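(* Let $d\in\{2,3\}$ and $r_0\in[0,d/2)$. There exists $\varepsilon>0$ such that the following holds. Let $T>0$, let $d/2+2-\varepsilon\le r\le s$, and let $u\in C([0,T];\dot Z_{s,r}(\mathbb{R}^d))$ be a solution of the initial value problem $$\partial_t u-\mathcal{R}_1\Delta u+u\,\partial_{x_1}u=0,\qquad u(x,0)=u_0(x),\qquad x\in\mathbb{R}^d .$$ Then $$|\nabla|^{-1}u\in C\big([0,T];L^2(|x|^{2r_0}\,dx)\big).$$
   Context: Functions $u=u(x,t)$ are real-valued. $\mathcal{R}_1=-\partial_{x_1}(-\Delta)^{-1/2}$ is the Riesz transform, the Fourier multiplier operator with symbol $-i\xi_1/|\xi|$, where $\widehat f(\xi)=\int_{\mathbb{R}^d}e^{-ix\cdot\xi}f(x)\,dx$. The operator $|\nabla|^{-1}$ is the Fourier multiplier with symbol $|\xi|^{-1}=(\xi_1^2+\dots+\xi_d^2)^{-1/2}$. $$\dot Z_{s,r}(\mathbb{R}^d)=\{f\in H^s(\mathbb{R}^d)\cap L^2(|x|^{2r}dx):\ \widehat f(0)=0\},$$ with norm $\|f\|_{H^s}+\||x|^rf\|_{L^2}$. Solutions are understood in the sense of Duhamel's formula $u(t)=e^{t\mathcal{R}_1\Delta}u_0-\int_0^te^{(t-\tau)\mathcal{R}_1\Delta}u(\tau)\partial_{x_1}u(\tau)\,d\tau$, where $e^{t\mathcal{R}_1\Delta}$ has Fourier symbol $e^{it\xi_1|\xi|}$. *)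

theory Defs
  imports "HOL-Analysis.Analysis"
begin

text \<open>
  Elements of function spaces are represented by Borel functions; equality in these spaces
  is equality almost everywhere.
\<close>

definition L2_norm :: "'a measure \<Rightarrow> ('a \<Rightarrow> 'b::real_normed_vector) \<Rightarrow> ennreal" where
  "L2_norm M f =
    (let I = (\<integral>\<^sup>+x. ennreal ((norm (f x))\<^sup>2) \<partial>M) in
     if I = \<infinity> then \<infinity> else ennreal (sqrt (enn2real I)))"

definition L2_space :: "'a measure \<Rightarrow> ('a \<Rightarrow> 'b::real_normed_vector) set" where
  "L2_space M = {f \<in> borel_measurable M. L2_norm M f < \<infinity>}"

definition power_weight :: "real \<Rightarrow> (real ^ 'n) measure" where
  "power_weight r = density lborel (\<lambda>x. ennreal (norm x powr (2 * r)))"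

definition bessel_weight :: "real \<Rightarrow> (real ^ 'n) measure" where
  "bessel_weight s = density lborel (\<lambda>\<xi>. ennreal ((1 + (norm \<xi>)\<^sup>2) powr s))"

definition fourier_integral :: "(real ^ 'n \<Rightarrow> real) \<Rightarrow> real ^ 'n \<Rightarrow> complex" where
  "fourier_integral f \<xi> =
    (LINT x|lborel. exp (- \<i> * complex_of_real (x \<bullet> \<xi>)) * complex_of_real (f x))"

text \<open>
  The Fourier transform on \<open>L\<^sup>2\<close>, as the \<open>L\<^sup>2\<close>-limit of the transforms of truncations. By
  Plancherel's theorem the limit exists for every \<open>f\<close> in \<open>L\<^sup>2\<close>; it is unique almost everywhere.
\<close>

definition fourier :: "(real ^ 'n \<Rightarrow> real) \<Rightarrow> real ^ 'n \<Rightarrow> complex" where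
  "fourier f = (SOME g. g \<in> L2_space lborel \<and>
    ((\<lambda>R::real. L2_norm lborel
        (\<lambda>\<xi>. g \<xi> - fourier_integral (\<lambda>x. indicator (ball 0 R) x * f x) \<xi>)) \<longlongrightarrow> 0) at_top)"

definition Hs_norm :: "real \<Rightarrow> (real ^ 'n \<Rightarrow> real) \<Rightarrow> ennreal" where
  "Hs_norm s f = L2_norm (bessel_weight s) (fourier f)"

definition Hs_space :: "real \<Rightarrow> (real ^ 'n \<Rightarrow> real) set" where
  "Hs_space s = {f \<in> L2_space lborel. Hs_norm s f < \<infinity>}"

text \<open>
  The value at the origin is that of the Fourier integral. For \<open>r > d/2\<close> the elements are
  integrable, so this is the value of the continuous representative of the transform. (For
  non-integrable functions the Bochner integral would be \<open>0\<close> by convention.)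
\<close>

definition Zdot_space :: "real \<Rightarrow> real \<Rightarrow> (real ^ 'n \<Rightarrow> real) set" where
  "Zdot_space s r =
    {f \<in> Hs_space s \<inter> L2_space (power_weight r). fourier_integral f 0 = 0}"

definition Zdot_norm :: "real \<Rightarrow> real \<Rightarrow> (real ^ 'n \<Rightarrow> real) \<Rightarrow> ennreal" where
  "Zdot_norm s r f = Hs_norm s f + L2_norm (power_weight r) f"

text \<open>\<open>C([0,T]; X)\<close> for a space \<open>X\<close> of functions with norm \<open>N\<close>.\<close>

definition C_into ::
    "real \<Rightarrow> ('a \<Rightarrow> real) set \<Rightarrow> (('a \<Rightarrow> real) \<Rightarrow> ennreal) \<Rightarrow> (real \<Rightarrow> 'a \<Rightarrow> real) set" where
  "C_into T X N = {u. \<forall>t\<in>{0..T}. u t \<in> X \<and>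
    ((\<lambda>t'. N (\<lambda>x. u t' x - u t x)) \<longlongrightarrow> 0) (at t within {0..T})}"

text \<open>
  \<open>is_multiplier m f g\<close>: \<open>f\<close> lies in the domain (in \<open>L\<^sup>2\<close>) of the Fourier multiplier operator
  with symbol \<open>m\<close> and \<open>g\<close> is its image. All symbols below satisfy \<open>m (- \<xi>) = cnj (m \<xi>)\<close> for
  \<open>\<xi> \<noteq> 0\<close>, so that the operators map real functions to real functions.
\<close>

definition is_multiplier ::
    "(real ^ 'n \<Rightarrow> complex) \<Rightarrow> (real ^ 'n \<Rightarrow> real) \<Rightarrow> (real ^ 'n \<Rightarrow> real) \<Rightarrow> bool" where
  "is_multiplier m f g \<longleftrightarrow> f \<in> L2_space lborel \<and> g \<in> L2_space lborel \<and>
    (AE \<xi> in lborel. fourier g \<xi> = m \<xi> * fourier f \<xi>)"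

text \<open>The index \<open>k\<close> designates the coordinate \<open>x\<^sub>1\<close>.\<close>

definition partial_symbol :: "'n \<Rightarrow> real ^ 'n \<Rightarrow> complex" where
  "partial_symbol k \<xi> = \<i> * complex_of_real (\<xi> $ k)"

definition propagator_symbol :: "'n \<Rightarrow> real \<Rightarrow> real ^ 'n \<Rightarrow> complex" where
  "propagator_symbol k t \<xi> = exp (\<i> * complex_of_real (t * (\<xi> $ k) * norm \<xi>))"

definition inv_nabla_symbol :: "real ^ 'n \<Rightarrow> complex" where
  "inv_nabla_symbol \<xi> = complex_of_real (1 / norm \<xi>)"

text \<open>
  The integral of an \<open>L\<^sup>2\<close>-valued function of time: \<open>has_integral\<close> with the norm of the (quotient)
  space \<open>L\<^sup>2\<close> in place of the norm of a type.
\<close>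

definition has_L2_integral ::
    "(real \<Rightarrow> real ^ 'n \<Rightarrow> real) \<Rightarrow> (real ^ 'n \<Rightarrow> real) \<Rightarrow> real \<Rightarrow> real \<Rightarrow> bool" where
  "has_L2_integral F I a b \<longleftrightarrow>
    (\<forall>\<tau>\<in>{a..b}. F \<tau> \<in> L2_space lborel) \<and> I \<in> L2_space lborel \<and>
    (\<forall>e::real. e > 0 \<longrightarrow> (\<exists>\<gamma>. gauge \<gamma> \<and>
      (\<forall>p. p tagged_division_of {a..b} \<and> \<gamma> fine p \<longrightarrow>
        L2_norm lborel (\<lambda>x. (\<Sum>(\<tau>, K)\<in>p. measure lborel K * F \<tau> x) - I x) < ennreal e)))"

text \<open>
  Solutions in the sense of Duhamel's formula. Here \<open>w \<tau>\<close> is the \<open>x\<^sub>1\<close>-derivative of \<open>u \<tau>\<close>,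
  \<open>g\<close> the free evolution of \<open>u0\<close>, \<open>h \<tau>\<close> the evolution over time \<open>t - \<tau>\<close> of the nonlinearity at
  time \<open>\<tau>\<close>, and \<open>I\<close> the time integral of \<open>h\<close>; all are determined up to null sets.
\<close>

definition duhamel_solution ::
    "'n \<Rightarrow> real \<Rightarrow> (real ^ 'n \<Rightarrow> real) \<Rightarrow> (real \<Rightarrow> real ^ 'n \<Rightarrow> real) \<Rightarrow> bool" where
  "duhamel_solution k T u0 u \<longleftrightarrow>
    (\<exists>w. (\<forall>\<tau>\<in>{0..T}. is_multiplier (partial_symbol k) (u \<tau>) (w \<tau>)) \<and>
      (\<forall>t\<in>{0..T}. \<exists>g h I.
        is_multiplier (propagator_symbol k t) u0 g \<and>
        (\<forall>\<tau>\<in>{0..t}.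
          is_multiplier (propagator_symbol k (t - \<tau>)) (\<lambda>x. u \<tau> x * w \<tau> x) (h \<tau>)) \<and>
        has_L2_integral h I 0 t \<and>
        (AE x in lborel. u t x = g x - I x)))"

end

theory Submission
  imports Defs "HOL-Probability.Characteristic_Functions"
begin

text \<open>
  The operator with symbol \<open>1 / |\<xi>|\<close> is linear, so the theorem follows once it is shown to be bounded
  from \<open>Zdot_space s r\<close>, with its norm, to \<open>L\<^sup>2\<close> with the weight \<open>|x|\<close> to the power \<open>2 r0\<close>. The bound is
  applied to \<open>u t\<close> and to the differences \<open>u t' - u t\<close>.

  Heuristically, the operator is convolution with a multiple of \<open>|x|\<close> to the power \<open>1 - d\<close>. Mean zero
  gains one power at infinity, where the image decays like \<open>|x|\<close> to the power \<open>-d\<close>; this is square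
  integrable against the weight precisely when \<open>r0 < d/2\<close>. The kernel is not locally square
  integrable, so small and large scales are separated. This is done by the identity
  \<open>1 / |\<xi>| = sqrt (2 / \<pi>) \<integral> exp (- s\<^sup>2 |\<xi>|\<^sup>2 / 2) ds\<close> over \<open>s > 0\<close>, which writes the operator as a superposition
  of convolutions with the normal densities of width \<open>s\<close>. For \<open>s \<le> 1\<close> the convolutions are bounded in
  the weighted norm by Jensen's inequality (\<open>heat_weighted_small\<close>). For \<open>s \<ge> 1\<close> mean zero replaces the
  density by a difference of two of its translates, whose weighted norm is at most a constant times
  \<open>s\<close> to the power \<open>-1-\<kappa>\<close>, with \<open>\<kappa> = min (d/2 - r0) (1/4) > 0\<close>, at the expense of the growth
  \<open>(1 + |y|)\<close> to the power \<open>7/4\<close> in the shift \<open>y\<close> (\<open>gauss_diff_weighted\<close>, \<open>heat_weighted_large\<close>). The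
  corresponding moment of \<open>f\<close> is finite by Cauchy--Schwarz when \<open>2 r > d + 7/2\<close>, that is, for
  \<open>\<epsilon> < 1/4\<close>. Both rates are integrable in \<open>s\<close>, which gives the bound
  (\<open>inv_nabla_weighted_bound\<close>); with exponent \<open>0\<close> it also gives membership in \<open>L\<^sup>2\<close>.

  Two facts about the Fourier transform connect this with the statement. That the superposition has
  the right transform (\<open>is_multiplier_inv_nabla\<close>) follows by truncating it to \<open>s \<le> n\<close>, where Fubini's
  theorem applies, and passing to the limit in \<open>L\<^sup>2\<close> (\<open>fourier_eq_L2_limit\<close>). And the norm of \<open>H\<^sup>s\<close>
  measures the transform, while the bound is in terms of the function. Both use Plancherel's theorem
  for functions in \<open>L\<^sup>1\<close> and \<open>L\<^sup>2\<close> (\<open>plancherel_le\<close>, \<open>plancherel_ge\<close>), obtained from a Parseval identity with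
  Gaussian damping (\<open>fourier_gauss_bilinear\<close>).
\<close>

section \<open>Gaussian densities\<close>

lemma Basis_vec_real: "(Basis :: (real ^ 'n::finite) set) = range (\<lambda>i. axis i 1)"
  by (auto simp: Basis_vec_def)

lemma inj_axis_one: "inj (\<lambda>i. axis i (1::real) :: real ^ 'n::finite)"
  by (auto simp: inj_on_def axis_eq_axis)

lemma prod_Basis_vec:
  fixes F :: "'n::finite \<Rightarrow> 'c::comm_monoid_mult"
  shows "(\<Prod>b\<in>(Basis :: (real ^ 'n) set). F (inv (\<lambda>i. axis i 1) b)) = (\<Prod>i\<in>UNIV. F i)"
  unfolding Basis_vec_real by (subst prod.reindex[OF inj_axis_one]) (simp add: inv_f_f[OF inj_axis_one] o_def)

lemma prod_Basis_vec_inner: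
  fixes f :: "'n::finite \<Rightarrow> real \<Rightarrow> 'c::comm_monoid_mult"
  shows "(\<Prod>b\<in>(Basis :: (real ^ 'n) set). f (inv (\<lambda>i. axis i 1) b) (x \<bullet> b)) = (\<Prod>i\<in>UNIV. f i (x $ i))"
  unfolding Basis_vec_real
  by (subst prod.reindex[OF inj_axis_one]) (simp add: inv_f_f[OF inj_axis_one] o_def inner_axis)

text \<open>
  Lebesgue measure is a product measure over the standard basis, whereas the coordinates of a
  vector are indexed by the type \<open>'n\<close>. The inverse of \<open>i \<mapsto> axis i 1\<close> translates one index set into
  the other.
\<close>

lemma
  fixes f :: "'n::finite \<Rightarrow> real \<Rightarrow> 'c::{real_normed_field,banach,second_countable_topology}"
  assumes f: "\<And>i. integrable lborel (f i)"
  shows integrable_prod_vec: "integrable lborel (\<lambda>x::real^'n. \<Prod>i\<in>UNIV. f i (x $ i))"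
    and integral_prod_vec: "(LINT x|lborel. (\<Prod>i\<in>UNIV. f i ((x::real^'n) $ i))) = (\<Prod>i\<in>UNIV. (LINT x|lborel. f i x))"
proof -
  let ?F = "\<lambda>b::real^'n. f (inv (\<lambda>i. axis i 1) b)"
  let ?P = "Pi\<^sub>M (Basis::(real^'n) set) (\<lambda>_. lborel :: real measure)"
  let ?T = "\<lambda>g::(real^'n) \<Rightarrow> real. \<Sum>b\<in>Basis. g b *\<^sub>R b"
  interpret product_sigma_finite "\<lambda>_::real^'n. lborel :: real measure" ..
  have T: "?T \<in> ?P \<rightarrow>\<^sub>M borel" by measurable
  have [measurable]: "f i \<in> borel_measurable borel" for i using f[of i] by auto
  have eq: "(\<Prod>i\<in>UNIV. f i ((?T g) $ i)) = (\<Prod>b\<in>Basis. ?F b (g b))" for g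
    unfolding prod_Basis_vec_inner[symmetric, of f] by (intro prod.cong) (simp_all only: inner_sum_left_Basis)
  have i: "integrable ?P (\<lambda>g. \<Prod>b\<in>Basis. ?F b (g b))"
    by (rule product_integrable_prod) (use f in auto)
  have meas: "(\<lambda>x::real^'n. \<Prod>i\<in>UNIV. f i (x $ i)) \<in> borel_measurable borel"
    by measurable
  show "integrable lborel (\<lambda>x::real^'n. \<Prod>i\<in>UNIV. f i (x $ i))"
    by (subst lborel_eq, subst integrable_distr_eq[OF T meas]) (simp only: eq i)
  have "(LINT x|lborel. (\<Prod>i\<in>UNIV. f i ((x::real^'n) $ i))) = (LINT g|?P. (\<Prod>b\<in>Basis. ?F b (g b)))"
    by (subst lborel_eq, subst integral_distr[OF T meas]) (simp only: eq)
  also have "\<dots> = (\<Prod>b\<in>Basis. (LINT x|lborel. ?F b x))"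
    by (rule product_integral_prod) (use f in auto)
  also have "\<dots> = (\<Prod>i\<in>UNIV. (LINT x|lborel. f i x))"
    by (rule prod_Basis_vec)
  finally show "(LINT x|lborel. (\<Prod>i\<in>UNIV. f i ((x::real^'n) $ i))) = (\<Prod>i\<in>UNIV. (LINT x|lborel. f i x))" .
qed

text \<open>
  The normal density with covariance \<open>\<sigma>\<^sup>2\<close> times the identity. In product form its integrals reduce
  to those of one real variable.
\<close>

definition gauss :: "real \<Rightarrow> real ^ 'n \<Rightarrow> real" where
  "gauss \<sigma> x = (\<Prod>i\<in>UNIV. normal_density 0 \<sigma> (x $ i))"

lemma borel_measurable_vec_nth [measurable (raw)]:
  assumes "f \<in> borel_measurable M"
  shows "(\<lambda>x. (f x :: real ^ 'n::finite) $ i) \<in> borel_measurable M"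
  using borel_measurable_inner[OF assms, of "\<lambda>_. axis i 1"] by (simp add: inner_axis)

lemma gauss_measurable [measurable]:
  "(\<lambda>p. gauss (fst p) (snd p)) \<in> borel_measurable (borel \<Otimes>\<^sub>M borel)"
  unfolding gauss_def normal_density_def by measurable

lemma gauss_measurable' [measurable (raw)]:
  assumes [measurable]: "s \<in> borel_measurable M" "f \<in> borel_measurable M"
  shows "(\<lambda>z. gauss (s z) (f z)) \<in> borel_measurable M"
  using measurable_compose[OF _ gauss_measurable, of "\<lambda>z. (s z, f z)" M] by simp

lemma norm_vec_power2: "(norm (x :: real ^ 'n::finite))\<^sup>2 = (\<Sum>i\<in>UNIV. (x $ i)\<^sup>2)"
  by (simp add: norm_vec_def L2_set_def sum_nonneg)

lemma gauss_eq:
  fixes x :: "real ^ 'n::finite"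
  assumes "\<sigma> > 0"
  shows "gauss \<sigma> x = exp (- (norm x)\<^sup>2 / (2 * \<sigma>\<^sup>2)) / (\<sigma> * sqrt (2 * pi)) ^ CARD('n)"
proof -
  have "gauss \<sigma> x = (\<Prod>i\<in>UNIV. exp (- (x $ i)\<^sup>2 / (2 * \<sigma>\<^sup>2)) / (\<sigma> * sqrt (2 * pi)))"
    using assms unfolding gauss_def normal_density_def
    by (intro prod.cong) (simp_all add: real_sqrt_mult)
  also have "\<dots> = exp (\<Sum>i\<in>UNIV. - (x $ i)\<^sup>2 / (2 * \<sigma>\<^sup>2)) / (\<sigma> * sqrt (2 * pi)) ^ CARD('n)"
    by (simp add: prod_dividef exp_sum)
  also have "(\<Sum>i\<in>UNIV. - (x $ i)\<^sup>2 / (2 * \<sigma>\<^sup>2)) = - (norm x)\<^sup>2 / (2 * \<sigma>\<^sup>2)"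
    by (simp add: norm_vec_power2 sum_divide_distrib sum_negf)
  finally show ?thesis .
qed

lemma gauss_nonneg [simp]: "0 \<le> gauss \<sigma> x"
  unfolding gauss_def by (intro prod_nonneg) auto

lemma integrable_gauss: "\<sigma> > 0 \<Longrightarrow> integrable lborel (gauss \<sigma> :: real ^ 'n::finite \<Rightarrow> real)"
  unfolding gauss_def by (rule integrable_prod_vec) auto

lemma integral_gauss: "\<sigma> > 0 \<Longrightarrow> (LINT x|lborel. gauss \<sigma> (x :: real ^ 'n::finite)) = 1"
  unfolding gauss_def by (subst integral_prod_vec) auto

lemma nn_integral_gauss: "\<sigma> > 0 \<Longrightarrow> (\<integral>\<^sup>+ x. ennreal (gauss \<sigma> (x :: real ^ 'n::finite)) \<partial>lborel) = 1"
  by (subst nn_integral_eq_integral) (auto simp: integrable_gauss integral_gauss)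

lemma lborel_translate: "distr lborel borel (\<lambda>x. x - y) = (lborel :: 'a::euclidean_space measure)"
proof -
  have "(\<lambda>x. x - y) = (+) (- y)" by (auto simp: fun_eq_iff)
  thus ?thesis by (simp only: lborel_distr_plus)
qed

lemma lborel_reflect:
  "distr lborel borel (\<lambda>x. y - x) = (lborel :: 'a::euclidean_space measure)"
proof -
  have "density (distr lborel borel (\<lambda>x. y + (-1) *\<^sub>R x)) (\<lambda>_. ennreal 1) = (lborel :: 'a measure)"
    using lborel_affine[of "-1" y] by simp
  thus ?thesis by (simp add: density_1)
qed

lemma nn_integral_translate:
  assumes [measurable]: "f \<in> borel_measurable borel"
  shows "(\<integral>\<^sup>+ x. f (x - y) \<partial>(lborel :: 'a::euclidean_space measure)) = (\<integral>\<^sup>+ x. f x \<partial>lborel)"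
  by (subst (2) lborel_translate[of y, symmetric], subst nn_integral_distr) auto

lemma nn_integral_reflect:
  assumes [measurable]: "f \<in> borel_measurable borel"
  shows "(\<integral>\<^sup>+ x. f (y - x) \<partial>(lborel :: 'a::euclidean_space measure)) = (\<integral>\<^sup>+ x. f x \<partial>lborel)"
  by (subst (2) lborel_reflect[of y, symmetric], subst nn_integral_distr) auto

text \<open>
  The substitution \<open>x = \<sigma> y\<close> reduces this to the characteristic function of the standard normal
  distribution.
\<close>

lemma integral_cexp_normal_density:
  assumes "\<sigma> > 0"
  shows "(LINT x|lborel. exp (- \<i> * complex_of_real (x * a)) * complex_of_real (normal_density 0 \<sigma> x))
     = exp (- complex_of_real ((\<sigma> * a)\<^sup>2 / 2))"
proof -
  have "(LINT x|lborel. exp (- \<i> * complex_of_real (x * a)) * complex_of_real (normal_density 0 \<sigma> x))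
    = \<sigma> *\<^sub>R (LINT y|lborel. exp (- \<i> * complex_of_real ((0 + \<sigma> * y) * a)) * complex_of_real (normal_density 0 \<sigma> (0 + \<sigma> * y)))"
    using assms by (subst lborel_integral_real_affine[of \<sigma> _ 0]) simp_all
  also have "\<dots> = (LINT y|lborel. \<sigma> *\<^sub>R (exp (- \<i> * complex_of_real ((0 + \<sigma> * y) * a)) * complex_of_real (normal_density 0 \<sigma> (0 + \<sigma> * y))))"
    by simp
  also have "\<dots> = (LINT y|lborel. std_normal_density y *\<^sub>R (iexp ((- \<sigma> * a) * y)))"
  proof (rule Bochner_Integration.integral_cong[OF refl])
    fix y
    have n: "\<sigma> * normal_density 0 \<sigma> (\<sigma> * y) = std_normal_density y"
      using assms by (simp add: normal_density_def real_sqrt_mult power_mult_distrib field_simps)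
    have e: "- \<i> * complex_of_real ((0 + \<sigma> * y) * a) = \<i> * complex_of_real ((- \<sigma> * a) * y)"
      by simp
    show "\<sigma> *\<^sub>R (exp (- \<i> * complex_of_real ((0 + \<sigma> * y) * a)) * complex_of_real (normal_density 0 \<sigma> (0 + \<sigma> * y))) =
       std_normal_density y *\<^sub>R (iexp ((- \<sigma> * a) * y))"
      unfolding e n[symmetric] scaleR_conv_of_real by simp
  qed
  also have "\<dots> = char std_normal_distribution (- \<sigma> * a)"
    unfolding char_def by (subst integral_density) (auto simp: normal_density_nonneg)
  also have "\<dots> = exp (- complex_of_real ((\<sigma> * a)\<^sup>2 / 2))"
    unfolding char_std_normal_distribution by (simp add: exp_of_real[symmetric])
  finally show ?thesis .
qed

lemma fourier_integral_gauss:
  fixes \<xi> :: "real ^ 'n::finite"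
  assumes "\<sigma> > 0"
  shows "fourier_integral (gauss \<sigma>) \<xi> = complex_of_real (exp (- (\<sigma> * norm \<xi>)\<^sup>2 / 2))"
proof -
  have *: "exp (- \<i> * complex_of_real (x \<bullet> \<xi>)) * complex_of_real (gauss \<sigma> x) =
     (\<Prod>i\<in>UNIV. exp (- \<i> * complex_of_real (x $ i * \<xi> $ i)) * complex_of_real (normal_density 0 \<sigma> (x $ i)))" for x
    by (simp add: gauss_def prod.distrib inner_vec_def exp_sum[symmetric] sum_distrib_left sum_negf)
  have int: "integrable lborel (\<lambda>x. exp (- \<i> * complex_of_real (x * a)) * complex_of_real (normal_density 0 \<sigma> x))" for a
    by (rule Bochner_Integration.integrable_bound[OF integrable_normal_density[of \<sigma> 0]])
       (auto simp: assms norm_mult)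
  have "fourier_integral (gauss \<sigma>) \<xi> = (\<Prod>i\<in>UNIV. exp (- complex_of_real ((\<sigma> * \<xi> $ i)\<^sup>2 / 2)))"
    unfolding fourier_integral_def *
    by (subst integral_prod_vec[where f="\<lambda>i x. exp (- \<i> * complex_of_real (x * \<xi> $ i)) * complex_of_real (normal_density 0 \<sigma> x)"])
       (simp_all only: int integral_cexp_normal_density[OF assms])
  also have "\<dots> = exp (\<Sum>i\<in>UNIV. (- complex_of_real ((\<sigma> * \<xi> $ i)\<^sup>2 / 2)))"
    by (simp add: exp_sum)
  also have "(\<Sum>i\<in>UNIV. (- complex_of_real ((\<sigma> * \<xi> $ i)\<^sup>2 / 2))) = complex_of_real (- (\<sigma> * norm \<xi>)\<^sup>2 / 2)"
    by (simp add: norm_vec_power2 power_mult_distrib sum_distrib_left sum_divide_distrib sum_negf)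
  finally show ?thesis by (simp only: exp_of_real)
qed

lemma powr_le_exp_square:
  fixes u p :: real
  assumes "0 \<le> p" "p \<le> 6" "0 \<le> u"
  shows "u powr p \<le> 385 * exp (u\<^sup>2 / 4)"
proof (cases "u \<le> 1")
  case True
  have "u powr p \<le> 1 powr p" using True assms by (intro powr_mono2) auto
  also have "\<dots> \<le> 385 * exp (u\<^sup>2 / 4)"
    using one_le_exp_iff[of "u\<^sup>2/4"] zero_le_power2[of u] by (simp only: powr_one_eq_one) linarith
  finally show ?thesis .
next
  case False
  have "u powr p \<le> u powr 6" using False assms by (intro powr_mono) auto
  also have "\<dots> = u ^ 6" using False by simp
  \<comment> \<open>The cubic term of the exponential series suffices, and \<open>384 = 4\<^sup>3 \<cdot> 3!\<close>.\<close>
  also have "\<dots> = 384 * ((u\<^sup>2/4) ^ 3 / fact 3)"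
    by (simp add: fact_numeral power_divide field_simps)
  also have "(u\<^sup>2/4) ^ 3 / fact 3 \<le> exp (u\<^sup>2/4)"
  proof -
    have "(\<Sum>n\<in>{3}. (u\<^sup>2/4)^n /\<^sub>R fact n) \<le> (\<Sum>n. (u\<^sup>2/4)^n /\<^sub>R fact n)"
      by (rule sum_le_suminf) (auto simp: summable_exp)
    moreover have "(\<Sum>n\<in>{3}. (u\<^sup>2/4)^n /\<^sub>R fact n) = (u\<^sup>2/4) ^ 3 / fact 3"
      by (simp add: field_simps)
    ultimately show ?thesis by (simp only: exp_def)
  qed
  finally have "u powr p \<le> 384 * exp (u\<^sup>2 / 4)" by simp
  thus ?thesis using exp_ge_zero[of "u\<^sup>2 / 4"] by linarith
qed

text \<open>
  With \<open>u = |x| / \<sigma>\<close>, the factor \<open>u\<^sup>p\<close> is absorbed by half of the Gaussian exponent. A power of \<open>|x|\<close>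
  thus costs the same power of \<open>\<sigma>\<close> and a slightly wider Gaussian.
\<close>

lemma gauss_weight_le:
  fixes x :: "real ^ 'n::finite"
  assumes "\<sigma> > 0" "0 \<le> p" "p \<le> 6"
  shows "norm x powr p * gauss \<sigma> x \<le> 385 * sqrt 2 ^ CARD('n) * \<sigma> powr p * gauss (sqrt 2 * \<sigma>) x"
proof -
  define u where "u = norm x / \<sigma>"
  have x: "norm x = \<sigma> * u" using assms by (simp add: u_def)
  have u: "0 \<le> u" using assms by (simp add: u_def)
  have "u powr p * exp (- u\<^sup>2 / 2) \<le> 385 * exp (u\<^sup>2 / 4) * exp (- u\<^sup>2 / 2)"
    using powr_le_exp_square[of p u] assms u by (intro mult_right_mono) auto
  also have "\<dots> = 385 * exp (- u\<^sup>2 / 4)" by (simp flip: exp_add)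
  finally have "u powr p * exp (- u\<^sup>2 / 2) \<le> 385 * exp (- u\<^sup>2 / 4)" .
  note * = this
  define K where "K = \<sigma> powr p / (\<sigma> * sqrt (2 * pi)) ^ CARD('n)"
  have "norm x powr p * gauss \<sigma> x = K * (u powr p * exp (- u\<^sup>2 / 2))"
    using assms u by (simp add: gauss_eq x powr_mult power_mult_distrib K_def)
  also have "\<dots> \<le> K * (385 * exp (- u\<^sup>2 / 4))"
    using assms * by (intro mult_left_mono) (auto simp: K_def)
  also have "\<dots> = 385 * sqrt 2 ^ CARD('n) * \<sigma> powr p * gauss (sqrt 2 * \<sigma>) x"
    using assms u by (simp add: gauss_eq x power_mult_distrib K_def)
  finally show ?thesis .
qed

lemma gauss_moment_le:
  assumes "\<sigma> > 0" "0 \<le> p" "p \<le> 6"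
  shows "(\<integral>\<^sup>+ x. ennreal (norm x powr p * gauss \<sigma> (x :: real ^ 'n::finite)) \<partial>lborel)
     \<le> ennreal (385 * sqrt 2 ^ CARD('n) * \<sigma> powr p)"
proof -
  have "(\<integral>\<^sup>+ x. ennreal (norm x powr p * gauss \<sigma> (x :: real ^ 'n)) \<partial>lborel)
     \<le> (\<integral>\<^sup>+ x. ennreal (385 * sqrt 2 ^ CARD('n) * \<sigma> powr p) * ennreal (gauss (sqrt 2 * \<sigma>) (x :: real ^ 'n)) \<partial>lborel)"
    by (intro nn_integral_mono)
       (use gauss_weight_le[OF assms] in \<open>auto simp: ennreal_mult[symmetric] intro!: ennreal_leI\<close>)
  also have "\<dots> = ennreal (385 * sqrt 2 ^ CARD('n) * \<sigma> powr p)"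
    using assms by (subst nn_integral_cmult) (auto simp: nn_integral_gauss)
  finally show ?thesis .
qed

section \<open>Plancherel's theorem\<close>

abbreviation lborel2 :: "('a::euclidean_space \<times> 'b::euclidean_space) measure" where
  "lborel2 \<equiv> lborel \<Otimes>\<^sub>M lborel"

lemma integrable_pair_mult:
  fixes a :: "'a \<Rightarrow> 'c::{real_normed_field,banach,second_countable_topology}"
  assumes "sigma_finite_measure M" "sigma_finite_measure N" "integrable M a" "integrable N b"
  shows "integrable (M \<Otimes>\<^sub>M N) (\<lambda>p. a (fst p) * b (snd p))"
    and "(LINT p|(M \<Otimes>\<^sub>M N). a (fst p) * b (snd p)) = (LINT x|M. a x) * (LINT y|N. b y)"
proof -
  interpret M: sigma_finite_measure M by fact
  interpret N: sigma_finite_measure N by fact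
  interpret pair_sigma_finite M N ..
  have [measurable]: "a \<in> borel_measurable M" "b \<in> borel_measurable N" using assms by auto
  show i: "integrable (M \<Otimes>\<^sub>M N) (\<lambda>p. a (fst p) * b (snd p))"
    by (rule Fubini_integrable) (use assms in \<open>auto simp: norm_mult\<close>)
  show "(LINT p|(M \<Otimes>\<^sub>M N). a (fst p) * b (snd p)) = (LINT x|M. a x) * (LINT y|N. b y)"
    by (subst integral_fst'[symmetric, OF i]) simp
qed

lemma integrable_fourier_kernel:
  assumes "integrable lborel f"
  shows "integrable lborel (\<lambda>x. exp (- \<i> * complex_of_real (x \<bullet> \<xi>)) * complex_of_real (f x))"
proof -
  have [measurable]: "f \<in> borel_measurable borel" using assms by auto
  show ?thesis
    by (rule Bochner_Integration.integrable_bound[OF assms]) (auto simp: norm_mult)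
qed

lemma fourier_integral_measurable [measurable]:
  assumes [measurable]: "f \<in> borel_measurable borel"
  shows "fourier_integral f \<in> borel_measurable borel"
  unfolding fourier_integral_def by measurable

lemma norm_fourier_integral_le:
  "norm (fourier_integral f \<xi>) \<le> (LINT x|lborel. \<bar>f x\<bar>)"
proof -
  have "norm (fourier_integral f \<xi>) \<le>
    (LINT x|lborel. norm (exp (- \<i> * complex_of_real (x \<bullet> \<xi>)) * complex_of_real (f x)))"
    unfolding fourier_integral_def by (rule integral_norm_bound)
  thus ?thesis by (simp add: norm_mult)
qed

lemma fourier_integral_diff:
  assumes "integrable lborel f" "integrable lborel h"
  shows "fourier_integral (\<lambda>x. f x - h x) \<xi> = fourier_integral f \<xi> - fourier_integral h \<xi>"
  unfolding fourier_integral_def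
  by (subst Bochner_Integration.integral_diff[symmetric, OF assms[THEN integrable_fourier_kernel]])
     (simp add: algebra_simps)

lemma cnj_fourier_integral:
  "cnj (fourier_integral f \<xi>) = (LINT x|lborel. exp (\<i> * complex_of_real (x \<bullet> \<xi>)) * complex_of_real (f x))"
proof -
  have "cnj (fourier_integral f \<xi>) = (LINT x|lborel. cnj (exp (- \<i> * complex_of_real (x \<bullet> \<xi>)) * complex_of_real (f x)))"
    unfolding fourier_integral_def by (rule Bochner_Integration.integral_cnj[symmetric])
  thus ?thesis by (simp add: exp_cnj)
qed

text \<open>
  Parseval's identity with Gaussian damping. The damping makes the triple integral in
  \<open>\<xi>\<close>, \<open>x\<close> and \<open>y\<close> absolutely convergent; integrating out \<open>\<xi>\<close> first leaves the transform of a
  Gaussian at \<open>x - y\<close>. Both halves of Plancherel's theorem follow as \<open>\<epsilon>\<close> tends to \<open>0\<close>.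
\<close>

lemma fourier_gauss_bilinear:
  fixes f h :: "real ^ 'n::finite \<Rightarrow> real"
  assumes f: "integrable lborel f" and h: "integrable lborel h" and e: "\<epsilon> > 0"
  shows "(LINT \<xi>|lborel. fourier_integral f \<xi> * cnj (fourier_integral h \<xi>) * complex_of_real (exp (- (\<epsilon> * norm \<xi>)\<^sup>2 / 2)))
     = complex_of_real ((2 * pi) ^ CARD('n) * (LINT p|lborel2. f (fst p) * h (snd p) * gauss \<epsilon> (fst p - snd p)))"
proof -
  have s2: "sigma_finite_measure (lborel2 :: ((real^'n) \<times> (real^'n)) measure)"
    by (simp add: lborel_prod sigma_finite_lborel)
  interpret P: pair_sigma_finite "lborel :: (real^'n) measure" "lborel2 :: ((real^'n) \<times> (real^'n)) measure"
    using s2 by (simp add: pair_sigma_finite_def sigma_finite_lborel)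
  have [measurable]: "f \<in> borel_measurable borel" "h \<in> borel_measurable borel" using f h by auto
  \<comment> \<open>The damping factor is a multiple of the Gaussian of reciprocal width.\<close>
  define \<sigma> where "\<sigma> = 1 / \<epsilon>"
  have s: "\<sigma> > 0" using e by (simp add: \<sigma>_def)
  define K where "K = (sqrt (2 * pi) / \<epsilon>) ^ CARD('n)"
  have g1: "exp (- (\<epsilon> * norm \<xi>)\<^sup>2 / 2) = K * gauss \<sigma> \<xi>" for \<xi> :: "real^'n"
    unfolding gauss_eq[OF s] using e by (simp add: K_def \<sigma>_def power_mult_distrib power_divide field_simps)
  have g2: "K * exp (- (\<sigma> * norm x)\<^sup>2 / 2) = (2 * pi) ^ CARD('n) * gauss \<epsilon> x" for x :: "real^'n"
  proof -
    have "K = (2 * pi) ^ CARD('n) / (\<epsilon> * sqrt (2 * pi)) ^ CARD('n)"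
    proof -
      have "sqrt (2 * pi) / \<epsilon> = 2 * pi / (\<epsilon> * sqrt (2 * pi))"
        using e by (simp add: field_simps)
      thus ?thesis unfolding K_def power_divide[symmetric] by simp
    qed
    thus ?thesis using e by (simp add: gauss_eq[OF e] \<sigma>_def power_divide)
  qed
  define \<Phi> where "\<Phi> = (\<lambda>\<xi> p. complex_of_real (K * gauss \<sigma> \<xi>) *
     ((exp (- \<i> * complex_of_real (fst p \<bullet> \<xi>)) * complex_of_real (f (fst p))) *
      (exp (\<i> * complex_of_real (snd p \<bullet> \<xi>)) * complex_of_real (h (snd p)))))"
  have int: "integrable (lborel \<Otimes>\<^sub>M lborel2) (\<lambda>(\<xi>, p). \<Phi> \<xi> p)"
  proof (rule Bochner_Integration.integrable_bound)
    show "integrable (lborel \<Otimes>\<^sub>M lborel2)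
       (\<lambda>q. (K * gauss \<sigma> (fst q :: real^'n)) * (f (fst (snd q)) * h (snd (snd q))))"
      using integrable_pair_mult(1)[OF sigma_finite_lborel s2, of "\<lambda>\<xi>::real^'n. K * gauss \<sigma> \<xi>" "\<lambda>p. f (fst p) * h (snd p)"]
        integrable_pair_mult(1)[OF sigma_finite_lborel sigma_finite_lborel f h] integrable_gauss[OF s, where 'n='n]
      by simp
    show "(\<lambda>(\<xi>, p). \<Phi> \<xi> p) \<in> borel_measurable (lborel \<Otimes>\<^sub>M lborel2)"
      unfolding \<Phi>_def by measurable
  qed (auto simp: \<Phi>_def norm_mult abs_mult)
  have inner: "(LINT p|lborel2. \<Phi> \<xi> p) = fourier_integral f \<xi> * cnj (fourier_integral h \<xi>) * complex_of_real (exp (- (\<epsilon> * norm \<xi>)\<^sup>2 / 2))" for \<xi>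
  proof -
    have h': "integrable lborel (\<lambda>x. exp (\<i> * complex_of_real (x \<bullet> \<xi>)) * complex_of_real (h x))"
      using integrable_fourier_kernel[OF h, of "- \<xi>"] by simp
    show ?thesis
      unfolding \<Phi>_def integral_mult_right_zero g1
      by (subst integrable_pair_mult(2)[OF sigma_finite_lborel sigma_finite_lborel integrable_fourier_kernel[OF f] h'])
         (simp add: cnj_fourier_integral fourier_integral_def[of f])
  qed
  have outer: "(LINT \<xi>|lborel. \<Phi> \<xi> p) = complex_of_real ((2 * pi) ^ CARD('n) * (f (fst p) * h (snd p) * gauss \<epsilon> (fst p - snd p)))" for p
  proof -
    have "\<Phi> \<xi> p = complex_of_real (K * f (fst p) * h (snd p)) *
        (exp (- \<i> * complex_of_real (\<xi> \<bullet> (fst p - snd p))) * complex_of_real (gauss \<sigma> \<xi>))" for \<xi>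
      by (simp add: \<Phi>_def inner_diff_left inner_diff_right inner_commute algebra_simps exp_add[symmetric] exp_diff exp_minus divide_inverse)
    hence "(LINT \<xi>|lborel. \<Phi> \<xi> p) = complex_of_real (K * f (fst p) * h (snd p)) * fourier_integral (gauss \<sigma>) (fst p - snd p)"
      by (simp add: fourier_integral_def)
    also have "\<dots> = complex_of_real (f (fst p) * h (snd p) * (K * exp (- (\<sigma> * norm (fst p - snd p))\<^sup>2 / 2)))"
      unfolding fourier_integral_gauss[OF s] by simp
    finally show ?thesis unfolding g2 by (simp add: algebra_simps)
  qed
  have "(LINT \<xi>|lborel. (LINT p|lborel2. \<Phi> \<xi> p)) = (LINT p|lborel2. (LINT \<xi>|lborel. \<Phi> \<xi> p))"
    by (rule P.Fubini_integral[OF int, symmetric])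
  thus ?thesis unfolding inner outer integral_complex_of_real by simp
qed

lemma nn_integral_gauss_shift:
  assumes "\<sigma> > 0"
  shows "(\<integral>\<^sup>+ x. ennreal (gauss \<sigma> (x - y :: real ^ 'n::finite)) \<partial>lborel) = 1"
    and "(\<integral>\<^sup>+ x. ennreal (gauss \<sigma> (y - x :: real ^ 'n::finite)) \<partial>lborel) = 1"
  using nn_integral_translate[of "\<lambda>x. ennreal (gauss \<sigma> x)" y] nn_integral_reflect[of "\<lambda>x. ennreal (gauss \<sigma> x)" y]
  by (simp_all add: nn_integral_gauss[OF assms])

text \<open>
  Schur's test: \<open>|f x f y|\<close> is at most the mean of the squares, and the kernel has mass \<open>1\<close> in each
  variable.
\<close>

lemma gauss_quadratic_form_le:
  fixes f :: "real ^ 'n::finite \<Rightarrow> real"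
  assumes [measurable]: "f \<in> borel_measurable borel" and f2: "integrable lborel (\<lambda>x. (f x)\<^sup>2)" and e: "\<epsilon> > 0"
  shows "\<bar>LINT p|lborel2. f (fst p) * f (snd p) * gauss \<epsilon> (fst p - snd p)\<bar> \<le> (LINT x|lborel. (f x)\<^sup>2)"
proof -
  let ?I = "LINT p|lborel2. f (fst p) * f (snd p) * gauss \<epsilon> (fst p - snd p)"
  have "ennreal (norm ?I) \<le> (\<integral>\<^sup>+ p. ennreal (norm (f (fst p) * f (snd p) * gauss \<epsilon> (fst p - snd p))) \<partial>lborel2)"
  proof (cases "integrable lborel2 (\<lambda>p. f (fst p) * f (snd p) * gauss \<epsilon> (fst p - snd p))")
    case True
    thus ?thesis by (rule integral_norm_bound_ennreal)
  next
    case False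
    hence "?I = 0" by (rule not_integrable_integral_eq)
    thus ?thesis by (simp only: norm_zero ennreal_0 zero_le)
  qed
  also have "\<dots> \<le> (\<integral>\<^sup>+ p. ennreal ((f (fst p))\<^sup>2 / 2) * ennreal (gauss \<epsilon> (fst p - snd p)) +
       ennreal ((f (snd p))\<^sup>2 / 2) * ennreal (gauss \<epsilon> (fst p - snd p)) \<partial>lborel2)"
  proof (rule nn_integral_mono)
    fix p :: "(real^'n) \<times> (real^'n)"
    have "\<bar>f (fst p) * f (snd p)\<bar> \<le> (f (fst p))\<^sup>2 / 2 + (f (snd p))\<^sup>2 / 2"
      using sum_squares_bound[of "\<bar>f (fst p)\<bar>" "\<bar>f (snd p)\<bar>"] by (simp add: abs_mult power2_eq_square)
    hence "\<bar>f (fst p) * f (snd p)\<bar> * gauss \<epsilon> (fst p - snd p) \<le>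
        ((f (fst p))\<^sup>2 / 2 + (f (snd p))\<^sup>2 / 2) * gauss \<epsilon> (fst p - snd p)"
      by (intro mult_right_mono) auto
    thus "ennreal (norm (f (fst p) * f (snd p) * gauss \<epsilon> (fst p - snd p))) \<le>
       ennreal ((f (fst p))\<^sup>2 / 2) * ennreal (gauss \<epsilon> (fst p - snd p)) +
       ennreal ((f (snd p))\<^sup>2 / 2) * ennreal (gauss \<epsilon> (fst p - snd p))"
      by (simp add: ennreal_mult[symmetric] ennreal_plus[symmetric] abs_mult algebra_simps ennreal_leI del: ennreal_plus)
  qed
  also have "\<dots> = (\<integral>\<^sup>+ p. ennreal ((f (fst p))\<^sup>2 / 2) * ennreal (gauss \<epsilon> (fst p - snd p)) \<partial>lborel2) +
       (\<integral>\<^sup>+ p. ennreal ((f (snd p))\<^sup>2 / 2) * ennreal (gauss \<epsilon> (fst p - snd p)) \<partial>lborel2)"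
    by (rule nn_integral_add) measurable
  also have "(\<integral>\<^sup>+ p. ennreal ((f (fst p))\<^sup>2 / 2) * ennreal (gauss \<epsilon> (fst p - snd p)) \<partial>lborel2) = (\<integral>\<^sup>+ x. ennreal ((f x)\<^sup>2 / 2) \<partial>lborel)"
    by (subst lborel.nn_integral_fst[symmetric]) (simp_all add: nn_integral_cmult nn_integral_gauss_shift[OF e])
  also have "(\<integral>\<^sup>+ p. ennreal ((f (snd p))\<^sup>2 / 2) * ennreal (gauss \<epsilon> (fst p - snd p)) \<partial>lborel2) = (\<integral>\<^sup>+ x. ennreal ((f x)\<^sup>2 / 2) \<partial>lborel)"
    by (subst lborel_pair.nn_integral_snd[symmetric]) (simp_all add: nn_integral_cmult nn_integral_gauss_shift[OF e])
  also have "(\<integral>\<^sup>+ x. ennreal ((f x)\<^sup>2 / 2) \<partial>lborel) = ennreal ((LINT x|lborel. (f x)\<^sup>2) / 2)"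
    using f2 by (subst nn_integral_eq_integral) auto
  also have "ennreal ((LINT x|lborel. (f x)\<^sup>2) / 2) + ennreal ((LINT x|lborel. (f x)\<^sup>2) / 2) = ennreal (LINT x|lborel. (f x)\<^sup>2)"
    by (subst ennreal_plus[symmetric]) auto
  finally show ?thesis by simp
qed

text \<open>
  The damped integrals are bounded uniformly in \<open>\<epsilon>\<close>, so Fatou's lemma removes the damping.
\<close>

lemma plancherel_le_aux:
  fixes f :: "real ^ 'n::finite \<Rightarrow> real"
  assumes f: "integrable lborel f" and f2: "integrable lborel (\<lambda>x. (f x)\<^sup>2)"
  shows "(\<integral>\<^sup>+ \<xi>. ennreal ((norm (fourier_integral f \<xi>))\<^sup>2) \<partial>lborel) \<le> ennreal ((2 * pi) ^ CARD('n) * (LINT x|lborel. (f x)\<^sup>2))"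
proof -
  have [measurable]: "f \<in> borel_measurable borel" using f by auto
  let ?C = "(2 * pi) ^ CARD('n) * (LINT x|lborel. (f x)\<^sup>2)"
  define e where "e n = 1 / real (Suc n)" for n
  have e: "e n > 0" for n by (simp add: e_def)
  define u where "u n \<xi> = (norm (fourier_integral f \<xi>))\<^sup>2 * exp (- (e n * norm \<xi>)\<^sup>2 / 2)" for n \<xi>
  have lim: "(\<lambda>n. u n \<xi>) \<longlonglongrightarrow> (norm (fourier_integral f \<xi>))\<^sup>2" for \<xi>
  proof -
    have "e \<longlonglongrightarrow> 0" unfolding e_def using LIMSEQ_inverse_real_of_nat by (simp add: inverse_eq_divide)
    hence "(\<lambda>n. u n \<xi>) \<longlonglongrightarrow> (norm (fourier_integral f \<xi>))\<^sup>2 * exp (- (0 * norm \<xi>)\<^sup>2 / 2)"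
      unfolding u_def by (intro tendsto_intros) auto
    thus ?thesis by simp
  qed
  have bound: "(\<integral>\<^sup>+ \<xi>. ennreal (u n \<xi>) \<partial>lborel) \<le> ennreal ?C" for n
  proof -
    let ?B = "LINT x|lborel. \<bar>f x\<bar>"
    have eg: "exp (- (e n * norm \<xi>)\<^sup>2 / 2) = (sqrt (2 * pi) / e n) ^ CARD('n) * gauss (1 / e n) \<xi>" for \<xi> :: "real^'n"
      using e[of n] by (simp add: gauss_eq power_mult_distrib power_divide field_simps)
    have B: "(norm (fourier_integral f \<xi>))\<^sup>2 \<le> ?B\<^sup>2" for \<xi>
      by (intro power_mono norm_fourier_integral_le) auto
    have int: "integrable lborel (u n)"
    proof (rule Bochner_Integration.integrable_bound)
      show "integrable lborel (\<lambda>\<xi>::real^'n. ?B\<^sup>2 * ((sqrt (2 * pi) / e n) ^ CARD('n) * gauss (1 / e n) \<xi>))"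
        using e[of n] by (intro integrable_mult_right integrable_gauss) auto
      show "u n \<in> borel_measurable lborel" unfolding u_def by measurable
      show "AE \<xi> in lborel. norm (u n \<xi>) \<le> norm (?B\<^sup>2 * ((sqrt (2 * pi) / e n) ^ CARD('n) * gauss (1 / e n) \<xi>))"
        unfolding eg[symmetric] u_def using B by (auto simp: intro!: mult_right_mono)
    qed
    have "complex_of_real (LINT \<xi>|lborel. u n \<xi>) = (LINT \<xi>|lborel. fourier_integral f \<xi> * cnj (fourier_integral f \<xi>) * complex_of_real (exp (- (e n * norm \<xi>)\<^sup>2 / 2)))"
      unfolding integral_complex_of_real[symmetric] u_def
      by (intro Bochner_Integration.integral_cong) (auto simp only: of_real_mult complex_norm_square of_real_power[symmetric])
    also have "\<dots> = complex_of_real ((2 * pi) ^ CARD('n) * (LINT p|lborel2. f (fst p) * f (snd p) * gauss (e n) (fst p - snd p)))"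
      by (rule fourier_gauss_bilinear[OF f f e])
    finally have "(LINT \<xi>|lborel. u n \<xi>) = (2 * pi) ^ CARD('n) * (LINT p|lborel2. f (fst p) * f (snd p) * gauss (e n) (fst p - snd p))"
      by (simp only: of_real_eq_iff)
    also have "\<dots> \<le> ?C"
      using gauss_quadratic_form_le[OF _ f2 e[of n]] by (intro mult_left_mono) auto
    finally show ?thesis
      using int by (subst nn_integral_eq_integral) (auto intro!: ennreal_leI, simp add: u_def)
  qed
  have "(\<integral>\<^sup>+ \<xi>. ennreal ((norm (fourier_integral f \<xi>))\<^sup>2) \<partial>lborel) = (\<integral>\<^sup>+ \<xi>. liminf (\<lambda>n. ennreal (u n \<xi>)) \<partial>lborel)"
    by (intro nn_integral_cong lim_imp_Liminf[symmetric] tendsto_ennrealI lim) auto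
  also have "\<dots> \<le> liminf (\<lambda>n. \<integral>\<^sup>+ \<xi>. ennreal (u n \<xi>) \<partial>lborel)"
    by (rule nn_integral_liminf) (auto simp: u_def)
  also have "\<dots> \<le> ennreal ?C"
    using bound by (intro Liminf_le) auto
  finally show ?thesis .
qed

lemma plancherel_le:
  fixes f :: "real ^ 'n::finite \<Rightarrow> real"
  assumes f: "integrable lborel f" and f2: "integrable lborel (\<lambda>x. (f x)\<^sup>2)"
  shows "integrable lborel (\<lambda>\<xi>. (norm (fourier_integral f \<xi>))\<^sup>2)"
    and "(LINT \<xi>|lborel. (norm (fourier_integral f \<xi>))\<^sup>2) \<le> (2 * pi) ^ CARD('n) * (LINT x|lborel. (f x)\<^sup>2)"
proof -
  have [measurable]: "f \<in> borel_measurable borel" using f by auto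
  show i: "integrable lborel (\<lambda>\<xi>. (norm (fourier_integral f \<xi>))\<^sup>2)"
    using plancherel_le_aux[OF assms] by (intro integrableI_bounded) (auto simp: less_top[symmetric] top_unique)
  show "(LINT \<xi>|lborel. (norm (fourier_integral f \<xi>))\<^sup>2) \<le> (2 * pi) ^ CARD('n) * (LINT x|lborel. (f x)\<^sup>2)"
    using plancherel_le_aux[OF assms] by (subst (asm) nn_integral_eq_integral[OF i]) (auto simp: mult_nonneg_nonneg)
qed

lemma cauchy_schwarz_integral:
  fixes a b :: "'a \<Rightarrow> real"
  assumes [measurable]: "a \<in> borel_measurable M" "b \<in> borel_measurable M"
    and a2: "integrable M (\<lambda>x. (a x)\<^sup>2)" and b2: "integrable M (\<lambda>x. (b x)\<^sup>2)"
  shows "integrable M (\<lambda>x. a x * b x)"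
    and "(LINT x|M. \<bar>a x * b x\<bar>)\<^sup>2 \<le> (LINT x|M. (a x)\<^sup>2) * (LINT x|M. (b x)\<^sup>2)"
proof -
  show i: "integrable M (\<lambda>x. a x * b x)"
  proof (rule Bochner_Integration.integrable_bound)
    show "integrable M (\<lambda>x. ((a x)\<^sup>2 + (b x)\<^sup>2) / 2)" using a2 b2 by simp
    show "AE x in M. norm (a x * b x) \<le> norm (((a x)\<^sup>2 + (b x)\<^sup>2) / 2)"
      using sum_squares_bound[of "\<bar>a x\<bar>" "\<bar>b x\<bar>" for x]
      by (auto simp: abs_mult) (simp add: field_simps)
  qed simp
  have "(\<integral>\<^sup>+x. ennreal \<bar>a x\<bar> * ennreal \<bar>b x\<bar> \<partial>M)\<^sup>2 \<le> (\<integral>\<^sup>+x. (ennreal \<bar>a x\<bar>)\<^sup>2 \<partial>M) * (\<integral>\<^sup>+x. (ennreal \<bar>b x\<bar>)\<^sup>2 \<partial>M)"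
    by (rule Cauchy_Schwarz_nn_integral) measurable
  also have "(\<integral>\<^sup>+x. ennreal \<bar>a x\<bar> * ennreal \<bar>b x\<bar> \<partial>M) = ennreal (LINT x|M. \<bar>a x * b x\<bar>)"
    using integrable_abs[OF i] by (subst nn_integral_eq_integral[symmetric]) (auto simp: abs_mult ennreal_mult)
  also have "(\<integral>\<^sup>+x. (ennreal \<bar>a x\<bar>)\<^sup>2 \<partial>M) = ennreal (LINT x|M. (a x)\<^sup>2)"
    using a2 by (subst nn_integral_eq_integral[symmetric]) (auto simp: ennreal_power)
  also have "(\<integral>\<^sup>+x. (ennreal \<bar>b x\<bar>)\<^sup>2 \<partial>M) = ennreal (LINT x|M. (b x)\<^sup>2)"
    using b2 by (subst nn_integral_eq_integral[symmetric]) (auto simp: ennreal_power)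
  finally show "(LINT x|M. \<bar>a x * b x\<bar>)\<^sup>2 \<le> (LINT x|M. (a x)\<^sup>2) * (LINT x|M. (b x)\<^sup>2)"
    by (simp add: ennreal_power ennreal_mult[symmetric])
qed

lemma gauss_scale:
  fixes z :: "real ^ 'n::finite"
  assumes "\<epsilon> > 0"
  shows "\<epsilon> ^ CARD('n) * gauss \<epsilon> (\<epsilon> *\<^sub>R z) = gauss 1 z"
  using assms by (simp add: gauss_eq power_mult_distrib)

lemma gauss_minus [simp]: "gauss \<sigma> (- x) = gauss \<sigma> x"
  by (simp add: gauss_def normal_density_def)

lemma gauss_le:
  fixes z :: "real ^ 'n::finite"
  assumes "\<epsilon> > 0"
  shows "gauss \<epsilon> z \<le> 1 / (\<epsilon> * sqrt (2 * pi)) ^ CARD('n)"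
  using assms by (simp add: gauss_eq divide_right_mono)

lemma integral_conv_gauss:
  fixes x :: "real ^ 'n::finite"
  assumes [measurable]: "\<phi> \<in> borel_measurable borel" and e: "\<epsilon> > 0"
  shows "(LINT y|lborel. \<phi> y * gauss \<epsilon> (x - y)) = (LINT z|lborel. \<phi> (x + \<epsilon> *\<^sub>R z) * gauss 1 z)"
proof -
  have "(LINT y|lborel. \<phi> y * gauss \<epsilon> (x - y)) =
     (LINT y|density (distr lborel borel (\<lambda>z. x + \<epsilon> *\<^sub>R z)) (\<lambda>_. ennreal (\<bar>\<epsilon>\<bar> ^ DIM(real^'n))). \<phi> y * gauss \<epsilon> (x - y))"
    using e by (subst lborel_affine[of \<epsilon> x]) auto
  also have "\<dots> = (LINT z|lborel. \<epsilon> ^ CARD('n) * (\<phi> (x + \<epsilon> *\<^sub>R z) * gauss \<epsilon> (- (\<epsilon> *\<^sub>R z))))"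
    using e by (subst integral_density) (auto simp: integral_distr)
  also have "\<dots> = (LINT z|lborel. \<phi> (x + \<epsilon> *\<^sub>R z) * gauss 1 z)"
    unfolding gauss_scale[OF e, symmetric] by (simp add: mult.assoc mult.left_commute)
  finally show ?thesis .
qed

text \<open>
  Gaussians are an approximate identity. In the scaled variable \<open>z = (y - x) / \<epsilon>\<close> the kernel is fixed,
  and continuity of \<open>\<phi>\<close> suffices for dominated convergence.
\<close>

lemma gauss_pairing_tendsto:
  fixes f \<phi> :: "real ^ 'n::finite \<Rightarrow> real"
  assumes f: "integrable lborel f" and phi: "integrable lborel \<phi>"
    and cont: "continuous_on UNIV \<phi>" and bd: "\<And>x. \<bar>\<phi> x\<bar> \<le> M"
  shows "(\<lambda>n. LINT p|lborel2. f (fst p) * \<phi> (snd p) * gauss (1 / real (Suc n)) (fst p - snd p))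
     \<longlonglongrightarrow> (LINT x|lborel. f x * \<phi> x)"
proof -
  define e where "e n = 1 / real (Suc n)" for n
  let ?A = "\<lambda>n p. f (fst p) * \<phi> (snd p) * gauss (e n) (fst p - snd p)" and ?B = "\<lambda>n p. f (fst p) * \<phi> (fst p + e n *\<^sub>R snd p) * gauss 1 (snd p :: real^'n)"
  have e: "e n > 0" for n by (simp add: e_def)
  have e0: "e \<longlonglongrightarrow> 0" unfolding e_def using LIMSEQ_inverse_real_of_nat by (simp add: inverse_eq_divide)
  have [measurable]: "f \<in> borel_measurable borel" "\<phi> \<in> borel_measurable borel" using f phi by auto
  have M: "0 \<le> M" using bd[of 0] by linarith
  have bdm: "norm (a * \<phi> y * c) \<le> norm (M * a * c)" for a c y
    using mult_right_mono[OF bd, of "\<bar>a * c\<bar>" y] M by (simp add: abs_mult mult_ac)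
  have dom: "integrable lborel2 (\<lambda>p. (M * f (fst p)) * gauss 1 (snd p :: real^'n))"
    by (rule integrable_pair_mult) (auto simp: sigma_finite_lborel f integrable_gauss)
  have int2: "integrable lborel2 (\<lambda>p. ?B n p)" for n
  proof (rule Bochner_Integration.integrable_bound[OF dom])
    show "AE p in lborel2. norm (?B n p) \<le> norm (M * f (fst p) * gauss 1 (snd p))"
      by (intro AE_I2 bdm)
  qed measurable
  have eq: "(LINT p|lborel2. ?A n p) =
     (LINT p|lborel2. ?B n p)" for n
  proof -
    let ?K = "1 / (e n * sqrt (2 * pi)) ^ CARD('n)"
    have int1: "integrable lborel2 (\<lambda>p. ?A n p)"
    proof (rule Bochner_Integration.integrable_bound)
      show "integrable lborel2 (\<lambda>p. ?K * (f (fst p) * \<phi> (snd p)))"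
        by (intro integrable_mult_right integrable_pair_mult) (auto simp: sigma_finite_lborel f phi)
      have "gauss (e n) y \<le> \<bar>?K\<bar>" for y :: "real^'n"
        using gauss_le[OF e, of n y] by linarith
      note * = this
      show "AE p in lborel2. norm (?A n p) \<le> norm (?K * (f (fst p) * \<phi> (snd p)))"
      proof (intro AE_I2)
        fix p :: "(real^'n) \<times> (real^'n)"
        have "\<bar>f (fst p) * \<phi> (snd p)\<bar> * gauss (e n) (fst p - snd p) \<le> \<bar>f (fst p) * \<phi> (snd p)\<bar> * \<bar>?K\<bar>"
          by (rule mult_left_mono[OF *]) simp
        thus "norm (?A n p) \<le> norm (?K * (f (fst p) * \<phi> (snd p)))"
          by (simp only: real_norm_def abs_mult[of ?K] abs_mult[of _ "gauss _ _"] abs_of_nonneg[OF gauss_nonneg] mult.commute[of "\<bar>?K\<bar>"])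
      qed
    qed measurable
    have "(LINT p|lborel2. ?A n p) =
       (LINT x|lborel. (LINT y|lborel. f x * (\<phi> y * gauss (e n) (x - y))))"
      by (subst lborel_pair.integral_fst'[symmetric, OF int1]) (simp add: mult.assoc)
    also have "\<dots> = (LINT x|lborel. (LINT z|lborel. f x * (\<phi> (x + e n *\<^sub>R z) * gauss 1 z)))"
      by (simp add: integral_conv_gauss[OF _ e])
    also have "\<dots> = (LINT p|lborel2. ?B n p)"
      by (subst lborel_pair.integral_fst'[symmetric, OF int2]) (simp add: mult.assoc)
    finally show ?thesis .
  qed
  have "(\<lambda>n. LINT p|lborel2. ?B n p)
     \<longlonglongrightarrow> (LINT p|lborel2. (f (fst p) * \<phi> (fst p)) * gauss 1 (snd p :: real^'n))"
  proof (rule integral_dominated_convergence)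
    show "integrable lborel2 (\<lambda>p. norm ((M * f (fst p)) * gauss 1 (snd p :: real^'n)))"
      using dom by (rule integrable_norm)
    show "AE p in lborel2. (\<lambda>n. ?B n p) \<longlonglongrightarrow> (f (fst p) * \<phi> (fst p)) * gauss 1 (snd p :: real^'n)"
    proof (rule AE_I2)
      fix p :: "(real^'n) \<times> (real^'n)"
      have "(\<lambda>n. fst p + e n *\<^sub>R snd p) \<longlonglongrightarrow> fst p + 0 *\<^sub>R snd p"
        by (intro tendsto_intros e0)
      hence "(\<lambda>n. \<phi> (fst p + e n *\<^sub>R snd p)) \<longlonglongrightarrow> \<phi> (fst p)"
        using cont by (intro isCont_tendsto_compose[of "fst p" \<phi>]) (auto simp: continuous_on_eq_continuous_at)
      thus "(\<lambda>n. ?B n p) \<longlonglongrightarrow> (f (fst p) * \<phi> (fst p)) * gauss 1 (snd p)"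
        by (intro tendsto_intros)
    qed
    show "AE p in lborel2. norm (?B n p) \<le> norm (M * f (fst p) * gauss 1 (snd p))" for n
      by (intro AE_I2 bdm)
  qed measurable
  also have "(LINT p|lborel2. (f (fst p) * \<phi> (fst p)) * gauss 1 (snd p :: real^'n)) = (LINT x|lborel. f x * \<phi> x)"
  proof -
    have "integrable lborel (\<lambda>x. f x * \<phi> x)"
    proof (rule Bochner_Integration.integrable_bound)
      show "integrable lborel (\<lambda>x. M * f x)" using f by simp
      show "AE x in lborel. norm (f x * \<phi> x) \<le> norm (M * f x)"
        using bdm[of _ _ 1] by simp
    qed measurable
    thus ?thesis
      by (subst integrable_pair_mult(2)) (auto simp: sigma_finite_lborel integrable_gauss integral_gauss)
  qed
  finally show ?thesis unfolding eq[symmetric] unfolding e_def .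
qed

text \<open>
  Testing against continuous functions: the damped Parseval identity bounds the pairing by the
  norms of the two transforms, and that of \<open>\<phi>\<close> is controlled by the inequality proved above. The
  square of the dimensional factor appears on the left and one power of it on the right.
\<close>

lemma integral_mult_le_fourier:
  fixes f \<phi> :: "real ^ 'n::finite \<Rightarrow> real"
  assumes f: "integrable lborel f" and f2: "integrable lborel (\<lambda>x. (f x)\<^sup>2)"
    and phi: "integrable lborel \<phi>" and phi2: "integrable lborel (\<lambda>x. (\<phi> x)\<^sup>2)"
    and cont: "continuous_on UNIV \<phi>" and bd: "\<And>x. \<bar>\<phi> x\<bar> \<le> M"
  shows "(2 * pi) ^ CARD('n) * (LINT x|lborel. f x * \<phi> x)\<^sup>2 \<le> (LINT \<xi>|lborel. (norm (fourier_integral f \<xi>))\<^sup>2) * (LINT x|lborel. (\<phi> x)\<^sup>2)"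
proof -
  have [measurable]: "f \<in> borel_measurable borel" "\<phi> \<in> borel_measurable borel" using f phi by auto
  define D where "D = (2 * pi) ^ CARD('n)"
  have D: "D > 0" by (simp add: D_def)
  let ?N = "LINT \<xi>|lborel. (norm (fourier_integral f \<xi>))\<^sup>2"
  let ?I = "\<lambda>n. LINT p|lborel2. f (fst p) * \<phi> (snd p) * gauss (1 / real (Suc n)) (fst p - snd p)"
  have N: "0 \<le> ?N" by (rule Bochner_Integration.integral_nonneg) simp
  have b: "D * (?I n)\<^sup>2 \<le> ?N * (LINT x|lborel. (\<phi> x)\<^sup>2)" for n
  proof -
    let ?g = "\<lambda>\<xi>. complex_of_real (exp (- (1 / real (Suc n) * norm \<xi>)\<^sup>2 / 2))"
    let ?A = "LINT \<xi>|lborel. \<bar>norm (fourier_integral f \<xi>) * norm (fourier_integral \<phi> \<xi>)\<bar>"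
    have i: "integrable lborel (\<lambda>\<xi>. norm (fourier_integral f \<xi>) * norm (fourier_integral \<phi> \<xi>))"
      by (rule cauchy_schwarz_integral) (auto intro: plancherel_le f f2 phi phi2)
    have "\<bar>D * ?I n\<bar> = norm (LINT \<xi>|lborel. fourier_integral f \<xi> * cnj (fourier_integral \<phi> \<xi>) * ?g \<xi>)"
      unfolding D_def by (subst fourier_gauss_bilinear[OF f phi]) (simp_all only: norm_of_real, simp)
    also have "\<dots> \<le> (LINT \<xi>|lborel. norm (fourier_integral f \<xi> * cnj (fourier_integral \<phi> \<xi>) * ?g \<xi>))"
      by (rule integral_norm_bound)
    also have "\<dots> \<le> ?A"
    proof (rule integral_mono')
      show "integrable lborel (\<lambda>\<xi>. \<bar>norm (fourier_integral f \<xi>) * norm (fourier_integral \<phi> \<xi>)\<bar>)"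
        using i by simp
      fix \<xi> :: "real^'n"
      show "norm (fourier_integral f \<xi> * cnj (fourier_integral \<phi> \<xi>) * ?g \<xi>) \<le> \<bar>norm (fourier_integral f \<xi>) * norm (fourier_integral \<phi> \<xi>)\<bar>"
        by (simp add: norm_mult abs_mult mult_left_le)
    qed simp
    finally have le: "\<bar>D * ?I n\<bar> \<le> ?A" .
    have "(D * ?I n)\<^sup>2 \<le> ?A\<^sup>2"
      using power_mono[OF le abs_ge_zero, of 2] by (simp only: power2_abs)
    also have "\<dots> \<le> ?N * (LINT \<xi>|lborel. (norm (fourier_integral \<phi> \<xi>))\<^sup>2)"
      by (rule cauchy_schwarz_integral) (auto intro: plancherel_le f f2 phi phi2)
    also have "\<dots> \<le> ?N * (D * (LINT x|lborel. (\<phi> x)\<^sup>2))"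
      unfolding D_def by (intro mult_left_mono plancherel_le phi phi2 N)
    finally have "D * (D * (?I n)\<^sup>2) \<le> D * (?N * (LINT x|lborel. (\<phi> x)\<^sup>2))"
      by (simp add: power_mult_distrib power2_eq_square mult_ac)
    thus ?thesis using D by simp
  qed
  have "(\<lambda>n. D * (?I n)\<^sup>2) \<longlonglongrightarrow> D * (LINT x|lborel. f x * \<phi> x)\<^sup>2"
    by (intro tendsto_intros gauss_pairing_tendsto[OF f phi cont bd])
  from LIMSEQ_le_const2[OF this] b show ?thesis unfolding D_def by blast
qed

text \<open>
  This supplies the test functions that approach \<open>f\<close> itself.
\<close>

lemma borel_measurable_AE_limit_continuous:
  fixes f :: "real ^ 'n::finite \<Rightarrow> real"
  assumes "f \<in> borel_measurable borel"
  obtains g :: "nat \<Rightarrow> real ^ 'n \<Rightarrow> real" where "\<And>n. continuous_on UNIV (g n)"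
    "AE x in lborel. (\<lambda>n. g n x) \<longlonglongrightarrow> f x"
proof -
  have "f \<in> borel_measurable lebesgue" using assms by (simp add: measurable_completion)
  hence "f measurable_on UNIV"
    by (intro lebesgue_measurable_imp_measurable_on) auto
  then obtain N g where N: "negligible N" and g: "\<And>n. continuous_on UNIV (g n)"
    and lim: "\<And>x. x \<notin> N \<Longrightarrow> (\<lambda>n. g n x) \<longlonglongrightarrow> f x"
    unfolding measurable_on_def by auto
  have "AE x in lebesgue. (\<lambda>n. g n x) \<longlonglongrightarrow> f x"
    using N lim by (intro AE_I'[of N]) (auto simp: negligible_iff_null_sets)
  hence "AE x in lborel. (\<lambda>n. g n x) \<longlonglongrightarrow> f x"
    by (simp add: AE_completion_iff)
  with g show ?thesis by (rule that)
qed

text \<open>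
  Let \<open>F\<close> be \<open>f\<close> with its values clamped to \<open>[-m, m]\<close> and multiplied by a cutoff. Approximating \<open>F\<close> by
  continuous functions, the previous bound passes to \<open>F\<close>. As \<open>F\<^sup>2 \<le> f F\<close>, it bounds the norm of \<open>F\<close> by
  that of the transform of \<open>f\<close>, uniformly in \<open>m\<close>.
\<close>

lemma plancherel_ge:
  fixes f :: "real ^ 'n::finite \<Rightarrow> real"
  assumes f: "integrable lborel f" and f2: "integrable lborel (\<lambda>x. (f x)\<^sup>2)"
  shows "(2 * pi) ^ CARD('n) * (LINT x|lborel. (f x)\<^sup>2) \<le> (LINT \<xi>|lborel. (norm (fourier_integral f \<xi>))\<^sup>2)"
proof -
  have [measurable]: "f \<in> borel_measurable borel" using f by auto
  define D where "D = (2 * pi) ^ CARD('n)"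
  have D: "D > 0" by (simp add: D_def)
  let ?N = "LINT \<xi>|lborel. (norm (fourier_integral f \<xi>))\<^sup>2"
  have N: "0 \<le> ?N" by (rule Bochner_Integration.integral_nonneg) simp
  obtain g :: "nat \<Rightarrow> real^'n \<Rightarrow> real" where g: "\<And>n. continuous_on UNIV (g n)"
    and lim: "AE x in lborel. (\<lambda>n. g n x) \<longlonglongrightarrow> f x"
    using borel_measurable_AE_limit_continuous[of f] by auto
  define c where "c m y = max (- real m) (min (real m) y)" for m :: nat and y :: real
  define cut where "cut m x = max 0 (min 1 (real m + 1 - norm x))" for m :: nat and x :: "real^'n"
  have [measurable]: "g n \<in> borel_measurable borel" for n
    using g by (rule borel_measurable_continuous_onI)
  have [measurable]: "c m \<in> borel_measurable borel" "cut m \<in> borel_measurable borel" for m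
    unfolding c_def cut_def by measurable
  have cabs: "\<bar>c m y\<bar> \<le> real m" "\<bar>c m y\<bar> \<le> \<bar>y\<bar>" for m y
    by (auto simp: c_def max_def min_def)
  have csq: "(c m y)\<^sup>2 \<le> y * c m y" for m y
  proof -
    consider "y < - real m" | "\<bar>y\<bar> \<le> real m" | "real m < y" by linarith
    thus ?thesis
    proof cases
      case 1
      have "real m * real m \<le> (- y) * real m" using 1 by (intro mult_right_mono) auto
      thus ?thesis using 1 by (simp add: c_def power2_eq_square)
    next
      case 2
      hence "c m y = y" by (auto simp: c_def)
      thus ?thesis by (simp add: power2_eq_square)
    next
      case 3
      have "real m * real m \<le> y * real m" using 3 by (intro mult_right_mono) auto
      thus ?thesis using 3 by (simp add: c_def power2_eq_square)
    qed
  qed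
  have chi: "0 \<le> cut m x" "cut m x \<le> 1" for m x
    by (auto simp: cut_def)
  have chi0: "cut m x = 0" if "x \<notin> cball 0 (real m + 1)" for m x
    using that by (auto simp: cut_def)
  have bdm: "\<bar>c m y * cut m x\<bar> \<le> real m" for m y x
  proof -
    have "\<bar>c m y\<bar> * cut m x \<le> real m * 1" by (intro mult_mono cabs chi) auto
    thus ?thesis using chi[of m x] by (simp add: abs_mult)
  qed
  have bd: "\<bar>c m y * cut m x\<bar> \<le> real m * indicator (cball 0 (real m + 1)) x" for m y x
    using bdm[of m y x] chi0[of x m] by (cases "x \<in> cball 0 (real m + 1)") auto
  have bd2: "(c m y * cut m x)\<^sup>2 \<le> (real m)\<^sup>2 * indicator (cball 0 (real m + 1)) x" for m y x
    using power_mono[OF bdm abs_ge_zero, of m y x 2] chi0[of x m] by (cases "x \<in> cball 0 (real m + 1)") auto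
  have ind: "integrable lborel (\<lambda>x::real^'n. C * indicator (cball 0 r) x :: real)" for C r
    using emeasure_bounded_finite[OF bounded_cball[of "0::real^'n" r]]
    by (intro integrable_mult_right integrable_real_indicator) auto
  have csq0: "0 \<le> y * c m y" for m y
    using order_trans[OF zero_le_power2 csq] .
  have int1: "integrable lborel (\<lambda>x. c m (h x) * cut m x)"
    if [measurable]: "h \<in> borel_measurable borel" for m h
    by (rule Bochner_Integration.integrable_bound[OF ind[of "real m" "real m + 1"]])
       (auto intro!: bd)
  have int2: "integrable lborel (\<lambda>x. (c m (h x) * cut m x)\<^sup>2)"
    if [measurable]: "h \<in> borel_measurable borel" for m h
    by (rule Bochner_Integration.integrable_bound[OF ind[of "(real m)\<^sup>2" "real m + 1"]])
       (auto intro!: bd2)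
  have step: "D * (LINT x|lborel. (c m (f x) * cut m x)\<^sup>2) \<le> ?N" for m
  proof -
    let ?F = "\<lambda>x. c m (f x) * cut m x" and ?\<phi> = "\<lambda>n x. c m (g n x) * cut m x"
    have limF: "AE x in lborel. (\<lambda>n. ?\<phi> n x) \<longlonglongrightarrow> ?F x"
      using lim by eventually_elim (unfold c_def, intro tendsto_intros)
    have "D * (LINT x|lborel. f x * ?\<phi> n x)\<^sup>2 \<le> ?N * (LINT x|lborel. (?\<phi> n x)\<^sup>2)" for n
      unfolding D_def
    proof (rule integral_mult_le_fourier[OF f f2])
      show "integrable lborel (?\<phi> n)"
        by (rule int1) simp
      show "integrable lborel (\<lambda>x. (?\<phi> n x)\<^sup>2)"
        by (rule int2) simp
      show "continuous_on UNIV (?\<phi> n)"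
        unfolding c_def cut_def by (intro continuous_intros g)
      show "\<bar>?\<phi> n x\<bar> \<le> real m" for x
        by (rule bdm)
    qed
    moreover have "(\<lambda>n. LINT x|lborel. f x * ?\<phi> n x) \<longlonglongrightarrow> (LINT x|lborel. f x * ?F x)"
    proof (rule integral_dominated_convergence[where w="\<lambda>x. real m * \<bar>f x\<bar>"])
      show "AE x in lborel. (\<lambda>n. f x * ?\<phi> n x) \<longlonglongrightarrow> f x * ?F x"
        using limF by eventually_elim (erule tendsto_mult[OF tendsto_const])
      show "AE x in lborel. norm (f x * ?\<phi> n x) \<le> real m * \<bar>f x\<bar>" for n
      proof (rule AE_I2)
        fix x
        have "\<bar>?\<phi> n x\<bar> \<le> real m"
          by (rule bdm)
        from mult_right_mono[OF this, of "\<bar>f x\<bar>"]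
        show "norm (f x * ?\<phi> n x) \<le> real m * \<bar>f x\<bar>" by (simp add: abs_mult mult_ac)
      qed
    qed (use f in auto)
    moreover have "(\<lambda>n. LINT x|lborel. (?\<phi> n x)\<^sup>2) \<longlonglongrightarrow> (LINT x|lborel. (?F x)\<^sup>2)"
    proof (rule integral_dominated_convergence[OF _ _ ind])
      show "AE x in lborel. (\<lambda>n. (?\<phi> n x)\<^sup>2) \<longlonglongrightarrow> (?F x)\<^sup>2"
        using limF by eventually_elim (erule tendsto_power)
      show "AE x in lborel. norm ((?\<phi> n x)\<^sup>2) \<le> (real m)\<^sup>2 * indicator (cball 0 (real m + 1)) x" for n
        using bd2 by simp
    qed auto
    ultimately have le: "D * (LINT x|lborel. f x * ?F x)\<^sup>2 \<le> ?N * (LINT x|lborel. (?F x)\<^sup>2)"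
      by (intro LIMSEQ_le[of "\<lambda>n. D * (LINT x|lborel. f x * ?\<phi> n x)\<^sup>2" _ "\<lambda>n. ?N * (LINT x|lborel. (?\<phi> n x)\<^sup>2)"] tendsto_intros) auto
    let ?J = "LINT x|lborel. (?F x)\<^sup>2"
    have J: "0 \<le> ?J" by (rule Bochner_Integration.integral_nonneg) simp
    have "?J \<le> (LINT x|lborel. f x * ?F x)"
    proof (rule integral_mono)
      show "integrable lborel (\<lambda>x. (?F x)\<^sup>2)"
        by (rule int2) simp
      show "integrable lborel (\<lambda>x. f x * ?F x)"
      proof (rule Bochner_Integration.integrable_bound)
        show "integrable lborel (\<lambda>x. real m * f x)" using f by simp
        show "AE x in lborel. norm (f x * ?F x) \<le> norm (real m * f x)"
        proof (rule AE_I2)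
          fix x
          have "\<bar>?F x\<bar> \<le> real m"
            by (rule bdm)
          from mult_right_mono[OF this, of "\<bar>f x\<bar>"]
          show "norm (f x * ?F x) \<le> norm (real m * f x)" by (simp add: abs_mult mult_ac)
        qed
      qed auto
      fix x
      have "(?F x)\<^sup>2 = (c m (f x))\<^sup>2 * (cut m x)\<^sup>2" by (simp add: power_mult_distrib)
      also have "\<dots> \<le> (f x * c m (f x)) * cut m x"
        using chi[of m x] csq0[of "f x" m]
        by (intro mult_mono csq) (auto simp: power2_eq_square mult_left_le)
      finally show "(?F x)\<^sup>2 \<le> f x * ?F x" by (simp add: mult.assoc)
    qed
    hence "D * ?J\<^sup>2 \<le> ?N * ?J"
      using J D by (intro order_trans[OF _ le] mult_left_mono power_mono) auto
    hence "(D * ?J) * ?J \<le> ?N * ?J" by (simp add: power2_eq_square mult.assoc)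
    thus ?thesis
      using J N by (cases "?J = 0") (auto simp: mult_le_cancel_right)
  qed
  have "(\<lambda>m. LINT x|lborel. (c m (f x) * cut m x)\<^sup>2) \<longlonglongrightarrow> (LINT x|lborel. (f x)\<^sup>2)"
  proof (rule integral_dominated_convergence[OF _ _ f2])
    show "AE x in lborel. (\<lambda>m. (c m (f x) * cut m x)\<^sup>2) \<longlonglongrightarrow> (f x)\<^sup>2"
    proof (rule AE_I2)
      fix x :: "real^'n"
      obtain m0 :: nat where m0: "\<bar>f x\<bar> + norm x \<le> real m0" using real_arch_simple by blast
      have "(c m (f x) * cut m x)\<^sup>2 = (f x)\<^sup>2" if "m \<ge> m0" for m
      proof -
        have "\<bar>f x\<bar> + norm x \<le> real m" using m0 that by linarith
        hence "\<bar>f x\<bar> \<le> real m" "norm x \<le> real m" using norm_ge_zero[of x] abs_ge_zero[of "f x"] by linarith+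
        hence "c m (f x) = f x" "cut m x = 1" by (auto simp: c_def cut_def)
        thus ?thesis by simp
      qed
      thus "(\<lambda>m. (c m (f x) * cut m x)\<^sup>2) \<longlonglongrightarrow> (f x)\<^sup>2"
        by (intro tendsto_eventually eventually_sequentiallyI)
    qed
    show "AE x in lborel. norm ((c m (f x) * cut m x)\<^sup>2) \<le> (f x)\<^sup>2" for m
    proof (rule AE_I2)
      fix x
      have "\<bar>c m (f x)\<bar> * cut m x \<le> \<bar>f x\<bar> * 1" using chi[of m x] by (intro mult_mono cabs) auto
      hence "\<bar>c m (f x) * cut m x\<bar> \<le> \<bar>f x\<bar>" using chi[of m x] by (simp add: abs_mult)
      thus "norm ((c m (f x) * cut m x)\<^sup>2) \<le> (f x)\<^sup>2" by (simp add: abs_le_square_iff)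
    qed
  qed auto
  hence "(\<lambda>m. D * (LINT x|lborel. (c m (f x) * cut m x)\<^sup>2)) \<longlonglongrightarrow> D * (LINT x|lborel. (f x)\<^sup>2)"
    by (intro tendsto_intros)
  from LIMSEQ_le_const2[OF this] step show ?thesis unfolding D_def by blast
qed

section \<open>The Fourier transform on square integrable functions\<close>

lemma L2_norm_power2: "(L2_norm M f)\<^sup>2 = (\<integral>\<^sup>+x. ennreal ((norm (f x))\<^sup>2) \<partial>M)"
proof (cases "(\<integral>\<^sup>+x. ennreal ((norm (f x))\<^sup>2) \<partial>M) = \<infinity>")
  case True
  thus ?thesis by (simp add: L2_norm_def power2_eq_square ennreal_top_mult)
next
  case False
  thus ?thesis by (simp add: L2_norm_def Let_def ennreal_power less_top)
qed

lemma L2_space_iff: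
  "f \<in> L2_space M \<longleftrightarrow> f \<in> borel_measurable M \<and> integrable M (\<lambda>x. (norm (f x))\<^sup>2)"
proof -
  have "L2_norm M f < \<infinity> \<longleftrightarrow> (\<integral>\<^sup>+x. ennreal ((norm (f x))\<^sup>2) \<partial>M) < \<infinity>"
    by (auto simp: L2_norm_def Let_def less_top[symmetric])
  thus ?thesis
    by (auto simp: L2_space_def integrable_iff_bounded)
qed

lemma ennreal_power2_tendsto_0_iff:
  fixes a :: "'a \<Rightarrow> ennreal"
  shows "((\<lambda>i. (a i)\<^sup>2) \<longlongrightarrow> 0) F \<longleftrightarrow> (a \<longlongrightarrow> 0) F"
proof
  assume a: "(a \<longlongrightarrow> 0) F"
  show "((\<lambda>i. (a i)\<^sup>2) \<longlongrightarrow> 0) F"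
  proof (rule tendsto_sandwich[OF _ _ tendsto_const a])
    show "\<forall>\<^sub>F i in F. (a i)\<^sup>2 \<le> a i"
      using order_tendstoD(2)[OF a, of 1]
      by (simp, elim eventually_mono) (use mult_left_mono[of _ "1::ennreal"] in \<open>force simp: power2_eq_square\<close>)
  qed auto
next
  assume a: "((\<lambda>i. (a i)\<^sup>2) \<longlongrightarrow> 0) F"
  show "(a \<longlongrightarrow> 0) F"
  proof (rule order_tendstoI)
    fix e :: ennreal assume "0 < e"
    then have "0 < e\<^sup>2" by (simp add: power2_eq_square ennreal_zero_less_mult_iff)
    from order_tendstoD(2)[OF a this] show "\<forall>\<^sub>F i in F. a i < e"
      by eventually_elim (metis not_le power_mono zero_le)
  qed simp
qed

lemma L2_norm_tendsto_0_iff: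
  "((\<lambda>i. L2_norm M (f i)) \<longlongrightarrow> 0) F \<longleftrightarrow> ((\<lambda>i. \<integral>\<^sup>+x. ennreal ((norm (f i x))\<^sup>2) \<partial>M) \<longlongrightarrow> 0) F"
  using ennreal_power2_tendsto_0_iff[of "\<lambda>i. L2_norm M (f i)" F] by (simp add: L2_norm_power2)

lemma norm_add_power2_le:
  "(norm (a + b :: 'a::real_normed_vector))\<^sup>2 \<le> 2 * (norm a)\<^sup>2 + 2 * (norm b)\<^sup>2"
proof -
  have "(norm (a + b))\<^sup>2 \<le> (norm a + norm b)\<^sup>2" by (intro power_mono norm_triangle_ineq) auto
  also have "\<dots> \<le> 2 * (norm a)\<^sup>2 + 2 * (norm b)\<^sup>2"
    using sum_squares_bound[of "norm a" "norm b"] by (simp add: power2_sum)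
  finally show ?thesis .
qed

lemma norm_diff_power2_le:
  "(norm (a - b :: 'a::real_normed_vector))\<^sup>2 \<le> 2 * (norm a)\<^sup>2 + 2 * (norm b)\<^sup>2"
  using norm_add_power2_le[of a "- b"] by simp

lemma nn_integral_norm_power2_add_le:
  fixes a b :: "'a \<Rightarrow> 'b::{real_normed_vector, second_countable_topology}"
  assumes [measurable]: "a \<in> borel_measurable M" "b \<in> borel_measurable M"
  shows "(\<integral>\<^sup>+x. ennreal ((norm (a x + b x))\<^sup>2) \<partial>M)
     \<le> 2 * (\<integral>\<^sup>+x. ennreal ((norm (a x))\<^sup>2) \<partial>M) + 2 * (\<integral>\<^sup>+x. ennreal ((norm (b x))\<^sup>2) \<partial>M)"
proof -
  have "(\<integral>\<^sup>+x. ennreal ((norm (a x + b x))\<^sup>2) \<partial>M) \<le> (\<integral>\<^sup>+x. 2 * ennreal ((norm (a x))\<^sup>2) + 2 * ennreal ((norm (b x))\<^sup>2) \<partial>M)"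
  proof (rule nn_integral_mono)
    fix x
    have "ennreal ((norm (a x + b x))\<^sup>2) \<le> ennreal (2 * (norm (a x))\<^sup>2 + 2 * (norm (b x))\<^sup>2)"
      by (intro ennreal_leI norm_add_power2_le)
    thus "ennreal ((norm (a x + b x))\<^sup>2) \<le> 2 * ennreal ((norm (a x))\<^sup>2) + 2 * ennreal ((norm (b x))\<^sup>2)"
      by (simp add: ennreal_plus ennreal_mult)
  qed
  also have "\<dots> = 2 * (\<integral>\<^sup>+x. ennreal ((norm (a x))\<^sup>2) \<partial>M) + 2 * (\<integral>\<^sup>+x. ennreal ((norm (b x))\<^sup>2) \<partial>M)"
    by (subst nn_integral_add) (auto simp: nn_integral_cmult)
  finally show ?thesis .
qed

lemma integral_norm_power2_add_le:
  fixes a b :: "'a \<Rightarrow> 'b::{real_normed_vector, second_countable_topology}"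
  assumes [measurable]: "a \<in> borel_measurable M" "b \<in> borel_measurable M"
    and "integrable M (\<lambda>x. (norm (a x))\<^sup>2)" "integrable M (\<lambda>x. (norm (b x))\<^sup>2)"
  shows "integrable M (\<lambda>x. (norm (a x + b x))\<^sup>2)"
    and "(LINT x|M. (norm (a x + b x))\<^sup>2) \<le> 2 * (LINT x|M. (norm (a x))\<^sup>2) + 2 * (LINT x|M. (norm (b x))\<^sup>2)"
proof -
  have ab: "integrable M (\<lambda>x. 2 * (norm (a x))\<^sup>2 + 2 * (norm (b x))\<^sup>2)" using assms by simp
  show i: "integrable M (\<lambda>x. (norm (a x + b x))\<^sup>2)"
    by (rule Bochner_Integration.integrable_bound[OF ab]) (auto simp: norm_add_power2_le)
  have "(LINT x|M. (norm (a x + b x))\<^sup>2) \<le> (LINT x|M. 2 * (norm (a x))\<^sup>2 + 2 * (norm (b x))\<^sup>2)"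
    by (intro integral_mono i ab norm_add_power2_le)
  thus "(LINT x|M. (norm (a x + b x))\<^sup>2) \<le> 2 * (LINT x|M. (norm (a x))\<^sup>2) + 2 * (LINT x|M. (norm (b x))\<^sup>2)"
    using assms by simp
qed

lemma indicator_ball_measurable [measurable]:
  "(indicator (ball a r) :: 'a::metric_space \<Rightarrow> real) \<in> borel_measurable borel"
  by (intro borel_measurable_indicator) simp

text \<open>
  The limit of the truncated transforms in \<open>L\<^sup>2\<close> is unique almost everywhere, so any candidate that is
  such a limit agrees with the one picked by the choice operator.
\<close>

lemma fourier_eqI:
  fixes f :: "real ^ 'n::finite \<Rightarrow> real"
  assumes f [measurable]: "f \<in> borel_measurable borel" and g: "g \<in> L2_space lborel"
    and lim: "((\<lambda>R::real. L2_norm lborel (\<lambda>\<xi>. g \<xi> - fourier_integral (\<lambda>x. indicator (ball 0 R) x * f x) \<xi>)) \<longlongrightarrow> 0) at_top"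
  shows "fourier f \<in> L2_space lborel" and "AE \<xi> in lborel. fourier f \<xi> = g \<xi>"
proof -
  let ?T = "\<lambda>R::real. fourier_integral (\<lambda>x. indicator (ball 0 R) x * f x)"
  have "fourier f \<in> L2_space lborel \<and> ((\<lambda>R::real. L2_norm lborel (\<lambda>\<xi>. fourier f \<xi> - ?T R \<xi>)) \<longlongrightarrow> 0) at_top"
    unfolding fourier_def by (rule someI[of _ g]) (use g lim in auto)
  hence F: "fourier f \<in> L2_space lborel"
    and Flim: "((\<lambda>R::real. L2_norm lborel (\<lambda>\<xi>. fourier f \<xi> - ?T R \<xi>)) \<longlongrightarrow> 0) at_top" by auto
  show "fourier f \<in> L2_space lborel" by (rule F)
  have [measurable]: "fourier f \<in> borel_measurable borel" "g \<in> borel_measurable borel"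
    using F g by (auto simp: L2_space_def)
  let ?I = "\<integral>\<^sup>+\<xi>. ennreal ((norm (fourier f \<xi> - g \<xi>))\<^sup>2) \<partial>lborel"
  let ?a = "\<lambda>R. \<integral>\<^sup>+\<xi>. ennreal ((norm (fourier f \<xi> - ?T R \<xi>))\<^sup>2) \<partial>lborel"
  let ?b = "\<lambda>R. \<integral>\<^sup>+\<xi>. ennreal ((norm (g \<xi> - ?T R \<xi>))\<^sup>2) \<partial>lborel"
  have "?I \<le> 2 * ?a R + 2 * ?b R" for R
    using nn_integral_norm_power2_add_le[of "\<lambda>\<xi>. fourier f \<xi> - ?T R \<xi>" lborel "\<lambda>\<xi>. ?T R \<xi> - g \<xi>"]
    by (simp add: norm_minus_commute)
  moreover have "((\<lambda>R. 2 * ?a R + 2 * ?b R) \<longlongrightarrow> 2 * 0 + 2 * 0) at_top"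
    using Flim lim unfolding L2_norm_tendsto_0_iff by (intro tendsto_add ennreal_tendsto_cmult) auto
  ultimately have "?I \<le> 2 * 0 + 2 * 0"
    by (intro tendsto_le[OF _ _ tendsto_const[of ?I]]) (auto simp: trivial_limit_at_top_linorder)
  hence "?I = 0" by simp
  thus "AE \<xi> in lborel. fourier f \<xi> = g \<xi>"
    by (subst (asm) nn_integral_0_iff_AE) auto
qed

text \<open>
  The transform may be computed along any integrable functions \<open>v n\<close> tending to \<open>f\<close> in \<open>L\<^sup>2\<close>. Compare
  the truncation of \<open>f\<close> to a ball with \<open>v n\<close>: by Plancherel their transforms differ by at most the
  error \<open>v n - f\<close> and the part of \<open>v n\<close> outside the ball. First \<open>n\<close> and then the radius is chosen large.
\<close>

lemma fourier_eq_L2_limit: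
  fixes f :: "real ^ 'n::finite \<Rightarrow> real" and v :: "nat \<Rightarrow> real ^ 'n \<Rightarrow> real"
  assumes f: "f \<in> L2_space lborel" and g: "g \<in> L2_space lborel"
    and v: "\<And>n. integrable lborel (v n)" "\<And>n. integrable lborel (\<lambda>x. (v n x)\<^sup>2)"
    and vf: "(\<lambda>n. LINT x|lborel. (v n x - f x)\<^sup>2) \<longlonglongrightarrow> 0"
    and vg: "(\<lambda>n. LINT \<xi>|lborel. (norm (g \<xi> - fourier_integral (v n) \<xi>))\<^sup>2) \<longlonglongrightarrow> 0"
  shows "fourier f \<in> L2_space lborel" and "AE \<xi> in lborel. fourier f \<xi> = g \<xi>"
proof -
  define D where "D = (2 * pi) ^ CARD('n)"
  have D: "D > 0" by (simp add: D_def)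
  have [measurable]: "f \<in> borel_measurable borel" and f2: "integrable lborel (\<lambda>x. (f x)\<^sup>2)"
    using f by (auto simp: L2_space_iff)
  have [measurable]: "g \<in> borel_measurable borel" and g2: "integrable lborel (\<lambda>\<xi>. (norm (g \<xi>))\<^sup>2)"
    using g by (auto simp: L2_space_iff)
  have [measurable]: "v n \<in> borel_measurable borel" for n using v(1)[of n] by auto
  let ?f = "\<lambda>R x. indicator (ball 0 R) x * f x"
  let ?v = "\<lambda>n R x. indicator (ball 0 R) x * v n x"
  let ?A = "\<lambda>n. LINT \<xi>|lborel. (norm (g \<xi> - fourier_integral (v n) \<xi>))\<^sup>2"
  let ?B = "\<lambda>n. LINT x|lborel. (v n x - f x)\<^sup>2"
  let ?C = "\<lambda>n R. LINT x|lborel. (v n x - ?v n R x)\<^sup>2"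
  have cut2: "integrable lborel (\<lambda>x. (indicator (ball 0 R) x * h x)\<^sup>2)" 
    if "h \<in> borel_measurable borel" "integrable lborel (\<lambda>x. (h x)\<^sup>2)" for h :: "real^'n \<Rightarrow> real" and R
    using that by (intro Bochner_Integration.integrable_bound[OF that(2)]) (auto simp: indicator_def)
  have cut1: "integrable lborel (\<lambda>x. indicator (ball 0 R) x * h x)" 
    if [measurable]: "h \<in> borel_measurable borel" and "integrable lborel (\<lambda>x. (h x)\<^sup>2)" for h :: "real^'n \<Rightarrow> real" and R
  proof (rule cauchy_schwarz_integral)
    show "integrable lborel (\<lambda>x::real^'n. (indicator (ball 0 R) x :: real)\<^sup>2)"
    proof -
      have "(\<lambda>x::real^'n. (indicator (ball 0 R) x :: real)\<^sup>2) = indicator (ball 0 R)"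
        by (auto simp: indicator_def fun_eq_iff)
      thus ?thesis using emeasure_bounded_finite[OF bounded_ball[of "0::real^'n" R]]
        by (simp only:) (intro integrable_real_indicator, auto)
    qed
  qed (use that in auto)
  have bound: "(\<integral>\<^sup>+\<xi>. ennreal ((norm (g \<xi> - fourier_integral (?f R) \<xi>))\<^sup>2) \<partial>lborel) \<le> ennreal (2 * ?A n + 4 * D * ?B n + 4 * D * ?C n R)" for n R
  proof -
    define a where "a \<xi> = g \<xi> - fourier_integral (v n) \<xi>" for \<xi>
    define h where "h x = v n x - ?f R x" for x
    have a2: "integrable lborel (\<lambda>\<xi>. (norm (a \<xi>))\<^sup>2)"
      using integral_norm_power2_add_le(1)[of g lborel "\<lambda>\<xi>. - fourier_integral (v n) \<xi>"] g2 plancherel_le(1)[OF v]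
      by (simp add: a_def)
    have h1: "integrable lborel h"
      unfolding h_def using v(1) cut1[of f] f2 by auto
    have h2: "integrable lborel (\<lambda>x. (h x)\<^sup>2)" 
      unfolding h_def using integral_norm_power2_add_le(1)[of "v n" lborel "\<lambda>x. - ?f R x"] v(2) cut2[of f] f2 by auto
    have [measurable]: "h \<in> borel_measurable borel" using h1 by auto
    have [measurable]: "a \<in> borel_measurable borel" by (auto simp: a_def[abs_def])
    have eq: "g \<xi> - fourier_integral (?f R) \<xi> = a \<xi> + fourier_integral h \<xi>" for \<xi>
      unfolding a_def h_def by (subst fourier_integral_diff) (auto simp: v cut1 f2)
    have "(LINT x|lborel. (h x)\<^sup>2) \<le> 2 * ?C n R + 2 * ?B n"
    proof -
      have i1: "integrable lborel (\<lambda>x. (v n x - ?v n R x)\<^sup>2)"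
        using integral_norm_power2_add_le(1)[of "v n" lborel "\<lambda>x. - ?v n R x"] v(2) cut2[of "v n"] by auto
      have i0: "integrable lborel (\<lambda>x. (v n x - f x)\<^sup>2)"
        using integral_norm_power2_add_le(1)[of "v n" lborel "\<lambda>x. - f x"] v(2) f2 by auto
      have i2: "integrable lborel (\<lambda>x. (indicator (ball 0 R) x * (v n x - f x))\<^sup>2)"
        using i0 by (intro cut2) auto
      have "(LINT x|lborel. (h x)\<^sup>2) \<le> 2 * ?C n R + 2 * (LINT x|lborel. (indicator (ball 0 R) x * (v n x - f x))\<^sup>2)"
        using integral_norm_power2_add_le(2)[of "\<lambda>x. v n x - ?v n R x" lborel "\<lambda>x. indicator (ball 0 R) x * (v n x - f x)"] i1 i2
        by (simp add: h_def algebra_simps)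
      also have "(LINT x|lborel. (indicator (ball 0 R) x * (v n x - f x))\<^sup>2) \<le> ?B n"
        by (intro integral_mono i2 i0) (auto simp: indicator_def)
      finally show ?thesis by simp
    qed
    hence hD: "D * (LINT x|lborel. (h x)\<^sup>2) \<le> D * (2 * ?C n R + 2 * ?B n)"
      using D by (intro mult_left_mono) auto
    have "(LINT \<xi>|lborel. (norm (a \<xi> + fourier_integral h \<xi>))\<^sup>2) \<le> 2 * ?A n + 2 * (LINT \<xi>|lborel. (norm (fourier_integral h \<xi>))\<^sup>2)"
      using integral_norm_power2_add_le(2)[of a lborel "fourier_integral h"] a2 plancherel_le(1)[OF h1 h2]
      by (simp add: a_def)
    also have "\<dots> \<le> 2 * ?A n + 2 * (D * (LINT x|lborel. (h x)\<^sup>2))"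
      unfolding D_def by (intro add_left_mono mult_left_mono plancherel_le(2) h1 h2) auto
    also have "\<dots> \<le> 2 * ?A n + 4 * D * ?B n + 4 * D * ?C n R"
      using hD by (simp add: algebra_simps)
    finally have "(LINT \<xi>|lborel. (norm (a \<xi> + fourier_integral h \<xi>))\<^sup>2) \<le> 2 * ?A n + 4 * D * ?B n + 4 * D * ?C n R" .
    moreover have "integrable lborel (\<lambda>\<xi>. (norm (a \<xi> + fourier_integral h \<xi>))\<^sup>2)"
      using integral_norm_power2_add_le(1)[of a lborel "fourier_integral h"] a2 plancherel_le(1)[OF h1 h2] by simp
    ultimately show ?thesis
      unfolding eq by (subst nn_integral_eq_integral) (auto intro: ennreal_leI)
  qed
  have C0: "((\<lambda>R. ?C n R) \<longlongrightarrow> 0) at_top" for n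
  proof -
    have "((\<lambda>R. ?C n R) \<longlongrightarrow> (LINT x|(lborel :: (real^'n) measure). (0::real))) at_top"
    proof (rule integral_dominated_convergence_at_top[where w="\<lambda>x. (v n x)\<^sup>2"])
      show "\<forall>\<^sub>F R in at_top. AE x in lborel. norm ((v n x - ?v n R x)\<^sup>2) \<le> (v n x)\<^sup>2"
        by (intro always_eventually allI AE_I2) (auto simp: indicator_def)
      show "AE x in lborel. ((\<lambda>R. (v n x - ?v n R x)\<^sup>2) \<longlongrightarrow> 0) at_top"
      proof (rule AE_I2)
        fix x :: "real^'n"
        have "\<forall>\<^sub>F R in at_top. (v n x - ?v n R x)\<^sup>2 = 0"
          using eventually_gt_at_top[of "norm x"] by eventually_elim auto
        thus "((\<lambda>R. (v n x - ?v n R x)\<^sup>2) \<longlongrightarrow> 0) at_top" by (rule tendsto_eventually)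
      qed
    qed (use v in auto)
    thus ?thesis by simp
  qed
  have "((\<lambda>R. \<integral>\<^sup>+\<xi>. ennreal ((norm (g \<xi> - fourier_integral (?f R) \<xi>))\<^sup>2) \<partial>lborel) \<longlongrightarrow> 0) at_top"
  proof (rule order_tendstoI)
    fix e :: ennreal assume "0 < e"
    then obtain e' where e': "0 < e'" "ennreal e' \<le> e"
      by (cases e) (auto intro!: that[of "1::real"])
    have "(\<lambda>n. 2 * ?A n + 4 * D * ?B n) \<longlonglongrightarrow> 2 * 0 + 4 * D * 0"
      by (intro tendsto_intros vf vg)
    hence "\<forall>\<^sub>F n in sequentially. 2 * ?A n + 4 * D * ?B n < e' / 2"
      using e' by (intro order_tendstoD(2)[where y="2 * 0 + 4 * D * 0"]) auto
    then obtain n where n: "2 * ?A n + 4 * D * ?B n < e' / 2" by (auto simp: eventually_sequentially)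
    have "((\<lambda>R. 4 * D * ?C n R) \<longlongrightarrow> 4 * D * 0) at_top"
      by (intro tendsto_intros C0)
    hence "\<forall>\<^sub>F R in at_top. 4 * D * ?C n R < e' / 2"
      using e' by (intro order_tendstoD(2)[where y="4 * D * 0"]) auto
    thus "\<forall>\<^sub>F R in at_top. (\<integral>\<^sup>+\<xi>. ennreal ((norm (g \<xi> - fourier_integral (?f R) \<xi>))\<^sup>2) \<partial>lborel) < e"
    proof eventually_elim
      case (elim R)
      have "ennreal (2 * ?A n + 4 * D * ?B n + 4 * D * ?C n R) < ennreal e'"
        using n elim e' by (intro ennreal_lessI) auto
      thus ?case using bound[of R n] e' by (meson le_less_trans less_le_trans)
    qed
  qed simp
  hence lim: "((\<lambda>R::real. L2_norm lborel (\<lambda>\<xi>. g \<xi> - fourier_integral (?f R) \<xi>)) \<longlongrightarrow> 0) at_top"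
    by (simp only: L2_norm_tendsto_0_iff)
  show "fourier f \<in> L2_space lborel" "AE \<xi> in lborel. fourier f \<xi> = g \<xi>"
    using fourier_eqI[OF _ g lim] by auto
qed

lemma fourier_eq_fourier_integral:
  fixes f :: "real ^ 'n::finite \<Rightarrow> real"
  assumes "integrable lborel f" "integrable lborel (\<lambda>x. (f x)\<^sup>2)"
  shows "AE \<xi> in lborel. fourier f \<xi> = fourier_integral f \<xi>"
proof (rule fourier_eq_L2_limit(2)[where v="\<lambda>_. f"])
  have [measurable]: "f \<in> borel_measurable borel" using assms by auto
  show "f \<in> L2_space lborel" "fourier_integral f \<in> L2_space lborel"
    using assms plancherel_le(1)[OF assms] by (auto simp: L2_space_iff)
qed (use assms in auto)

section \<open>Differences of Gaussians in weighted spaces\<close>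

abbreviation weighted_square :: "real \<Rightarrow> (real ^ 'n \<Rightarrow> real) \<Rightarrow> ennreal" where
  "weighted_square q h \<equiv> \<integral>\<^sup>+x. ennreal (norm x powr q * (h x)\<^sup>2) \<partial>lborel"

lemma powr_add_le:
  fixes a b q :: real
  assumes "0 \<le> a" "0 \<le> b" "0 \<le> q"
  shows "(a + b) powr q \<le> 2 powr q * (a powr q + b powr q)"
proof -
  have "(a + b) powr q \<le> (2 * max a b) powr q" using assms by (intro powr_mono2) auto
  also have "\<dots> = 2 powr q * max a b powr q" using assms by (simp add: powr_mult)
  also have "\<dots> \<le> 2 powr q * (a powr q + b powr q)"
    by (intro mult_left_mono) (auto simp: max_def)
  finally show ?thesis .
qed

lemma gauss_shifted_moment_le:
  fixes y :: "real ^ 'n::finite"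
  assumes s: "s > 0" and q: "0 \<le> q" "q \<le> 6"
  shows "(\<integral>\<^sup>+ x. ennreal (norm x powr q * gauss s (x - y)) \<partial>lborel)
     \<le> ennreal (2 powr q * (385 * sqrt 2 ^ CARD('n)) * (s powr q + norm y powr q))"
proof -
  let ?M = "385 * sqrt 2 ^ CARD('n) :: real"
  have "1 \<le> sqrt 2 ^ CARD('n)" by (intro one_le_power) auto
  hence M: "1 \<le> ?M" by linarith
  have "(\<integral>\<^sup>+ x. ennreal (norm x powr q * gauss s (x - y)) \<partial>lborel) \<le>
    (\<integral>\<^sup>+ x. ennreal (2 powr q) * (ennreal (norm (x - y) powr q * gauss s (x - y)) + ennreal (norm y powr q) * ennreal (gauss s (x - y))) \<partial>lborel)"
  proof (rule nn_integral_mono)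
    fix x
    have "norm x \<le> norm (x - y) + norm y" using norm_triangle_ineq[of "x - y" y] by simp
    hence "norm x powr q \<le> (norm (x - y) + norm y) powr q" using q by (intro powr_mono2) auto
    also have "\<dots> \<le> 2 powr q * (norm (x - y) powr q + norm y powr q)" using q by (intro powr_add_le) auto
    finally have "norm x powr q * gauss s (x - y) \<le> 2 powr q * (norm (x - y) powr q + norm y powr q) * gauss s (x - y)"
      by (intro mult_right_mono) auto
    thus "ennreal (norm x powr q * gauss s (x - y)) \<le> ennreal (2 powr q) * (ennreal (norm (x - y) powr q * gauss s (x - y)) + ennreal (norm y powr q) * ennreal (gauss s (x - y)))"
      by (simp add: ennreal_mult[symmetric] ennreal_plus[symmetric] algebra_simps ennreal_leI del: ennreal_plus)
  qed
  also have "\<dots> = ennreal (2 powr q) * ((\<integral>\<^sup>+ x. ennreal (norm (x - y) powr q * gauss s (x - y)) \<partial>lborel) + ennreal (norm y powr q))"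
    by (simp add: nn_integral_cmult nn_integral_add nn_integral_gauss_shift[OF s])
  also have "(\<integral>\<^sup>+ x. ennreal (norm (x - y) powr q * gauss s (x - y)) \<partial>lborel) = (\<integral>\<^sup>+ x. ennreal (norm (x::real^'n) powr q * gauss s x) \<partial>lborel)"
    by (rule nn_integral_translate) measurable
  also have "\<dots> \<le> ennreal (?M * s powr q)" by (rule gauss_moment_le[OF s q])
  also have "ennreal (2 powr q) * (ennreal (?M * s powr q) + ennreal (norm y powr q)) \<le> ennreal (2 powr q * ?M * (s powr q + norm y powr q))"
  proof -
    have "norm y powr q \<le> ?M * norm y powr q" using mult_right_mono[OF M, of "norm y powr q"] by simp
    hence "2 powr q * (?M * s powr q + norm y powr q) \<le> 2 powr q * (?M * s powr q + ?M * norm y powr q)"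
      by (intro mult_left_mono) auto
    thus ?thesis by (simp add: ennreal_mult[symmetric] ennreal_plus[symmetric] algebra_simps ennreal_leI del: ennreal_plus)
  qed
  finally show ?thesis by (simp add: mult_left_mono add_mono)
qed

lemma abs_exp_diff_le:
  fixes a b c :: real
  assumes "c \<le> a" "c \<le> b"
  shows "\<bar>exp (- a) - exp (- b)\<bar> \<le> \<bar>a - b\<bar> * exp (- c)"
proof -
  have *: "exp (- a) - exp (- b) \<le> (b - a) * exp (- c)" if "a \<le> b" "c \<le> a" for a b :: real
  proof -
    have "exp (- a) - exp (- b) = exp (- a) * (1 - exp (a - b))" by (simp add: algebra_simps flip: exp_add)
    also have "\<dots> \<le> exp (- a) * (b - a)"
    proof (rule mult_left_mono)
      show "1 - exp (a - b) \<le> b - a" using exp_ge_add_one_self[of "a - b"] by linarith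
    qed simp
    also have "\<dots> \<le> exp (- c) * (b - a)" using that by (intro mult_right_mono) auto
    finally show ?thesis by (simp add: mult.commute)
  qed
  show ?thesis using *[of a b] *[of b a] assms by (cases "a \<le> b") (auto simp: abs_if)
qed

text \<open>
  A shift by less than the width \<open>s\<close> changes the exponent by at most \<open>(|y| / s) (1 + |x| / s)\<close>, while
  both Gaussians stay below a multiple of \<open>exp (- |x|\<^sup>2 / (4 s\<^sup>2))\<close>.
\<close>

lemma gauss_diff_le:
  fixes x y :: "real ^ 'n::finite"
  assumes s: "s > 0" and y: "norm y \<le> s"
  shows "(gauss s (x - y) - gauss s x)\<^sup>2 \<le>
    8 / (s * sqrt (2 * pi)) ^ CARD('n) * (norm y / s)\<^sup>2 * (1 + (norm x)\<^sup>2 / s\<^sup>2) * gauss s x"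
proof -
  define N where "N = (s * sqrt (2 * pi)) ^ CARD('n)"
  have N: "N > 0" using s by (simp add: N_def)
  define u where "u = norm x / s"
  define v where "v = norm y / s"
  have uv: "0 \<le> u" "0 \<le> v" "v \<le> 1" using s y by (auto simp: u_def v_def)
  define a where "a = (norm (x - y))\<^sup>2 / (2 * s\<^sup>2)"
  define b where "b = u\<^sup>2 / 2"
  have g: "gauss s (x - y) = exp (- a) / N" "gauss s x = exp (- b) / N"
    using s by (simp_all add: gauss_eq a_def b_def u_def N_def power_divide)
  have "(norm x)\<^sup>2 \<le> 2 * (norm (x - y))\<^sup>2 + 2 * (norm y)\<^sup>2"
    using norm_add_power2_le[of "x - y" y] by simp
  hence "(norm x)\<^sup>2 / s\<^sup>2 \<le> (2 * (norm (x - y))\<^sup>2 + 2 * (norm y)\<^sup>2) / s\<^sup>2"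
    using s by (intro divide_right_mono) auto
  hence "u\<^sup>2 \<le> 4 * a + 2 * v\<^sup>2" by (simp add: u_def v_def a_def power_divide add_divide_distrib)
  moreover have "v\<^sup>2 \<le> 1" using uv by (simp add: power_le_one)
  ultimately have ca: "u\<^sup>2 / 4 - 1/2 \<le> a" by simp
  have cb: "u\<^sup>2 / 4 - 1/2 \<le> b" using zero_le_power2[of u] unfolding b_def by linarith
  have e: "exp (- (u\<^sup>2 / 4 - 1/2)) \<le> 2 * exp (- (u\<^sup>2 / 4))"
  proof -
    have "exp (- (u\<^sup>2 / 4 - 1/2)) = exp (1/2) * exp (- (u\<^sup>2 / 4))" by (simp flip: exp_add)
    also have "exp (1/2) \<le> (2::real)" using exp_half_le2 by simp
    finally show ?thesis by simp
  qed
  let ?\<delta> = "(norm (x - y))\<^sup>2 - (norm x)\<^sup>2"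
  have "\<bar>a - b\<bar> \<le> v * (u + 1)"
  proof -
    have "?\<delta> = (norm y)\<^sup>2 - 2 * (x \<bullet> y)"
      by (simp add: power2_norm_eq_inner inner_diff_left inner_diff_right inner_commute)
    moreover have "\<bar>x \<bullet> y\<bar> \<le> norm x * norm y" by (rule Cauchy_Schwarz_ineq2)
    ultimately have "\<bar>?\<delta>\<bar> \<le> (norm y)\<^sup>2 + 2 * (norm x * norm y)"
      using zero_le_power2[of "norm y"] by linarith
    hence "\<bar>?\<delta>\<bar> / (2 * s\<^sup>2) \<le> ((norm y)\<^sup>2 + 2 * (norm x * norm y)) / (2 * s\<^sup>2)"
      by (intro divide_right_mono) auto
    also have "((norm y)\<^sup>2 + 2 * (norm x * norm y)) / (2 * s\<^sup>2) = v\<^sup>2 / 2 + u * v"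
      using s by (simp add: u_def v_def power2_eq_square add_divide_distrib)
    also have "v\<^sup>2 / 2 \<le> v" using mult_left_mono[OF uv(3) uv(2)] uv by (simp add: power2_eq_square)
    also have "\<bar>?\<delta>\<bar> / (2 * s\<^sup>2) = \<bar>a - b\<bar>"
    proof -
      have "a - b = (?\<delta>) / (2 * s\<^sup>2)"
        by (simp add: a_def b_def u_def power_divide diff_divide_distrib mult.commute)
      thus ?thesis by (simp only: abs_divide) simp
    qed
    finally show ?thesis by (simp add: algebra_simps)
  qed
  hence "\<bar>exp (- a) - exp (- b)\<bar> \<le> (v * (u + 1)) * (2 * exp (- (u\<^sup>2 / 4)))"
    by (intro order_trans[OF abs_exp_diff_le[OF ca cb]] mult_mono e) (use uv in auto)
  hence "\<bar>exp (- a) - exp (- b)\<bar>\<^sup>2 \<le> ((v * (u + 1)) * (2 * exp (- (u\<^sup>2 / 4))))\<^sup>2"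
    by (intro power_mono) auto
  also have "\<dots> = 4 * v\<^sup>2 * (u + 1)\<^sup>2 * exp (- b)"
    by (simp add: power_mult_distrib b_def flip: exp_double)
  also have "\<dots> \<le> 4 * v\<^sup>2 * (2 * (1 + u\<^sup>2)) * exp (- b)"
    using sum_squares_bound[of u 1] by (intro mult_right_mono mult_left_mono) (auto simp: power2_sum)
  finally have "(exp (- a) - exp (- b))\<^sup>2 / N\<^sup>2 \<le> 8 * v\<^sup>2 * (1 + u\<^sup>2) * exp (- b) / N\<^sup>2"
    by (intro divide_right_mono) (auto simp: algebra_simps)
  also have "(exp (- a) - exp (- b))\<^sup>2 / N\<^sup>2 = (gauss s (x - y) - gauss s x)\<^sup>2"
    by (simp add: g power_divide diff_divide_distrib[symmetric])
  also have "8 * v\<^sup>2 * (1 + u\<^sup>2) * exp (- b) / N\<^sup>2 = 8 / N * (norm y / s)\<^sup>2 * (1 + (norm x)\<^sup>2 / s\<^sup>2) * gauss s x"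
    by (simp add: g u_def v_def power_divide power2_eq_square)
  finally show ?thesis unfolding N_def .
qed

text \<open>
  The factor \<open>(|y| / s)\<^sup>2\<close> from the cancellation is the gain over a single Gaussian.
\<close>

lemma gauss_diff_weighted_near:
  fixes y :: "real ^ 'n::finite"
  assumes s: "s \<ge> 1" and q: "0 \<le> q" "q \<le> 3" and y: "norm y \<le> s"
  shows "weighted_square q (\<lambda>x. gauss s (x - y) - gauss s x)
    \<le> ennreal (16 * (385 * sqrt 2 ^ CARD('n)) * s powr (q - real CARD('n) - 2) * (norm y)\<^sup>2)"
proof -
  have s0: "s > 0" using s by simp
  let ?M = "385 * sqrt 2 ^ CARD('n) :: real"
  define K where "K = 8 / (s * sqrt (2 * pi)) ^ CARD('n) * (norm y / s)\<^sup>2"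
  have K0: "K \<ge> 0" using s0 by (simp add: K_def)
  have "weighted_square q (\<lambda>x. gauss s (x - y) - gauss s x) \<le>
    (\<integral>\<^sup>+ x. ennreal K * (ennreal (norm x powr q * gauss s x) + ennreal (1 / s\<^sup>2) * ennreal (norm x powr (q + 2) * gauss s (x::real^'n))) \<partial>lborel)"
  proof (rule nn_integral_mono)
    fix x :: "real^'n"
    have "norm x powr q * (gauss s (x - y) - gauss s x)\<^sup>2 \<le> norm x powr q * (K * (1 + (norm x)\<^sup>2 / s\<^sup>2) * gauss s x)"
      unfolding K_def by (intro mult_left_mono gauss_diff_le s0 y) auto
    also have "\<dots> = K * (norm x powr q * gauss s x + 1 / s\<^sup>2 * (norm x powr (q + 2) * gauss s x))"
      by (simp add: powr_add algebra_simps)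
    finally show "ennreal (norm x powr q * (gauss s (x - y) - gauss s x)\<^sup>2) \<le> ennreal K * (ennreal (norm x powr q * gauss s x) + ennreal (1 / s\<^sup>2) * ennreal (norm x powr (q + 2) * gauss s x))"
      using K0 by (simp add: ennreal_mult[symmetric] ennreal_plus[symmetric] ennreal_leI del: ennreal_plus)
  qed
  also have "\<dots> = ennreal K * ((\<integral>\<^sup>+ x. ennreal (norm x powr q * gauss s (x::real^'n)) \<partial>lborel) + ennreal (1 / s\<^sup>2) * (\<integral>\<^sup>+ x. ennreal (norm x powr (q + 2) * gauss s (x::real^'n)) \<partial>lborel))"
    by (simp add: nn_integral_cmult nn_integral_add)
  also have "\<dots> \<le> ennreal K * (ennreal (?M * s powr q) + ennreal (1 / s\<^sup>2) * ennreal (?M * s powr (q + 2)))"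
    using q by (intro mult_left_mono add_mono gauss_moment_le s0) auto
  also have "\<dots> = ennreal (K * (?M * s powr q + 1 / s\<^sup>2 * (?M * s powr (q + 2))))"
    using K0 by (simp add: ennreal_mult[symmetric] ennreal_plus[symmetric] del: ennreal_plus)
  also have "K * (?M * s powr q + 1 / s\<^sup>2 * (?M * s powr (q + 2))) = K * (2 * ?M * s powr q)"
    using s0 by (simp add: powr_add)
  also have "\<dots> \<le> (8 / s ^ CARD('n) * (norm y / s)\<^sup>2) * (2 * ?M * s powr q)"
  proof -
    have "1 \<le> sqrt (2 * pi)" using pi_gt3 by simp
    hence "s * 1 \<le> s * sqrt (2 * pi)" using s0 by (intro mult_left_mono) auto
    hence "s ^ CARD('n) \<le> (s * sqrt (2 * pi)) ^ CARD('n)" using s0 by (intro power_mono) auto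
    hence "8 / (s * sqrt (2 * pi)) ^ CARD('n) \<le> 8 / s ^ CARD('n)" using s0 by (intro divide_left_mono) auto
    thus ?thesis unfolding K_def by (intro mult_right_mono) auto
  qed
  also have "\<dots> = 16 * ?M * s powr (q - real CARD('n) - 2) * (norm y)\<^sup>2"
    using s0 by (simp add: powr_diff powr_realpow power_divide)
  finally show ?thesis by (simp add: ennreal_leI)
qed

text \<open>
  A shift beyond the width leaves no cancellation, and the two Gaussians are estimated separately.
  The shifted one carries its weight at distance \<open>|y|\<close>.
\<close>

lemma gauss_diff_weighted_far:
  fixes y :: "real ^ 'n::finite"
  assumes s: "s \<ge> 1" and q: "0 \<le> q" "q \<le> 3" and y: "norm y > s"
  shows "weighted_square q (\<lambda>x. gauss s (x - y) - gauss s x)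
    \<le> ennreal (48 * (385 * sqrt 2 ^ CARD('n)) * s powr (- real CARD('n)) * norm y powr q)"
proof -
  have s0: "s > 0" using s by simp
  let ?M = "385 * sqrt 2 ^ CARD('n) :: real"
  define K where "K = 2 / (s * sqrt (2 * pi)) ^ CARD('n)"
  have K0: "K \<ge> 0" using s0 by (simp add: K_def)
  have gs: "(gauss s z)\<^sup>2 \<le> 1 / (s * sqrt (2 * pi)) ^ CARD('n) * gauss s z" for z :: "real^'n"
    using mult_right_mono[OF gauss_le[OF s0, of z], of "gauss s z"] by (simp add: power2_eq_square)
  have "weighted_square q (\<lambda>x. gauss s (x - y) - gauss s x) \<le>
    (\<integral>\<^sup>+ x. ennreal K * (ennreal (norm x powr q * gauss s (x - y)) + ennreal (norm x powr q * gauss s (x - 0))) \<partial>lborel)"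
  proof (rule nn_integral_mono)
    fix x :: "real^'n"
    have "(gauss s (x - y) - gauss s x)\<^sup>2 \<le> K * (gauss s (x - y) + gauss s x)"
      using norm_diff_power2_le[of "gauss s (x - y)" "gauss s x"] gs[of x] gs[of "x - y"] by (simp add: K_def algebra_simps add_divide_distrib)
    hence "norm x powr q * (gauss s (x - y) - gauss s x)\<^sup>2 \<le> norm x powr q * (K * (gauss s (x - y) + gauss s x))"
      by (intro mult_left_mono) auto
    thus "ennreal (norm x powr q * (gauss s (x - y) - gauss s x)\<^sup>2) \<le> ennreal K * (ennreal (norm x powr q * gauss s (x - y)) + ennreal (norm x powr q * gauss s (x - 0)))"
      using K0 by (simp add: ennreal_mult[symmetric] ennreal_plus[symmetric] ennreal_leI algebra_simps del: ennreal_plus)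
  qed
  also have "\<dots> = ennreal K * ((\<integral>\<^sup>+ x. ennreal (norm x powr q * gauss s (x - y)) \<partial>lborel) + (\<integral>\<^sup>+ x. ennreal (norm x powr q * gauss s (x - 0 ::real^'n)) \<partial>lborel))"
    by (simp add: nn_integral_cmult nn_integral_add)
  also have "\<dots> \<le> ennreal K * (ennreal (2 powr q * ?M * (s powr q + norm y powr q)) + ennreal (2 powr q * ?M * (s powr q + norm (0::real^'n) powr q)))"
    using q by (intro mult_left_mono add_mono gauss_shifted_moment_le s0) auto
  also have "\<dots> = ennreal (K * (2 powr q * ?M * (s powr q + norm y powr q) + 2 powr q * ?M * (s powr q + norm (0::real^'n) powr q)))"
    using K0 by (simp add: ennreal_mult[symmetric] ennreal_plus[symmetric] del: ennreal_plus)
  also have "K * (2 powr q * ?M * (s powr q + norm y powr q) + 2 powr q * ?M * (s powr q + norm (0::real^'n) powr q)) = K * (2 powr q * ?M * (2 * s powr q + norm y powr q))"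
    by (simp add: algebra_simps)
  also have "\<dots> \<le> (2 * s powr (- real CARD('n))) * (8 * ?M * (3 * norm y powr q))"
  proof (intro mult_mono)
    have "1 \<le> sqrt (2 * pi)" using pi_gt3 by simp
    hence "s * 1 \<le> s * sqrt (2 * pi)" using s0 by (intro mult_left_mono) auto
    hence "s ^ CARD('n) \<le> (s * sqrt (2 * pi)) ^ CARD('n)" using s0 by (intro power_mono) auto
    hence "K \<le> 2 / s ^ CARD('n)" using s0 unfolding K_def by (intro divide_left_mono) auto
    thus "K \<le> 2 * s powr (- real CARD('n))" using s0 by (simp add: powr_minus powr_realpow field_simps)
    have "2 powr q \<le> 2 powr (3::real)" using q by (intro powr_mono) auto
    thus "2 powr q \<le> 8" by simp
    have "s powr q \<le> norm y powr q" using s0 y q by (intro powr_mono2) auto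
    thus "2 * s powr q + norm y powr q \<le> 3 * norm y powr q" by simp
  qed auto
  also have "\<dots> = 48 * ?M * s powr (- real CARD('n)) * norm y powr q" by simp
  finally show ?thesis by (simp add: ennreal_leI)
qed

text \<open>
  Both regimes decay faster than \<open>s\<^sup>-\<^sup>2\<close>, which makes their square roots integrable at infinity. For
  small shifts the decay is \<open>s\<close> to the power \<open>q - d - 2\<close>, whence \<open>q < d\<close>. For large shifts it is only
  \<open>s\<close> to the power \<open>-d\<close>, which is not enough for \<open>d = 2\<close>; there \<open>s < |y|\<close> allows a factor
  \<open>s\<close> to the power \<open>1/2\<close> to be traded for one of \<open>|y|\<close>. The resulting growth \<open>q + 1/2 \<le> 7/2\<close> in
  \<open>|y|\<close> determines how many moments of \<open>f\<close> are used.
\<close>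

lemma gauss_diff_weighted:
  fixes y :: "real ^ 'n::finite"
  assumes s: "s \<ge> 1" and q: "0 \<le> q" "q \<le> 3" and d: "2 \<le> CARD('n)"
    and \<kappa>: "2 * \<kappa> \<le> real CARD('n) - q" "2 * \<kappa> \<le> 1/2"
  shows "weighted_square q (\<lambda>x. gauss s (x - y) - gauss s x)
    \<le> ennreal (48 * (385 * sqrt 2 ^ CARD('n)) * s powr (- 2 - 2 * \<kappa>) * (1 + norm y) powr (7/2))"
proof -
  let ?M = "385 * sqrt 2 ^ CARD('n) :: real"
  have y1: "norm y powr p \<le> (1 + norm y) powr (7/2)" if "0 \<le> p" "p \<le> 7/2" for p
  proof -
    have "norm y powr p \<le> (1 + norm y) powr p" using that by (intro powr_mono2) auto
    also have "\<dots> \<le> (1 + norm y) powr (7/2)" using that by (intro powr_mono) auto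
    finally show ?thesis .
  qed
  show ?thesis
  proof (cases "norm y \<le> s")
    case True
    note gauss_diff_weighted_near[OF s q True]
    also have "16 * ?M * s powr (q - real CARD('n) - 2) * (norm y)\<^sup>2 \<le> 48 * ?M * s powr (- 2 - 2 * \<kappa>) * (1 + norm y) powr (7/2)"
    proof (intro mult_mono)
      show "s powr (q - real CARD('n) - 2) \<le> s powr (- 2 - 2 * \<kappa>)" using s \<kappa> by (intro powr_mono) auto
      show "(norm y)\<^sup>2 \<le> (1 + norm y) powr (7/2)"
        using y1[of 2] by (cases "y = 0") auto
    qed auto
    finally show ?thesis by (simp add: ennreal_leI)
  next
    case False
    hence ys: "norm y > s" by simp
    note gauss_diff_weighted_far[OF s q ys]
    also have "48 * ?M * s powr (- real CARD('n)) * norm y powr q \<le> 48 * ?M * (s powr (- 2 - 2 * \<kappa>) * (1 + norm y) powr (7/2))"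
    proof -
      have "s powr (- real CARD('n)) * norm y powr q = s powr (- real CARD('n) - 1/2) * (s powr (1/2) * norm y powr q)"
        using s by (simp add: mult.assoc[symmetric] powr_add[symmetric])
      also have "\<dots> \<le> s powr (- 2 - 2 * \<kappa>) * (norm y powr (1/2) * norm y powr q)"
        using s \<kappa> d ys by (intro mult_mono powr_mono powr_mono2) auto
      also have "norm y powr (1/2) * norm y powr q = norm y powr (1/2 + q)"
        by (simp add: powr_add)
      also have "\<dots> \<le> (1 + norm y) powr (7/2)" using q by (intro y1) auto
      finally have "s powr (- real CARD('n)) * norm y powr q \<le> s powr (- 2 - 2 * \<kappa>) * (1 + norm y) powr (7/2)"
        by (simp add: mult_left_mono)
      from mult_left_mono[OF this, of "48 * ?M"] show ?thesis by (simp add: mult.assoc)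
    qed
    finally show ?thesis by (simp add: ennreal_leI mult.assoc)
  qed
qed

section \<open>Weighted decay of the heat flow\<close>

text \<open>
  The Cauchy--Schwarz inequality with a free weight \<open>w\<close>. If \<open>a\<close> depends on a further variable and its
  norm in that variable is at most \<open>w\<close>, integrating the right-hand side gives Minkowski's integral
  inequality with the bound \<open>w\<close> in place of the norm.
\<close>

lemma nn_integral_power2_le:
  fixes a w :: "'a \<Rightarrow> real"
  assumes [measurable]: "a \<in> borel_measurable M" "w \<in> borel_measurable M"
    and w: "\<And>x. 0 \<le> w x" and a: "\<And>x. w x = 0 \<Longrightarrow> a x = 0"
  shows "(\<integral>\<^sup>+x. ennreal \<bar>a x\<bar> \<partial>M)\<^sup>2 \<le> (\<integral>\<^sup>+x. ennreal (w x) \<partial>M) * (\<integral>\<^sup>+x. ennreal ((a x)\<^sup>2 / w x) \<partial>M)"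
proof -
  have 1: "ennreal \<bar>a x\<bar> = ennreal (sqrt (w x)) * ennreal (\<bar>a x\<bar> / sqrt (w x))" for x
    using w[of x] a[of x] by (cases "w x = 0") (auto simp: ennreal_mult[symmetric])
  have 2: "(ennreal (sqrt (w x)))\<^sup>2 = ennreal (w x)" for x
    using w[of x] by (simp add: ennreal_power)
  have 3: "(ennreal (\<bar>a x\<bar> / sqrt (w x)))\<^sup>2 = ennreal ((a x)\<^sup>2 / w x)" for x
    using w[of x] by (simp add: ennreal_power power_divide)
  have "(\<integral>\<^sup>+x. ennreal (sqrt (w x)) * ennreal (\<bar>a x\<bar> / sqrt (w x)) \<partial>M)\<^sup>2 \<le>
    (\<integral>\<^sup>+x. (ennreal (sqrt (w x)))\<^sup>2 \<partial>M) * (\<integral>\<^sup>+x. (ennreal (\<bar>a x\<bar> / sqrt (w x)))\<^sup>2 \<partial>M)"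
    by (rule Cauchy_Schwarz_nn_integral) measurable
  thus ?thesis by (simp only: 1[symmetric] 2 3)
qed

lemma abs_integral_le_nn_integral:
  fixes a :: "'a \<Rightarrow> real"
  shows "ennreal \<bar>LINT x|M. a x\<bar> \<le> (\<integral>\<^sup>+x. ennreal \<bar>a x\<bar> \<partial>M)"
proof (cases "integrable M a")
  case True
  thus ?thesis using integral_norm_bound_ennreal[OF True] by simp
qed (simp add: not_integrable_integral_eq)

lemma integral_power2_le:
  fixes a w :: "'a \<Rightarrow> real"
  assumes "a \<in> borel_measurable M" "w \<in> borel_measurable M"
    and "\<And>x. 0 \<le> w x" and "\<And>x. w x = 0 \<Longrightarrow> a x = 0"
  shows "ennreal ((LINT x|M. a x)\<^sup>2) \<le> (\<integral>\<^sup>+x. ennreal (w x) \<partial>M) * (\<integral>\<^sup>+x. ennreal ((a x)\<^sup>2 / w x) \<partial>M)"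
proof -
  have "ennreal ((LINT x|M. a x)\<^sup>2) = (ennreal \<bar>LINT x|M. a x\<bar>)\<^sup>2" by (simp add: ennreal_power)
  also have "\<dots> \<le> (\<integral>\<^sup>+x. ennreal \<bar>a x\<bar> \<partial>M)\<^sup>2" by (intro power_mono abs_integral_le_nn_integral) auto
  also have "\<dots> \<le> (\<integral>\<^sup>+x. ennreal (w x) \<partial>M) * (\<integral>\<^sup>+x. ennreal ((a x)\<^sup>2 / w x) \<partial>M)"
    by (rule nn_integral_power2_le[OF assms])
  finally show ?thesis .
qed

lemma nn_integral_atLeast_powr:
  assumes "a > 1" "b \<ge> 0"
  shows "(\<integral>\<^sup>+x. ennreal ((1 + x) powr (- a)) * indicator {b..} x \<partial>lborel) = ennreal ((1 + b) powr (1 - a) / (a - 1))"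
proof -
  define c where "c = - 1 / (a - 1)"
  have c: "c * (1 - a) = 1" using assms by (simp add: c_def field_simps)
  have "(\<integral>\<^sup>+x. ennreal ((1 + x) powr (- a)) * indicator {b..} x \<partial>lborel) = ennreal (0 - c * (1 + b) powr (1 - a))"
  proof (rule nn_integral_FTC_atLeast)
    fix x :: real assume x: "b \<le> x"
    have "((\<lambda>x. c * (1 + x) powr (1 - a)) has_real_derivative c * ((1 - a) * (1 + x) powr (1 - a - 1))) (at x)"
      using x assms by (auto intro!: derivative_eq_intros)
    also have "c * ((1 - a) * (1 + x) powr (1 - a - 1)) = (1 + x) powr (- a)"
      by (simp add: mult.assoc[symmetric] c)
    finally show "((\<lambda>x. c * (1 + x) powr (1 - a)) has_real_derivative (1 + x) powr (- a)) (at x)" .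
  next
    have "((\<lambda>x. (1 + x) powr (1 - a)) \<longlongrightarrow> 0) at_top"
      using assms by (intro tendsto_neg_powr filterlim_tendsto_add_at_top[OF tendsto_const] filterlim_ident) auto
    hence "((\<lambda>x. c * (1 + x) powr (1 - a)) \<longlongrightarrow> c * 0) at_top"
      by (intro tendsto_intros) auto
    thus "((\<lambda>x. c * (1 + x) powr (1 - a)) \<longlongrightarrow> 0) at_top" by simp
  qed auto
  thus ?thesis by (simp add: c_def)
qed

lemma nn_integral_powr_abs_finite:
  assumes "a > 1"
  shows "(\<integral>\<^sup>+x. ennreal ((1 + \<bar>x\<bar>) powr (- a)) \<partial>(lborel :: real measure)) < \<infinity>"
proof -
  let ?h = "\<lambda>x::real. ennreal ((1 + x) powr (- a)) * indicator {0..} x"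
  have "(\<integral>\<^sup>+x. ennreal ((1 + \<bar>x\<bar>) powr (- a)) \<partial>(lborel :: real measure)) \<le> (\<integral>\<^sup>+x. ?h x + ?h (0 - x) \<partial>lborel)"
    by (intro nn_integral_mono) (auto simp: indicator_def)
  also have "\<dots> = (\<integral>\<^sup>+x. ?h x \<partial>lborel) + (\<integral>\<^sup>+x. ?h (0 - x) \<partial>lborel)"
    by (rule nn_integral_add) measurable
  also have "(\<integral>\<^sup>+x. ?h (0 - x) \<partial>lborel) = (\<integral>\<^sup>+x. ?h x \<partial>lborel)"
    by (rule nn_integral_reflect) measurable
  also have "(\<integral>\<^sup>+x. ?h x \<partial>lborel) = ennreal (1 / (a - 1))"
    using nn_integral_atLeast_powr[OF assms, of 0] by simp
  finally show ?thesis by (auto simp: less_top[symmetric] top_unique)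
qed

lemma one_plus_norm_pos [simp]: "0 < 1 + norm x" "1 + norm x \<noteq> 0"
  using norm_ge_zero[of x] by linarith+

text \<open>
  Since \<open>|x|\<close> dominates each coordinate, \<open>(1 + |x|)\<close> to the power \<open>-p\<close> is at most the product of the
  one-dimensional factors with exponent \<open>-p/d\<close>, and \<open>p/d > 1\<close>.
\<close>

lemma nn_integral_powr_norm_finite:
  assumes p: "p > real CARD('n)"
  shows "(\<integral>\<^sup>+x. ennreal ((1 + norm x) powr (- p)) \<partial>(lborel :: (real ^ 'n::finite) measure)) < \<infinity>"
proof -
  define a where "a = p / real CARD('n)"
  have a: "a > 1" using p by (simp add: a_def)
  let ?f = "\<lambda>x::real. (1 + \<bar>x\<bar>) powr (- a)"
  have le: "(1 + norm x) powr (- p) \<le> (\<Prod>i\<in>UNIV. ?f (x $ i))" for x :: "real ^ 'n"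
  proof -
    have "(1 + norm x) powr (- p) = ((1 + norm x) powr (- a)) powr real CARD('n)"
      by (simp add: powr_powr a_def)
    also have "\<dots> = (\<Prod>i\<in>(UNIV::'n set). (1 + norm x) powr (- a))"
      by (simp add: powr_realpow add_pos_nonneg)
    also have "\<dots> \<le> (\<Prod>i\<in>UNIV. ?f (x $ i))"
      using a component_le_norm_cart[of x] by (intro prod_mono) (auto intro!: powr_mono2')
    finally show ?thesis .
  qed
  have i: "integrable lborel ?f"
    using nn_integral_powr_abs_finite[OF a] by (intro integrableI_bounded) auto
  have "integrable lborel (\<lambda>x::real^'n. \<Prod>i\<in>UNIV. ?f (x $ i))"
    by (rule integrable_prod_vec[of "\<lambda>_. ?f"]) (rule i)
  hence "integrable lborel (\<lambda>x::real^'n. (1 + norm x) powr (- p))"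
    by (rule Bochner_Integration.integrable_bound) (use le in \<open>auto intro!: AE_I2 order_trans[OF le] simp: abs_prod\<close>)
  thus ?thesis by (simp add: integrable_iff_bounded)
qed

text \<open>
  The parameter is the width of the Gaussian: this is the heat semigroup at time \<open>s\<^sup>2 / 2\<close>. With the
  width as variable, \<open>1 / |\<xi>|\<close> is a superposition with constant density.
\<close>

definition heat :: "real \<Rightarrow> (real ^ 'n \<Rightarrow> real) \<Rightarrow> real ^ 'n \<Rightarrow> real" where
  "heat s f x = (LINT y|lborel. gauss s (x - y) * f y)"

lemma heat_measurable [measurable (raw)]:
  assumes [measurable]: "f \<in> borel_measurable borel" "s \<in> borel_measurable M" "h \<in> borel_measurable M"
  shows "(\<lambda>z. heat (s z) f (h z)) \<in> borel_measurable M"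
  unfolding heat_def by measurable

lemma integrable_gauss_mult:
  fixes f :: "real ^ 'n::finite \<Rightarrow> real"
  assumes "integrable lborel f" and s: "s > 0"
  shows "integrable lborel (\<lambda>y. gauss s (x - y) * f y)"
proof -
  let ?K = "1 / (s * sqrt (2 * pi)) ^ CARD('n)"
  have [measurable]: "f \<in> borel_measurable borel" using assms by auto
  have K: "\<bar>gauss s z\<bar> \<le> \<bar>?K\<bar>" for z :: "real^'n" using gauss_le[OF s, of z] gauss_nonneg[of s z] by linarith
  show ?thesis
  proof (rule Bochner_Integration.integrable_bound)
    show "integrable lborel (\<lambda>y. ?K * f y)" using assms by simp
    show "AE y in lborel. norm (gauss s (x - y) * f y) \<le> norm (?K * f y)"
      by (simp only: real_norm_def abs_mult[of "gauss _ _"] abs_mult[of ?K]) (intro AE_I2 mult_right_mono K abs_ge_zero)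
  qed measurable
qed

lemma heat_diff:
  fixes f g :: "real ^ 'n::finite \<Rightarrow> real"
  assumes "integrable lborel f" "integrable lborel g" "s > 0"
  shows "heat s (\<lambda>x. f x - g x) x = heat s f x - heat s g x"
  unfolding heat_def
  using Bochner_Integration.integral_diff[OF integrable_gauss_mult[OF assms(1,3)] integrable_gauss_mult[OF assms(2,3)]]
  by (simp add: algebra_simps)

definition weighted_energy :: "real \<Rightarrow> (real ^ 'n \<Rightarrow> real) \<Rightarrow> ennreal" where
  "weighted_energy p f = (\<integral>\<^sup>+y. ennreal ((1 + norm y) powr p * (f y)\<^sup>2) \<partial>lborel)"

lemma weighted_energy_mono: "p \<le> p' \<Longrightarrow> weighted_energy p f \<le> weighted_energy p' f"
  unfolding weighted_energy_def
  by (intro nn_integral_mono ennreal_leI mult_right_mono powr_mono) auto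

text \<open>
  By Jensen's inequality the square of the convolution is at most the convolution of the square; the
  weight is then moved onto the Gaussian, whose moments are bounded for \<open>s \<le> 1\<close>.
\<close>

lemma heat_weighted_small:
  fixes f :: "real ^ 'n::finite \<Rightarrow> real"
  assumes [measurable]: "f \<in> borel_measurable borel" and s: "0 < s" "s \<le> 1" and q: "0 \<le> q" "q \<le> 3"
  shows "weighted_square q (heat s f) \<le> ennreal (16 * (385 * sqrt 2 ^ CARD('n))) * weighted_energy q f"
proof -
  let ?M = "385 * sqrt 2 ^ CARD('n) :: real"
  have gpos: "gauss s z > 0" for z :: "real^'n" using s by (simp add: gauss_eq)
  have jensen: "ennreal ((heat s f x)\<^sup>2) \<le> (\<integral>\<^sup>+y. ennreal (gauss s (x - y) * (f y)\<^sup>2) \<partial>lborel)" for x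
  proof -
    have "ennreal ((heat s f x)\<^sup>2) \<le> (\<integral>\<^sup>+y. ennreal (gauss s (x - y)) \<partial>lborel) * (\<integral>\<^sup>+y. ennreal ((gauss s (x - y) * f y)\<^sup>2 / gauss s (x - y)) \<partial>lborel)"
      unfolding heat_def by (rule integral_power2_le) (use gpos in \<open>auto simp: less_le\<close>)
    also have "(\<integral>\<^sup>+y. ennreal (gauss s (x - y)) \<partial>lborel) = 1" by (rule nn_integral_gauss_shift[OF s(1)])
    also have "(\<lambda>y. (gauss s (x - y) * f y)\<^sup>2 / gauss s (x - y)) = (\<lambda>y. gauss s (x - y) * (f y)\<^sup>2)"
      using gpos by (auto simp: power2_eq_square fun_eq_iff less_le)
    finally show ?thesis by simp
  qed
  have "weighted_square q (heat s f) \<le> (\<integral>\<^sup>+x. \<integral>\<^sup>+y. ennreal (norm x powr q * gauss s (x - y)) * ennreal ((f y)\<^sup>2) \<partial>lborel \<partial>lborel)"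
  proof (rule nn_integral_mono)
    fix x
    have "ennreal (norm x powr q * (heat s f x)\<^sup>2) = ennreal (norm x powr q) * ennreal ((heat s f x)\<^sup>2)"
      by (simp add: ennreal_mult)
    also have "\<dots> \<le> ennreal (norm x powr q) * (\<integral>\<^sup>+y. ennreal (gauss s (x - y) * (f y)\<^sup>2) \<partial>lborel)"
      by (intro mult_left_mono jensen) auto
    also have "\<dots> = (\<integral>\<^sup>+y. ennreal (norm x powr q) * ennreal (gauss s (x - y) * (f y)\<^sup>2) \<partial>lborel)"
      by (subst nn_integral_cmult) auto
    finally show "ennreal (norm x powr q * (heat s f x)\<^sup>2) \<le> (\<integral>\<^sup>+y. ennreal (norm x powr q * gauss s (x - y)) * ennreal ((f y)\<^sup>2) \<partial>lborel)"
      by (simp add: ennreal_mult mult.assoc)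
  qed
  also have "\<dots> = (\<integral>\<^sup>+y. \<integral>\<^sup>+x. ennreal (norm x powr q * gauss s (x - y)) * ennreal ((f y)\<^sup>2) \<partial>lborel \<partial>lborel)"
    by (rule lborel_pair.Fubini') measurable
  also have "\<dots> = (\<integral>\<^sup>+y. (\<integral>\<^sup>+x. ennreal (norm x powr q * gauss s (x - y)) \<partial>lborel) * ennreal ((f y)\<^sup>2) \<partial>lborel)"
    by (intro nn_integral_cong nn_integral_multc) measurable
  also have "\<dots> \<le> (\<integral>\<^sup>+y. ennreal (16 * ?M) * ennreal ((1 + norm y) powr q * (f y)\<^sup>2) \<partial>lborel)"
  proof (rule nn_integral_mono)
    fix y :: "real^'n"
    have "(\<integral>\<^sup>+x. ennreal (norm x powr q * gauss s (x - y)) \<partial>lborel) \<le> ennreal (2 powr q * ?M * (s powr q + norm y powr q))"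
      using q by (intro gauss_shifted_moment_le s) auto
    also have "2 powr q * ?M * (s powr q + norm y powr q) \<le> 8 * ?M * (2 * (1 + norm y) powr q)"
    proof (intro mult_mono)
      have "2 powr q \<le> 2 powr (3::real)" using q by (intro powr_mono) auto
      thus "2 powr q \<le> 8" by simp
      have "s powr q \<le> (1 + norm y) powr q" using s q by (intro powr_mono2) (auto intro: order_trans[of _ 1])
      moreover have "norm y powr q \<le> (1 + norm y) powr q" using q by (intro powr_mono2) auto
      ultimately show "s powr q + norm y powr q \<le> 2 * (1 + norm y) powr q" by simp
    qed auto
    finally have "(\<integral>\<^sup>+x. ennreal (norm x powr q * gauss s (x - y)) \<partial>lborel) \<le> ennreal (16 * ?M * (1 + norm y) powr q)"
      by (simp add: ennreal_leI mult_ac)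
    from mult_right_mono[OF this, of "ennreal ((f y)\<^sup>2)"]
    show "(\<integral>\<^sup>+x. ennreal (norm x powr q * gauss s (x - y)) \<partial>lborel) * ennreal ((f y)\<^sup>2) \<le> ennreal (16 * ?M) * ennreal ((1 + norm y) powr q * (f y)\<^sup>2)"
      by (simp add: ennreal_mult[symmetric] mult.assoc)
  qed
  also have "\<dots> = ennreal (16 * ?M) * weighted_energy q f"
    unfolding weighted_energy_def by (rule nn_integral_cmult) measurable
  finally show ?thesis .
qed

text \<open>
  As \<open>f\<close> has mean zero, \<open>gauss s x\<close> may be subtracted from the kernel. The weighted Cauchy--Schwarz
  inequality with \<open>\<rho> |f|\<close>, where \<open>\<rho> y\<close> is the growth in \<open>y\<close> of the norm of the difference of Gaussians,
  leaves a weighted \<open>L\<^sup>1\<close> norm of \<open>f\<close>.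
\<close>

lemma heat_weighted_large:
  fixes f :: "real ^ 'n::finite \<Rightarrow> real"
  assumes f: "integrable lborel f" and f0: "(LINT x|lborel. f x) = 0"
    and s: "1 \<le> s" and q: "0 \<le> q" "q \<le> 3" and d: "2 \<le> CARD('n)"
    and \<kappa>: "2 * \<kappa> \<le> real CARD('n) - q" "2 * \<kappa> \<le> 1/2"
  shows "weighted_square q (heat s f) \<le>
     ennreal (48 * (385 * sqrt 2 ^ CARD('n)) * s powr (- 2 - 2 * \<kappa>)) * (\<integral>\<^sup>+y. ennreal ((1 + norm y) powr (7/4) * \<bar>f y\<bar>) \<partial>lborel)\<^sup>2"
proof -
  have [measurable]: "f \<in> borel_measurable borel" using f by auto
  have s0: "0 < s" using s by simp
  let ?C = "48 * (385 * sqrt 2 ^ CARD('n)) * s powr (- 2 - 2 * \<kappa>)"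
  define D where "D x y = gauss s (x - y) - gauss s x" for x y :: "real^'n"
  have [measurable]: "(\<lambda>p. D (fst p) (snd p)) \<in> borel_measurable (borel \<Otimes>\<^sub>M borel)"
    unfolding D_def by measurable
  have [measurable]: "D x \<in> borel_measurable borel" "(\<lambda>x. D x y) \<in> borel_measurable borel" for x y
    unfolding D_def by measurable
  define \<rho> where "\<rho> y = (1 + norm y) powr (7/4)" for y :: "real^'n"
  have [measurable]: "\<rho> \<in> borel_measurable borel" unfolding \<rho>_def by measurable
  have \<rho>0: "\<rho> y > 0" for y by (simp add: \<rho>_def add_pos_nonneg)
  have \<rho>2: "\<rho> y * \<rho> y = (1 + norm y) powr (7/2)" for y by (simp add: \<rho>_def flip: powr_add)
  let ?P = "\<integral>\<^sup>+y. ennreal (\<rho> y * \<bar>f y\<bar>) \<partial>lborel"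
  let ?DD = "\<integral>\<^sup>+x. \<integral>\<^sup>+y. ennreal (norm x powr q * (D x y)\<^sup>2) * ennreal (\<bar>f y\<bar> / \<rho> y) \<partial>lborel \<partial>lborel"
  have h: "heat s f x = (LINT y|lborel. D x y * f y)" for x
  proof -
    have "(LINT y|lborel. D x y * f y) = (LINT y|lborel. gauss s (x - y) * f y - gauss s x * f y)"
      by (simp add: D_def algebra_simps)
    also have "\<dots> = heat s f x - gauss s x * (LINT y|lborel. f y)"
      using integrable_gauss_mult[OF f s0] f by (simp add: heat_def)
    finally show ?thesis by (simp add: f0)
  qed
  have cs: "ennreal ((heat s f x)\<^sup>2) \<le> ?P * (\<integral>\<^sup>+y. ennreal ((D x y)\<^sup>2 * (\<bar>f y\<bar> / \<rho> y)) \<partial>lborel)" for x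
  proof -
    have "ennreal ((heat s f x)\<^sup>2) \<le> ?P * (\<integral>\<^sup>+y. ennreal ((D x y * f y)\<^sup>2 / (\<rho> y * \<bar>f y\<bar>)) \<partial>lborel)"
      unfolding h by (rule integral_power2_le) (use \<rho>0 in \<open>auto simp: less_le\<close>)
    also have "(\<lambda>y. (D x y * f y)\<^sup>2 / (\<rho> y * \<bar>f y\<bar>)) = (\<lambda>y. (D x y)\<^sup>2 * (\<bar>f y\<bar> / \<rho> y))"
    proof
      fix y
      have "(D x y * f y)\<^sup>2 = (D x y)\<^sup>2 * (\<bar>f y\<bar> * \<bar>f y\<bar>)"
        by (simp only: abs_mult_self_eq power_mult_distrib power2_eq_square[of "f y"])
      thus "(D x y * f y)\<^sup>2 / (\<rho> y * \<bar>f y\<bar>) = (D x y)\<^sup>2 * (\<bar>f y\<bar> / \<rho> y)"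
        by (simp only:) (cases "f y = 0", simp_all add: divide_simps)
    qed
    finally show ?thesis .
  qed
  have "weighted_square q (heat s f) \<le>
    (\<integral>\<^sup>+x. ?P * (\<integral>\<^sup>+y. ennreal (norm x powr q * (D x y)\<^sup>2) * ennreal (\<bar>f y\<bar> / \<rho> y) \<partial>lborel) \<partial>lborel)"
  proof (rule nn_integral_mono)
    fix x
    have "ennreal (norm x powr q * (heat s f x)\<^sup>2) = ennreal (norm x powr q) * ennreal ((heat s f x)\<^sup>2)"
      by (simp add: ennreal_mult)
    also have "\<dots> \<le> ennreal (norm x powr q) * (?P * (\<integral>\<^sup>+y. ennreal ((D x y)\<^sup>2 * (\<bar>f y\<bar> / \<rho> y)) \<partial>lborel))"
      by (intro mult_left_mono cs) auto
    also have "\<dots> = ?P * (\<integral>\<^sup>+y. ennreal (norm x powr q) * ennreal ((D x y)\<^sup>2 * (\<bar>f y\<bar> / \<rho> y)) \<partial>lborel)"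
      by (subst nn_integral_cmult) (auto simp: mult_ac)
    also have "(\<lambda>y. ennreal (norm x powr q) * ennreal ((D x y)\<^sup>2 * (\<bar>f y\<bar> / \<rho> y))) = (\<lambda>y. ennreal (norm x powr q * (D x y)\<^sup>2) * ennreal (\<bar>f y\<bar> / \<rho> y))"
      using \<rho>0 by (simp add: ennreal_mult[symmetric] mult.assoc less_imp_le fun_eq_iff)
    finally show "ennreal (norm x powr q * (heat s f x)\<^sup>2) \<le> ?P * (\<integral>\<^sup>+y. ennreal (norm x powr q * (D x y)\<^sup>2) * ennreal (\<bar>f y\<bar> / \<rho> y) \<partial>lborel)" .
  qed
  also have "\<dots> = ?P * ?DD"
    by (rule nn_integral_cmult) (unfold D_def, measurable)
  finally have outer: "weighted_square q (heat s f) \<le>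
    ?P * ?DD" .
  have "?DD =
     (\<integral>\<^sup>+y. \<integral>\<^sup>+x. ennreal (norm x powr q * (D x y)\<^sup>2) * ennreal (\<bar>f y\<bar> / \<rho> y) \<partial>lborel \<partial>lborel)"
    by (rule lborel_pair.Fubini') (unfold D_def, measurable)
  also have "\<dots> = (\<integral>\<^sup>+y. (\<integral>\<^sup>+x. ennreal (norm x powr q * (D x y)\<^sup>2) \<partial>lborel) * ennreal (\<bar>f y\<bar> / \<rho> y) \<partial>lborel)"
    by (intro nn_integral_cong nn_integral_multc) measurable
  also have "\<dots> \<le> (\<integral>\<^sup>+y. ennreal ?C * ennreal (\<rho> y * \<bar>f y\<bar>) \<partial>lborel)"
  proof (rule nn_integral_mono)
    fix y
    have "(\<integral>\<^sup>+x. ennreal (norm x powr q * (D x y)\<^sup>2) \<partial>lborel) * ennreal (\<bar>f y\<bar> / \<rho> y) \<le> ennreal (?C * (1 + norm y) powr (7/2)) * ennreal (\<bar>f y\<bar> / \<rho> y)"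
      unfolding D_def by (intro mult_right_mono gauss_diff_weighted s q d \<kappa>) auto
    also have "\<dots> = ennreal ?C * ennreal (\<rho> y * \<bar>f y\<bar>)"
      unfolding \<rho>2[symmetric] using \<rho>0[of y] by (simp add: ennreal_mult[symmetric] less_imp_le mult.assoc)
    finally show "(\<integral>\<^sup>+x. ennreal (norm x powr q * (D x y)\<^sup>2) \<partial>lborel) * ennreal (\<bar>f y\<bar> / \<rho> y) \<le> ennreal ?C * ennreal (\<rho> y * \<bar>f y\<bar>)" .
  qed
  also have "\<dots> = ennreal ?C * ?P" by (rule nn_integral_cmult) measurable
  finally have "?P * ?DD \<le> ?P * (ennreal ?C * ?P)"
    by (intro mult_left_mono) auto
  from order_trans[OF outer this] show ?thesis
    by (simp only: \<rho>_def power2_eq_square mult_ac)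
qed

lemma moment_le_weighted_energy:
  fixes f :: "real ^ 'n::finite \<Rightarrow> real"
  assumes [measurable]: "f \<in> borel_measurable borel"
  shows "(\<integral>\<^sup>+y. ennreal ((1 + norm y) powr a * \<bar>f y\<bar>) \<partial>lborel)\<^sup>2 \<le>
    (\<integral>\<^sup>+y. ennreal ((1 + norm y) powr (- (p - 2 * a))) \<partial>(lborel :: (real^'n) measure)) * weighted_energy p f"
proof -
  have eq: "((1 + norm y) powr a * f y)\<^sup>2 / (1 + norm y) powr (- (p - 2 * a)) = (1 + norm y) powr p * (f y)\<^sup>2" for y :: "real^'n"
  proof -
    have "((1 + norm y) powr a)\<^sup>2 / (1 + norm y) powr (- (p - 2 * a)) = (1 + norm y) powr p"
      by (simp add: power2_eq_square flip: powr_add powr_diff)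
    thus ?thesis by (simp only: power_mult_distrib times_divide_eq_left[symmetric])
  qed
  have "(\<integral>\<^sup>+y. ennreal \<bar>(1 + norm y) powr a * f y\<bar> \<partial>lborel)\<^sup>2 \<le>
    (\<integral>\<^sup>+y. ennreal ((1 + norm y) powr (- (p - 2 * a))) \<partial>(lborel :: (real^'n) measure)) *
    (\<integral>\<^sup>+y. ennreal (((1 + norm y) powr a * f y)\<^sup>2 / (1 + norm y) powr (- (p - 2 * a))) \<partial>lborel)"
    by (rule nn_integral_power2_le) (auto simp: add_nonneg_eq_0_iff)
  thus ?thesis unfolding eq weighted_energy_def by (simp add: abs_mult)
qed

text \<open>
  For \<open>s \<le> 1\<close> and for \<open>s \<ge> 1\<close> the bounds \<open>1\<close> and \<open>s\<close> to the power \<open>-1-\<kappa>\<close> are comparable to the single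
  expression \<open>(1 + s)\<close> to the power \<open>-1-\<kappa>\<close>, which is integrable over all widths.
\<close>

lemma heat_weighted_le:
  assumes q: "0 \<le> q" "q \<le> 3" and d: "2 \<le> CARD('n::finite)"
    and \<kappa>: "0 \<le> \<kappa>" "2 * \<kappa> \<le> real CARD('n) - q" "2 * \<kappa> \<le> 1/2" and p: "p > real CARD('n) + 7/2"
  obtains C where "0 \<le> C" "\<And>(f :: real ^ 'n \<Rightarrow> real) s. integrable lborel f \<Longrightarrow> (LINT x|lborel. f x) = 0 \<Longrightarrow> 0 < s \<Longrightarrow>
    weighted_square q (heat s f) \<le> ennreal (C * ((1 + s) powr (- 1 - \<kappa>))\<^sup>2) * weighted_energy p f"
proof -
  define M where "M = (385 * sqrt 2 ^ CARD('n) :: real)"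
  have M: "0 \<le> M" by (simp add: M_def)
  define J where "J = (\<integral>\<^sup>+y. ennreal ((1 + norm y) powr (- (p - 2 * (7/4)))) \<partial>(lborel :: (real^'n) measure))"
  have J: "J < \<infinity>" unfolding J_def by (rule nn_integral_powr_norm_finite) (use p in simp)
  then obtain j where j: "J = ennreal j" "0 \<le> j" by (cases J) auto
  \<comment> \<open>The factor \<open>8\<close> pays for replacing \<open>1\<close> and \<open>s\<close> by \<open>1 + s \<le> 2 max 1 s\<close>; see \<open>pw\<close>.\<close>
  define C where "C = 8 * (16 * M + 48 * M * j)"
  have C: "0 \<le> C" using j by (simp add: C_def M)
  have pw: "2 powr (2 + 2 * \<kappa>) \<le> 8"
  proof -
    have "2 powr (2 + 2 * \<kappa>) \<le> 2 powr (3::real)" using \<kappa> by (intro powr_mono) auto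
    thus ?thesis by simp
  qed
  show ?thesis
  proof (rule that[OF C])
    fix f :: "real^'n \<Rightarrow> real" and s :: real
    assume f: "integrable lborel f" "(LINT x|lborel. f x) = 0" and s: "0 < s"
    have [measurable]: "f \<in> borel_measurable borel" using f by auto
    have w: "((1 + s) powr (- 1 - \<kappa>))\<^sup>2 = (1 + s) powr (- 2 - 2 * \<kappa>)"
      by (simp add: power2_eq_square flip: powr_add)
    show "weighted_square q (heat s f) \<le> ennreal (C * ((1 + s) powr (- 1 - \<kappa>))\<^sup>2) * weighted_energy p f"
    proof (cases "s \<le> 1")
      case True
      have "weighted_square q (heat s f) \<le> ennreal (16 * M) * weighted_energy q f"
        unfolding M_def by (rule heat_weighted_small) (use True s q in auto)
      also have "\<dots> \<le> ennreal (C * ((1 + s) powr (- 1 - \<kappa>))\<^sup>2) * weighted_energy p f"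
      proof (rule mult_mono[OF ennreal_leI weighted_energy_mono])
        have "1 \<le> 8 * (1 + s) powr (- 2 - 2 * \<kappa>)"
        proof -
          have "1 = 2 powr (2 + 2 * \<kappa>) * 2 powr (- 2 - 2 * \<kappa>)" by (simp flip: powr_add)
          also have "\<dots> \<le> 8 * (1 + s) powr (- 2 - 2 * \<kappa>)"
            using True s \<kappa> by (intro mult_mono pw powr_mono2') auto
          finally show ?thesis .
        qed
        hence "16 * M * 1 \<le> (16 * M + 48 * M * j) * (8 * (1 + s) powr (- 2 - 2 * \<kappa>))"
          using j M by (intro mult_mono) auto
        thus "16 * M \<le> C * ((1 + s) powr (- 1 - \<kappa>))\<^sup>2" by (simp only: w C_def mult_ac mult_1_right mult_1_left)
      qed (use p q in auto)
      finally show ?thesis .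
    next
      case False
      have "weighted_square q (heat s f) \<le>
        ennreal (48 * M * s powr (- 2 - 2 * \<kappa>)) * (\<integral>\<^sup>+y. ennreal ((1 + norm y) powr (7/4) * \<bar>f y\<bar>) \<partial>lborel)\<^sup>2"
        unfolding M_def by (rule heat_weighted_large) (use False f q d \<kappa> in auto)
      also have "\<dots> \<le> ennreal (48 * M * s powr (- 2 - 2 * \<kappa>)) * (J * weighted_energy p f)"
        unfolding J_def by (intro mult_left_mono moment_le_weighted_energy) auto
      also have "\<dots> = ennreal (48 * M * s powr (- 2 - 2 * \<kappa>) * j) * weighted_energy p f"
        using j M by (simp add: mult.assoc[symmetric] ennreal_mult[symmetric])
      also have "\<dots> \<le> ennreal (C * ((1 + s) powr (- 1 - \<kappa>))\<^sup>2) * weighted_energy p f"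
      proof (intro mult_right_mono ennreal_leI)
        have "s powr (- 2 - 2 * \<kappa>) = 2 powr (2 + 2 * \<kappa>) * (2 * s) powr (- 2 - 2 * \<kappa>)"
          using s by (simp add: powr_mult mult.assoc[symmetric] flip: powr_add)
        also have "\<dots> \<le> 8 * (1 + s) powr (- 2 - 2 * \<kappa>)"
          using False \<kappa> by (intro mult_mono pw powr_mono2') auto
        finally have sp: "s powr (- 2 - 2 * \<kappa>) \<le> 8 * (1 + s) powr (- 2 - 2 * \<kappa>)" .
        have "48 * M * j * s powr (- 2 - 2 * \<kappa>) \<le> (16 * M + 48 * M * j) * (8 * (1 + s) powr (- 2 - 2 * \<kappa>))"
          using j M sp by (intro mult_mono) auto
        thus "48 * M * s powr (- 2 - 2 * \<kappa>) * j \<le> C * ((1 + s) powr (- 1 - \<kappa>))\<^sup>2" by (simp only: w C_def mult_ac mult_1_right mult_1_left)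
      qed auto
      finally show ?thesis .
    qed
  qed
qed

section \<open>Superpositions of heat flows\<close>

text \<open>
  The factor is the reciprocal of the integral of \<open>exp (- s\<^sup>2 / 2)\<close> over \<open>s > 0\<close>. The set \<open>S\<close> of widths
  is a parameter so that the full superposition, its truncations and the remainders obey the same
  estimates.
\<close>

definition heat_superposition :: "real set \<Rightarrow> (real ^ 'n \<Rightarrow> real) \<Rightarrow> real ^ 'n \<Rightarrow> real" where
  "heat_superposition S f x = sqrt (2 / pi) * (LINT s|lborel. indicator S s * heat s f x)"

lemma heat_superposition_measurable [measurable]:
  assumes [measurable]: "f \<in> borel_measurable borel" "S \<in> sets borel"
  shows "heat_superposition S f \<in> borel_measurable borel"
  unfolding heat_superposition_def by measurable

definition decay_mass :: "real \<Rightarrow> real set \<Rightarrow> ennreal" where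
  "decay_mass \<kappa> S = (\<integral>\<^sup>+s. ennreal (indicator S s * (1 + s) powr (- 1 - \<kappa>)) \<partial>lborel)"

lemma decay_mass_atLeast:
  assumes "\<kappa> > 0" "b \<ge> 0" "S \<subseteq> {b..}"
  shows "decay_mass \<kappa> S \<le> ennreal ((1 + b) powr (- \<kappa>) / \<kappa>)"
proof -
  have "decay_mass \<kappa> S \<le> (\<integral>\<^sup>+s. ennreal ((1 + s) powr (- (1 + \<kappa>))) * indicator {b..} s \<partial>lborel)"
    unfolding decay_mass_def using assms(3) by (intro nn_integral_mono) (auto simp: indicator_def)
  also have "\<dots> = ennreal ((1 + b) powr (- \<kappa>) / \<kappa>)"
    using nn_integral_atLeast_powr[of "1 + \<kappa>" b] assms by simp
  finally show ?thesis .
qed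

text \<open>
  Cauchy--Schwarz in \<open>s\<close> with the decay rate as weight, followed by Tonelli's theorem.
\<close>

lemma heat_time_integral_weighted_le:
  fixes f :: "real ^ 'n::finite \<Rightarrow> real"
  assumes [measurable]: "f \<in> borel_measurable borel" "S \<in> sets borel" and S: "S \<subseteq> {0<..}" and C: "0 \<le> C"
    and bound: "\<And>s. 0 < s \<Longrightarrow> weighted_square q (heat s f) \<le> ennreal (C * ((1 + s) powr (- 1 - \<kappa>))\<^sup>2) * E"
  shows "(\<integral>\<^sup>+x. ennreal (norm x powr q) * (\<integral>\<^sup>+s. ennreal \<bar>indicator S s * heat s f x\<bar> \<partial>lborel)\<^sup>2 \<partial>lborel)
     \<le> ennreal C * (decay_mass \<kappa> S)\<^sup>2 * E"
proof -
  define w where "w s = (1 + s) powr (- 1 - \<kappa>)" for s :: real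
  have [measurable]: "w \<in> borel_measurable borel" unfolding w_def by measurable
  have w: "w s > 0" if "0 < s" for s using that by (simp add: w_def)
  let ?W = "decay_mass \<kappa> S"
  let ?I = "\<lambda>x. \<integral>\<^sup>+s. ennreal \<bar>indicator S s * heat s f x\<bar> \<partial>lborel"
  let ?Q = "\<lambda>x. \<integral>\<^sup>+s. ennreal ((indicator S s * heat s f x)\<^sup>2 / (indicator S s * w s)) \<partial>lborel"
  let ?R = "\<lambda>x. \<integral>\<^sup>+s. ennreal (indicator S s / w s) * ennreal (norm x powr q * (heat s f x)\<^sup>2) \<partial>lborel"
  have W: "?W = (\<integral>\<^sup>+s. ennreal (indicator S s * w s) \<partial>lborel)" by (simp add: decay_mass_def w_def)
  have "(?I x)\<^sup>2 \<le> ?W * ?Q x" for x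
    unfolding W
  proof (rule nn_integral_power2_le)
    show "0 \<le> indicator S s * w s" for s by (simp add: w_def)
    show "indicator S s * heat s f x = 0" if "indicator S s * w s = 0" for s
      using that w[of s] S by (auto simp: indicator_def split: if_splits)
  qed measurable
  hence "(\<integral>\<^sup>+x. ennreal (norm x powr q) * (?I x)\<^sup>2 \<partial>lborel) \<le>
     (\<integral>\<^sup>+x. ennreal (norm x powr q) * (?W * ?Q x) \<partial>lborel)"
    by (intro nn_integral_mono mult_left_mono) auto
  also have "\<dots> = (\<integral>\<^sup>+x. ?W * ?R x \<partial>lborel)"
  proof (rule nn_integral_cong)
    fix x
    have "ennreal (norm x powr q) * (?W * ?Q x) =
      ?W * (\<integral>\<^sup>+s. ennreal (norm x powr q) * ennreal ((indicator S s * heat s f x)\<^sup>2 / (indicator S s * w s)) \<partial>lborel)"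
      by (subst nn_integral_cmult) (auto simp: mult_ac)
    also have "(\<integral>\<^sup>+s. ennreal (norm x powr q) * ennreal ((indicator S s * heat s f x)\<^sup>2 / (indicator S s * w s)) \<partial>lborel) =
      ?R x"
    proof (rule nn_integral_cong)
      fix s
      show "ennreal (norm x powr q) * ennreal ((indicator S s * heat s f x)\<^sup>2 / (indicator S s * w s)) =
        ennreal (indicator S s / w s) * ennreal (norm x powr q * (heat s f x)\<^sup>2)"
        using w[of s] S by (cases "s \<in> S") (auto simp: ennreal_mult[symmetric] less_imp_le)
    qed
    finally show "ennreal (norm x powr q) * (?W * ?Q x) =
      ?W * ?R x" .
  qed
  also have "\<dots> = ?W * (\<integral>\<^sup>+x. ?R x \<partial>lborel)"
    by (rule nn_integral_cmult) measurable
  finally have 1: "(\<integral>\<^sup>+x. ennreal (norm x powr q) * (?I x)\<^sup>2 \<partial>lborel) \<le>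
    ?W * (\<integral>\<^sup>+x. ?R x \<partial>lborel)" .
  have "(\<integral>\<^sup>+x. ?R x \<partial>lborel) =
     (\<integral>\<^sup>+s. \<integral>\<^sup>+x. ennreal (indicator S s / w s) * ennreal (norm x powr q * (heat s f x)\<^sup>2) \<partial>lborel \<partial>lborel)"
    by (rule lborel_pair.Fubini') measurable
  also have "\<dots> = (\<integral>\<^sup>+s. ennreal (indicator S s / w s) * weighted_square q (heat s f) \<partial>lborel)"
    by (intro nn_integral_cong nn_integral_cmult) measurable
  also have "\<dots> \<le> (\<integral>\<^sup>+s. (ennreal C * E) * ennreal (indicator S s * w s) \<partial>lborel)"
  proof (rule nn_integral_mono)
    fix s
    show "ennreal (indicator S s / w s) * weighted_square q (heat s f) \<le> (ennreal C * E) * ennreal (indicator S s * w s)"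
    proof (cases "s \<in> S")
      case True
      hence s: "0 < s" using S by auto
      have "ennreal (indicator S s / w s) * weighted_square q (heat s f) \<le> ennreal (1 / w s) * (ennreal (C * (w s)\<^sup>2) * E)"
        unfolding w_def using True bound[OF s] by (intro mult_mono) auto
      also have "\<dots> = ennreal (C * w s) * E"
        using w[OF s] C by (simp add: mult.assoc[symmetric] ennreal_mult[symmetric] power2_eq_square)
      finally show ?thesis using True C w[OF s] by (simp add: ennreal_mult mult_ac)
    qed simp
  qed
  also have "\<dots> = (ennreal C * E) * ?W" unfolding W by (rule nn_integral_cmult) measurable
  finally have "?W * (\<integral>\<^sup>+x. ?R x \<partial>lborel) \<le> ?W * ((ennreal C * E) * ?W)"
    by (intro mult_left_mono) auto
  from order_trans[OF 1 this] show ?thesis by (simp only: power2_eq_square mult_ac)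
qed

lemma heat_superposition_weighted_le:
  fixes f :: "real ^ 'n::finite \<Rightarrow> real"
  assumes "f \<in> borel_measurable borel" "S \<in> sets borel" "S \<subseteq> {0<..}" "0 \<le> C"
    and "\<And>s. 0 < s \<Longrightarrow> weighted_square q (heat s f) \<le> ennreal (C * ((1 + s) powr (- 1 - \<kappa>))\<^sup>2) * E"
  shows "weighted_square q (heat_superposition S f) \<le> ennreal C * (decay_mass \<kappa> S)\<^sup>2 * E"
proof (rule order_trans[OF nn_integral_mono heat_time_integral_weighted_le[OF assms]])
  fix x
  let ?L = "LINT s|lborel. indicator S s * heat s f x"
  have "(heat_superposition S f x)\<^sup>2 = 2 / pi * ?L\<^sup>2"
    by (simp add: heat_superposition_def power_mult_distrib)
  also have "\<dots> \<le> 1 * ?L\<^sup>2" using pi_gt3 by (intro mult_right_mono) auto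
  finally have "ennreal (norm x powr q * (heat_superposition S f x)\<^sup>2) \<le> ennreal (norm x powr q * ?L\<^sup>2)"
    by (intro ennreal_leI mult_left_mono) auto
  also have "\<dots> = ennreal (norm x powr q) * (ennreal \<bar>?L\<bar>)\<^sup>2" by (simp add: ennreal_mult ennreal_power)
  also have "\<dots> \<le> ennreal (norm x powr q) * (\<integral>\<^sup>+s. ennreal \<bar>indicator S s * heat s f x\<bar> \<partial>lborel)\<^sup>2"
    by (intro mult_left_mono power_mono abs_integral_le_nn_integral) auto
  finally show "ennreal (norm x powr q * (heat_superposition S f x)\<^sup>2) \<le> ennreal (norm x powr q) * (\<integral>\<^sup>+s. ennreal \<bar>indicator S s * heat s f x\<bar> \<partial>lborel)\<^sup>2" .
qed

lemma AE_norm_powr_0: "AE x in (lborel :: (real ^ 'n::finite) measure). norm x powr 0 = 1"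
  using AE_lborel_singleton[of "0 :: real^'n"] by eventually_elim simp

section \<open>Superpositions of heat flows on the Fourier side\<close>

lemma integrable_of_weighted_energy:
  fixes f :: "real ^ 'n::finite \<Rightarrow> real"
  assumes f [measurable]: "f \<in> borel_measurable borel" and p: "p > real CARD('n) + 2" and E: "weighted_energy p f < \<infinity>"
  shows "integrable lborel f" and "integrable lborel (\<lambda>x. (f x)\<^sup>2)" and "integrable lborel (\<lambda>x. norm x * f x)"
proof -
  have fin: "(\<integral>\<^sup>+y. ennreal ((1 + norm y) powr 1 * \<bar>f y\<bar>) \<partial>lborel) < \<infinity>"
  proof -
    have "(\<integral>\<^sup>+y. ennreal ((1 + norm y) powr (- (p - 2 * 1))) \<partial>(lborel :: (real^'n) measure)) < \<infinity>"
      by (rule nn_integral_powr_norm_finite) (use p in simp)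
    hence "(\<integral>\<^sup>+y. ennreal ((1 + norm y) powr (- (p - 2 * 1))) \<partial>(lborel :: (real^'n) measure)) * weighted_energy p f < \<infinity>"
      using E by (simp add: ennreal_mult_less_top)
    from le_less_trans[OF moment_le_weighted_energy[OF f, of 1 p] this] show ?thesis
      by (auto simp: less_top[symmetric] power2_eq_square ennreal_top_mult)
  qed
  have i: "integrable lborel (\<lambda>y. (1 + norm y) powr 1 * f y)"
    by (rule integrableI_bounded) (use fin in \<open>simp_all add: abs_mult\<close>)
  show "integrable lborel f"
  proof (rule Bochner_Integration.integrable_bound[OF i])
    show "AE x in lborel. norm (f x) \<le> norm ((1 + norm x) powr 1 * f x)"
    proof (rule AE_I2)
      fix x :: "real^'n"
      show "norm (f x) \<le> norm ((1 + norm x) powr 1 * f x)"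
        using mult_right_mono[of 1 "1 + norm x" "\<bar>f x\<bar>"] by (simp add: abs_mult)
    qed
  qed simp
  show "integrable lborel (\<lambda>x. norm x * f x)"
  proof (rule Bochner_Integration.integrable_bound[OF i])
    show "AE x in lborel. norm (norm x * f x) \<le> norm ((1 + norm x) powr 1 * f x)"
    proof (rule AE_I2)
      fix x :: "real^'n"
      show "norm (norm x * f x) \<le> norm ((1 + norm x) powr 1 * f x)"
        using mult_right_mono[of "norm x" "1 + norm x" "\<bar>f x\<bar>"] by (simp add: abs_mult)
    qed
  qed simp
  have "(\<integral>\<^sup>+x. ennreal ((f x)\<^sup>2) \<partial>lborel) = weighted_energy 0 f"
    by (simp add: weighted_energy_def)
  also have "\<dots> \<le> weighted_energy p f" by (rule weighted_energy_mono) (use p in simp)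
  finally show "integrable lborel (\<lambda>x. (f x)\<^sup>2)"
    using E by (intro integrableI_bounded) auto
qed

text \<open>
  The exponent \<open>0\<close> stands for the unweighted norm: \<open>norm x powr 0\<close> is \<open>1\<close> except at the origin.
  Absolute convergence at almost every point makes the superposition additive in \<open>f\<close> and in \<open>S\<close>.
\<close>

lemma AE_integrable_heat_time:
  fixes f :: "real ^ 'n::finite \<Rightarrow> real"
  assumes d: "2 \<le> CARD('n)" and p: "p > real CARD('n) + 7/2"
    and f [measurable]: "f \<in> borel_measurable borel" and E: "weighted_energy p f < \<infinity>" and f0: "(LINT x|lborel. f x) = 0"
  shows "AE x in lborel. integrable lborel (\<lambda>s. indicator {0<..} s * heat s f x)"
proof -
  obtain C where C: "0 \<le> C" and "\<And>(f :: real ^ 'n \<Rightarrow> real) s. integrable lborel f \<Longrightarrow> (LINT x|lborel. f x) = 0 \<Longrightarrow> 0 < s \<Longrightarrow>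
    weighted_square 0 (heat s f) \<le> ennreal (C * ((1 + s) powr (- 1 - 1/4))\<^sup>2) * weighted_energy p f"
    using heat_weighted_le[of 0 "1/4" p, where 'n='n] d p by auto
  note bound = this(2)[OF integrable_of_weighted_energy(1)[OF f _ E] f0]
  let ?I = "\<lambda>x. \<integral>\<^sup>+s. ennreal \<bar>indicator {0<..} s * heat s f x\<bar> \<partial>lborel"
  have "decay_mass (1/4) {0<..} \<le> ennreal ((1 + 0) powr (- (1/4)) / (1/4))"
    by (rule decay_mass_atLeast) auto
  also have "\<dots> < \<infinity>" by simp
  finally have W: "decay_mass (1/4) {0<..} < \<infinity>" .
  have "(\<integral>\<^sup>+x. ennreal (norm x powr 0) * (?I x)\<^sup>2 \<partial>lborel) \<le> ennreal C * (decay_mass (1/4) {0<..})\<^sup>2 * weighted_energy p f"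
    by (rule heat_time_integral_weighted_le[OF f _ _ C bound]) (use p in auto)
  also have "\<dots> < \<infinity>" using W E by (simp add: ennreal_mult_less_top power2_eq_square)
  finally have fin: "(\<integral>\<^sup>+x. ennreal (norm x powr 0) * (?I x)\<^sup>2 \<partial>lborel) \<noteq> \<infinity>" by simp
  have "AE x in lborel. ennreal (norm x powr 0) * (?I x)\<^sup>2 \<noteq> \<infinity>"
    by (rule nn_integral_PInf_AE[OF _ fin]) measurable
  thus ?thesis using AE_norm_powr_0[where 'n='n]
  proof eventually_elim
    case (elim x)
    hence "?I x < \<infinity>" by (auto simp: less_top[symmetric] power2_eq_square ennreal_top_mult)
    thus ?case by (intro integrableI_bounded) auto
  qed
qed

text \<open>
  The transform vanishes at the origin and is Lipschitz with the first absolute moment as constant.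
\<close>

lemma norm_fourier_integral_le_norm:
  fixes f :: "real ^ 'n::finite \<Rightarrow> real"
  assumes f: "integrable lborel f" and xf: "integrable lborel (\<lambda>x. norm x * f x)" and f0: "(LINT x|lborel. f x) = 0"
  shows "norm (fourier_integral f \<xi>) \<le> norm \<xi> * (LINT x|lborel. norm x * \<bar>f x\<bar>)"
proof -
  let ?e = "\<lambda>x. exp (- \<i> * complex_of_real (x \<bullet> \<xi>))"
  have i: "integrable lborel (\<lambda>x. \<bar>norm x * f x\<bar>)" using xf by simp
  have "fourier_integral f \<xi> = (LINT x|lborel. ?e x * complex_of_real (f x)) - complex_of_real (LINT x|lborel. f x)"
    by (simp add: fourier_integral_def f0)
  also have "\<dots> = (LINT x|lborel. ?e x * complex_of_real (f x) - complex_of_real (f x))"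
    unfolding integral_complex_of_real[symmetric]
    by (rule Bochner_Integration.integral_diff[symmetric]) (use f integrable_fourier_kernel[OF f] in simp_all)
  finally have "norm (fourier_integral f \<xi>) \<le> (LINT x|lborel. norm (?e x * complex_of_real (f x) - complex_of_real (f x)))"
    by (simp only: integral_norm_bound)
  also have "\<dots> \<le> (LINT x|lborel. norm \<xi> * \<bar>norm x * f x\<bar>)"
  proof (rule integral_mono')
    show "integrable lborel (\<lambda>x. norm \<xi> * \<bar>norm x * f x\<bar>)" using i by simp
    fix x
    have "norm (?e x - 1) \<le> \<bar>x \<bullet> \<xi>\<bar>"
      using iexp_approx1[of "- (x \<bullet> \<xi>)" 0] by simp
    also have "\<dots> \<le> norm x * norm \<xi>" by (rule Cauchy_Schwarz_ineq2)
    finally have "norm (?e x - 1) * \<bar>f x\<bar> \<le> norm x * norm \<xi> * \<bar>f x\<bar>" by (intro mult_right_mono) auto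
    moreover have "?e x * complex_of_real (f x) - complex_of_real (f x) = (?e x - 1) * complex_of_real (f x)"
      by (simp add: algebra_simps)
    ultimately show "norm (?e x * complex_of_real (f x) - complex_of_real (f x)) \<le> norm \<xi> * \<bar>norm x * f x\<bar>"
      by (simp only: norm_mult norm_of_real abs_mult abs_norm_cancel mult_ac)
  qed simp
  finally show ?thesis by (simp add: abs_mult)
qed

text \<open>
  In the unit ball the quotient is bounded by the first moment; outside, the division only helps.
\<close>

lemma inv_nabla_fourier_L2:
  fixes f :: "real ^ 'n::finite \<Rightarrow> real"
  assumes f: "integrable lborel f" and f2: "integrable lborel (\<lambda>x. (f x)\<^sup>2)"
    and xf: "integrable lborel (\<lambda>x. norm x * f x)" and f0: "(LINT x|lborel. f x) = 0"
  shows "(\<lambda>\<xi>. inv_nabla_symbol \<xi> * fourier_integral f \<xi>) \<in> L2_space lborel"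
proof -
  have [measurable]: "f \<in> borel_measurable borel" using f by auto
  define B where "B = (LINT x|lborel. norm x * \<bar>f x\<bar>)"
  have B: "0 \<le> B" unfolding B_def by (rule Bochner_Integration.integral_nonneg) simp
  have [measurable]: "(inv_nabla_symbol :: real^'n \<Rightarrow> complex) \<in> borel_measurable borel"
    unfolding inv_nabla_symbol_def by measurable
  have ind: "integrable lborel (\<lambda>x::real^'n. B\<^sup>2 * indicator (ball 0 1) x + (norm (fourier_integral f x))\<^sup>2)"
    using emeasure_bounded_finite[OF bounded_ball[of "0::real^'n" 1]] plancherel_le(1)[OF f f2]
    by (intro Bochner_Integration.integrable_add integrable_mult_right integrable_real_indicator) auto
  have "integrable lborel (\<lambda>\<xi>. (norm (inv_nabla_symbol \<xi> * fourier_integral f \<xi>))\<^sup>2)"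
  proof (rule Bochner_Integration.integrable_bound[OF ind])
    show "AE \<xi> in lborel. norm ((norm (inv_nabla_symbol \<xi> * fourier_integral f \<xi>))\<^sup>2) \<le> norm (B\<^sup>2 * indicator (ball 0 1) \<xi> + (norm (fourier_integral f \<xi>))\<^sup>2)"
      using AE_lborel_singleton[of "0 :: real^'n"]
    proof eventually_elim
      case (elim \<xi>)
      have n: "norm (inv_nabla_symbol \<xi> * fourier_integral f \<xi>) = norm (fourier_integral f \<xi>) / norm \<xi>"
        by (simp add: inv_nabla_symbol_def norm_divide)
      have "(norm (inv_nabla_symbol \<xi> * fourier_integral f \<xi>))\<^sup>2 \<le> B\<^sup>2 * indicator (ball 0 1) \<xi> + (norm (fourier_integral f \<xi>))\<^sup>2"
      proof (cases "norm \<xi> < 1")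
        case True
        have "norm (fourier_integral f \<xi>) / norm \<xi> \<le> B"
          using norm_fourier_integral_le_norm[OF f xf f0, of \<xi>] elim by (simp add: B_def divide_le_eq mult.commute)
        hence "(norm (fourier_integral f \<xi>) / norm \<xi>)\<^sup>2 \<le> B\<^sup>2" by (intro power_mono) auto
        thus ?thesis using True unfolding n by (simp add: add_increasing2)
      next
        case False
        have "norm (fourier_integral f \<xi>) / norm \<xi> \<le> norm (fourier_integral f \<xi>) / 1"
          using False by (intro divide_left_mono) auto
        hence "(norm (fourier_integral f \<xi>) / norm \<xi>)\<^sup>2 \<le> (norm (fourier_integral f \<xi>))\<^sup>2"
          by (intro power_mono) auto
        thus ?thesis unfolding n by (simp add: add_increasing)
      qed
      thus ?case by simp
    qed
  qed measurable
  thus ?thesis by (auto simp: L2_space_iff)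
qed

lemma nn_integral_gauss_mult:
  fixes f :: "real ^ 'n::finite \<Rightarrow> real"
  assumes [measurable]: "f \<in> borel_measurable borel" and s: "s > 0"
  shows "(\<integral>\<^sup>+x. \<integral>\<^sup>+y. ennreal \<bar>gauss s (x - y) * f y\<bar> \<partial>lborel \<partial>lborel) = (\<integral>\<^sup>+y. ennreal \<bar>f y\<bar> \<partial>lborel)"
proof -
  have "(\<integral>\<^sup>+x. \<integral>\<^sup>+y. ennreal \<bar>gauss s (x - y) * f y\<bar> \<partial>lborel \<partial>lborel) = (\<integral>\<^sup>+y. \<integral>\<^sup>+x. ennreal \<bar>gauss s (x - y) * f y\<bar> \<partial>lborel \<partial>lborel)"
    by (rule lborel_pair.Fubini') measurable
  also have "\<dots> = (\<integral>\<^sup>+y. (\<integral>\<^sup>+x. ennreal (gauss s (x - y)) * ennreal \<bar>f y\<bar> \<partial>lborel) \<partial>lborel)"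
    by (simp add: abs_mult ennreal_mult)
  also have "\<dots> = (\<integral>\<^sup>+y. ennreal \<bar>f y\<bar> \<partial>lborel)"
    by (simp add: nn_integral_multc nn_integral_gauss_shift[OF s])
  finally show ?thesis .
qed

lemma nn_integral_heat_le:
  fixes f :: "real ^ 'n::finite \<Rightarrow> real"
  assumes [measurable]: "f \<in> borel_measurable borel" and s: "s > 0"
  shows "(\<integral>\<^sup>+x. ennreal \<bar>heat s f x\<bar> \<partial>lborel) \<le> (\<integral>\<^sup>+y. ennreal \<bar>f y\<bar> \<partial>lborel)"
proof -
  have "(\<integral>\<^sup>+x. ennreal \<bar>heat s f x\<bar> \<partial>lborel) \<le> (\<integral>\<^sup>+x. \<integral>\<^sup>+y. ennreal \<bar>gauss s (x - y) * f y\<bar> \<partial>lborel \<partial>lborel)"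
    unfolding heat_def by (intro nn_integral_mono abs_integral_le_nn_integral)
  thus ?thesis using nn_integral_gauss_mult[OF assms] by simp
qed

lemma integral_translate:
  fixes h :: "'a::euclidean_space \<Rightarrow> 'b::{banach, second_countable_topology}"
  assumes [measurable]: "h \<in> borel_measurable borel"
  shows "(LINT x|lborel. h (x - y)) = (LINT x|lborel. h x)"
  by (subst (2) lborel_translate[of y, symmetric], subst integral_distr) auto

lemma fourier_integral_heat:
  fixes f :: "real ^ 'n::finite \<Rightarrow> real"
  assumes f: "integrable lborel f" and s: "s > 0"
  shows "fourier_integral (heat s f) \<xi> = complex_of_real (exp (- (s * norm \<xi>)\<^sup>2 / 2)) * fourier_integral f \<xi>"
proof -
  have [measurable]: "f \<in> borel_measurable borel" using f by auto
  let ?e = "\<lambda>x. exp (- \<i> * complex_of_real (x \<bullet> \<xi>))"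
  define F where "F = (\<lambda>x y. ?e x * complex_of_real (gauss s (x - y) * f y))"
  have [measurable]: "case_prod F \<in> borel_measurable lborel2" unfolding F_def by measurable
  have int: "integrable lborel2 (case_prod F)"
  proof (rule integrableI_bounded)
    have "(\<integral>\<^sup>+p. ennreal (norm (case_prod F p)) \<partial>lborel2) = (\<integral>\<^sup>+x. \<integral>\<^sup>+y. ennreal \<bar>gauss s (x - y) * f y\<bar> \<partial>lborel \<partial>lborel)"
      by (subst lborel.nn_integral_fst[symmetric]) (simp_all add: F_def norm_mult abs_mult)
    also have "\<dots> < \<infinity>" using f unfolding nn_integral_gauss_mult[OF \<open>f \<in> borel_measurable borel\<close> s] by (simp add: integrable_iff_bounded)
    finally show "(\<integral>\<^sup>+p. ennreal (norm (case_prod F p)) \<partial>lborel2) < \<infinity>" .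
  qed measurable
  have "fourier_integral (heat s f) \<xi> = (LINT x|lborel. (LINT y|lborel. F x y))"
    unfolding fourier_integral_def heat_def F_def
    by (simp only: integral_complex_of_real[symmetric] integral_mult_right_zero)
  also have "\<dots> = (LINT y|lborel. (LINT x|lborel. F x y))"
    by (rule lborel_pair.Fubini_integral[OF int, symmetric])
  also have "\<dots> = (LINT y|lborel. fourier_integral (gauss s) \<xi> * (?e y * complex_of_real (f y)))"
  proof (rule Bochner_Integration.integral_cong[OF refl])
    fix y
    have "(LINT x|lborel. F x y) = (LINT x|lborel. (\<lambda>z. (?e z * complex_of_real (gauss s z)) * (?e y * complex_of_real (f y))) (x - y))"
      unfolding F_def
    proof (rule Bochner_Integration.integral_cong[OF refl])
      fix x
      have "?e x = ?e (x - y) * ?e y" by (simp add: inner_diff_left algebra_simps flip: exp_add)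
      thus "?e x * complex_of_real (gauss s (x - y) * f y) = (\<lambda>z. (?e z * complex_of_real (gauss s z)) * (?e y * complex_of_real (f y))) (x - y)"
        by simp
    qed
    also have "\<dots> = (LINT z|lborel. (?e z * complex_of_real (gauss s z)) * (?e y * complex_of_real (f y)))"
      by (rule integral_translate) measurable
    also have "\<dots> = fourier_integral (gauss s) \<xi> * (?e y * complex_of_real (f y))"
      by (simp only: fourier_integral_def integral_mult_left_zero)
    finally show "(LINT x|lborel. F x y) = fourier_integral (gauss s) \<xi> * (?e y * complex_of_real (f y))" .
  qed
  also have "\<dots> = fourier_integral (gauss s) \<xi> * fourier_integral f \<xi>"
    by (simp only: fourier_integral_def integral_mult_right_zero)
  finally show ?thesis unfolding fourier_integral_gauss[OF s] .
qed

text \<open>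
  The symbol of the superposition of the widths up to \<open>n\<close>, a radial function that increases to \<open>1 / a\<close>.
\<close>

definition partial_inverse_symbol :: "nat \<Rightarrow> real \<Rightarrow> real" where
  "partial_inverse_symbol n a = sqrt (2 / pi) * (LINT s|lborel. indicator {0<..real n} s * exp (- (s * a)\<^sup>2 / 2))"

text \<open>
  A bounded range of widths keeps the superposition integrable, because each heat flow contracts
  \<open>L\<^sup>1\<close>; hence its transform is computed by Fubini's theorem. The full superposition need not be
  integrable, and its transform is reached from these by a limit in \<open>L\<^sup>2\<close>.
\<close>

lemma heat_superposition_partial:
  fixes f :: "real ^ 'n::finite \<Rightarrow> real"
  assumes f: "integrable lborel f"
  shows "integrable lborel (heat_superposition {0<..real n} f)"
    and "fourier_integral (heat_superposition {0<..real n} f) \<xi> = complex_of_real (partial_inverse_symbol n (norm \<xi>)) * fourier_integral f \<xi>"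
proof -
  have [measurable]: "f \<in> borel_measurable borel" using f by auto
  let ?e = "\<lambda>x. exp (- \<i> * complex_of_real (x \<bullet> \<xi>))"
  let ?m = "\<lambda>s. complex_of_real (indicator {0<..real n} s * exp (- (s * norm \<xi>)\<^sup>2 / 2))"
  define G where "G = (\<lambda>x s. indicator {0<..real n} s * heat s f x)"
  have [measurable]: "case_prod G \<in> borel_measurable lborel2" unfolding G_def by measurable
  have int: "integrable lborel2 (case_prod G)"
  proof (rule integrableI_bounded)
    have "(\<integral>\<^sup>+p. ennreal (norm (case_prod G p)) \<partial>lborel2) = (\<integral>\<^sup>+s. \<integral>\<^sup>+x. ennreal \<bar>G x s\<bar> \<partial>lborel \<partial>lborel)"
      by (subst lborel_pair.nn_integral_snd[symmetric]) simp_all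
    also have "\<dots> \<le> (\<integral>\<^sup>+s. indicator {0<..real n} s * (\<integral>\<^sup>+y. ennreal \<bar>f y\<bar> \<partial>lborel) \<partial>lborel)"
    proof (rule nn_integral_mono)
      fix s
      show "(\<integral>\<^sup>+x. ennreal \<bar>G x s\<bar> \<partial>lborel) \<le> indicator {0<..real n} s * (\<integral>\<^sup>+y. ennreal \<bar>f y\<bar> \<partial>lborel)"
        using nn_integral_heat_le[of f s] by (cases "s \<in> {0<..real n}") (auto simp: G_def)
    qed
    also have "\<dots> = ennreal (real n) * (\<integral>\<^sup>+y. ennreal \<bar>f y\<bar> \<partial>lborel)"
      by (subst nn_integral_multc) auto
    also have "\<dots> < \<infinity>" using f by (simp add: integrable_iff_bounded ennreal_mult_less_top)
    finally show "(\<integral>\<^sup>+p. ennreal (norm (case_prod G p)) \<partial>lborel2) < \<infinity>" .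
  qed measurable
  show "integrable lborel (heat_superposition {0<..real n} f)"
    unfolding heat_superposition_def
    using lborel_pair.integrable_fst[OF int] by (intro integrable_mult_right) (simp add: G_def)
  define F where "F = (\<lambda>x s. ?e x * complex_of_real (G x s))"
  have intF: "integrable lborel2 (case_prod F)"
  proof (rule Bochner_Integration.integrable_bound[OF int])
    show "case_prod F \<in> borel_measurable lborel2" unfolding F_def G_def by measurable
    show "AE p in lborel2. norm (case_prod F p) \<le> norm (case_prod G p)"
      by (auto simp: F_def norm_mult)
  qed
  have "fourier_integral (heat_superposition {0<..real n} f) \<xi> = (LINT x|lborel. complex_of_real (sqrt (2 / pi)) * (LINT s|lborel. F x s))"
    unfolding fourier_integral_def
  proof (rule Bochner_Integration.integral_cong[OF refl])
    fix x
    have "(LINT s|lborel. F x s) = ?e x * complex_of_real (LINT s|lborel. G x s)"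
      by (simp only: F_def integral_mult_right_zero integral_complex_of_real)
    thus "?e x * complex_of_real (heat_superposition {0<..real n} f x) = complex_of_real (sqrt (2 / pi)) * (LINT s|lborel. F x s)"
      by (simp add: heat_superposition_def G_def)
  qed
  also have "\<dots> = complex_of_real (sqrt (2 / pi)) * (LINT s|lborel. (LINT x|lborel. F x s))"
    by (simp only: integral_mult_right_zero lborel_pair.Fubini_integral[OF intF, symmetric])
  also have "(LINT s|lborel. (LINT x|lborel. F x s)) = (LINT s|lborel. ?m s * fourier_integral f \<xi>)"
  proof (rule Bochner_Integration.integral_cong[OF refl])
    fix s
    have "(LINT x|lborel. F x s) = complex_of_real (indicator {0<..real n} s) * fourier_integral (heat s f) \<xi>"
      unfolding F_def G_def fourier_integral_def
      by (subst integral_mult_right_zero[symmetric]) (simp add: mult_ac)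
    also have "\<dots> = ?m s * fourier_integral f \<xi>"
      using fourier_integral_heat[OF f, of s \<xi>] by (cases "s \<in> {0<..real n}") auto
    finally show "(LINT x|lborel. F x s) = ?m s * fourier_integral f \<xi>" .
  qed
  also have "\<dots> = complex_of_real (LINT s|lborel. indicator {0<..real n} s * exp (- (s * norm \<xi>)\<^sup>2 / 2)) * fourier_integral f \<xi>"
    by (simp only: integral_mult_left_zero integral_complex_of_real)
  finally show "fourier_integral (heat_superposition {0<..real n} f) \<xi> = complex_of_real (partial_inverse_symbol n (norm \<xi>)) * fourier_integral f \<xi>"
    by (simp add: partial_inverse_symbol_def mult.assoc)
qed

lemma has_bochner_integral_half_gaussian:
  assumes a: "a > 0"
  shows "has_bochner_integral lborel (\<lambda>s. indicator {0<..} s * exp (- (s * a)\<^sup>2 / 2)) (sqrt (pi / 2) / a)"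
proof -
  define c where "c = a / sqrt 2"
  have c: "c > 0" using a by (simp add: c_def)
  have "has_bochner_integral lborel (\<lambda>x. indicator {0..} (0 + c * x) *\<^sub>R exp (- (0 + c * x)\<^sup>2)) ((sqrt pi / 2) /\<^sub>R \<bar>c\<bar>)"
    using gaussian_moment_0 c by (subst (asm) lborel_has_bochner_integral_real_affine_iff[of c _ _ 0]) auto
  moreover have "AE x in lborel. indicator {0..} (0 + c * x) *\<^sub>R exp (- (0 + c * x)\<^sup>2) = indicator {0<..} x * exp (- (x * a)\<^sup>2 / 2)"
    using AE_lborel_singleton[of "0::real"]
  proof eventually_elim
    case (elim x)
    have "(c * x)\<^sup>2 = (x * a)\<^sup>2 / 2" by (simp add: c_def power_mult_distrib power_divide)
    moreover have "indicator {0..} (c * x) = (indicator {0<..} x :: real)"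
      using elim c by (auto simp: indicator_def zero_le_mult_iff)
    ultimately show ?case by simp
  qed
  moreover have "(sqrt pi / 2) /\<^sub>R \<bar>c\<bar> = sqrt (pi / 2) / a"
  proof -
    have "sqrt pi * sqrt 2 * sqrt 2 = sqrt pi * 2" by (simp add: mult.assoc)
    thus ?thesis using a by (simp add: c_def real_sqrt_divide field_simps)
  qed
  ultimately show ?thesis
    by (subst has_bochner_integral_cong_AE[symmetric]) auto
qed

lemma partial_inverse_symbol:
  assumes a: "a > 0"
  shows "0 \<le> partial_inverse_symbol n a" "partial_inverse_symbol n a \<le> 1 / a"
    and "(\<lambda>n. partial_inverse_symbol n a) \<longlonglongrightarrow> 1 / a"
proof -
  let ?k = "\<lambda>n s. indicator {0<..real n} s * exp (- (s * a)\<^sup>2 / 2)" and ?h = "\<lambda>s. indicator {0<..} s * exp (- (s * a)\<^sup>2 / 2)"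
  note hb = has_bochner_integral_half_gaussian[OF a]
  have c: "sqrt (2 / pi) * (sqrt (pi / 2) / a) = 1 / a"
    by (simp add: real_sqrt_divide)
  show "0 \<le> partial_inverse_symbol n a"
    unfolding partial_inverse_symbol_def
    by (intro mult_nonneg_nonneg Bochner_Integration.integral_nonneg) auto
  have "(LINT s|lborel. ?k n s) \<le> (LINT s|lborel. ?h s)"
    by (rule integral_mono') (use hb in \<open>auto simp: has_bochner_integral_iff indicator_def\<close>)
  also have "\<dots> = sqrt (pi / 2) / a" using hb by (simp add: has_bochner_integral_iff)
  finally have "partial_inverse_symbol n a \<le> sqrt (2 / pi) * (sqrt (pi / 2) / a)"
    unfolding partial_inverse_symbol_def by (intro mult_left_mono) auto
  thus "partial_inverse_symbol n a \<le> 1 / a" by (simp only: c)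
  have "(\<lambda>n. LINT s|lborel. ?k n s) \<longlonglongrightarrow> (LINT s|lborel. ?h s)"
  proof (rule integral_dominated_convergence[where w="?h"])
    show "AE s in lborel. (\<lambda>n. ?k n s) \<longlonglongrightarrow> ?h s"
    proof (rule AE_I2)
      fix s :: real
      obtain m :: nat where m: "s \<le> real m" using real_arch_simple by blast
      show "(\<lambda>n. ?k n s) \<longlonglongrightarrow> ?h s"
        by (intro tendsto_eventually eventually_sequentiallyI[of m]) (use m in \<open>auto simp: indicator_def\<close>)
    qed
  qed (use hb in \<open>auto simp: has_bochner_integral_iff indicator_def\<close>)
  hence "(\<lambda>n. partial_inverse_symbol n a) \<longlonglongrightarrow> sqrt (2 / pi) * (LINT s|lborel. ?h s)"
    unfolding partial_inverse_symbol_def by (intro tendsto_intros)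
  also have "(LINT s|lborel. ?h s) = sqrt (pi / 2) / a" using hb by (simp add: has_bochner_integral_iff)
  finally show "(\<lambda>n. partial_inverse_symbol n a) \<longlonglongrightarrow> 1 / a" by (simp only: c)
qed

section \<open>The inverse of the operator with symbol \<open>|\<xi>|\<close>\<close>

abbreviation inv_nabla :: "(real ^ 'n \<Rightarrow> real) \<Rightarrow> real ^ 'n \<Rightarrow> real" where
  "inv_nabla \<equiv> heat_superposition {0<..}"

lemma decay_mass_less_top: "\<kappa> > 0 \<Longrightarrow> S \<subseteq> {0<..} \<Longrightarrow> decay_mass \<kappa> S < \<infinity>"
  using decay_mass_atLeast[of \<kappa> 0 S] by (auto simp: subset_eq less_imp_le intro: le_less_trans)

lemma inv_nabla_diff:
  fixes f g :: "real ^ 'n::finite \<Rightarrow> real"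
  assumes d: "2 \<le> CARD('n)" and p: "p > real CARD('n) + 7/2"
    and f: "f \<in> borel_measurable borel" "weighted_energy p f < \<infinity>" "(LINT x|lborel. f x) = 0"
    and g: "g \<in> borel_measurable borel" "weighted_energy p g < \<infinity>" "(LINT x|lborel. g x) = 0"
  shows "AE x in lborel. inv_nabla (\<lambda>x. f x - g x) x = inv_nabla f x - inv_nabla g x"
proof -
  have if1: "integrable lborel f" and ig: "integrable lborel g"
    using integrable_of_weighted_energy(1)[of f p] integrable_of_weighted_energy(1)[of g p] f g p by auto
  show ?thesis
    using AE_integrable_heat_time[OF d p f] AE_integrable_heat_time[OF d p g]
  proof eventually_elim
    case (elim x)
    have "(LINT s|lborel. indicator {0<..} s * heat s (\<lambda>x. f x - g x) x) = (LINT s|lborel. indicator {0<..} s * heat s f x - indicator {0<..} s * heat s g x)"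
      by (intro Bochner_Integration.integral_cong refl) (auto simp: indicator_def heat_diff[OF if1 ig])
    also have "\<dots> = (LINT s|lborel. indicator {0<..} s * heat s f x) - (LINT s|lborel. indicator {0<..} s * heat s g x)"
      by (rule Bochner_Integration.integral_diff[OF elim])
    finally show ?case by (simp add: heat_superposition_def right_diff_distrib)
  qed
qed

lemma inv_nabla_weighted_bound:
  assumes d: "2 \<le> CARD('n::finite)" and q: "0 \<le> q" "q \<le> 3" "q < real CARD('n)" and p: "p > real CARD('n) + 7/2"
  obtains K where "0 \<le> K" "\<And>f :: real ^ 'n \<Rightarrow> real. f \<in> borel_measurable borel \<Longrightarrow> weighted_energy p f < \<infinity> \<Longrightarrow> (LINT x|lborel. f x) = 0 \<Longrightarrow>
    weighted_square q (inv_nabla f) \<le> ennreal K * weighted_energy p f"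
proof -
  define \<kappa> where "\<kappa> = min ((real CARD('n) - q) / 2) (1/4)"
  have \<kappa>: "\<kappa> > 0" "2 * \<kappa> \<le> real CARD('n) - q" "2 * \<kappa> \<le> 1/2" using q by (auto simp: \<kappa>_def min_def)
  obtain C where C: "0 \<le> C" and bound: "\<And>(f :: real ^ 'n \<Rightarrow> real) s. integrable lborel f \<Longrightarrow> (LINT x|lborel. f x) = 0 \<Longrightarrow> 0 < s \<Longrightarrow>
    weighted_square q (heat s f) \<le> ennreal (C * ((1 + s) powr (- 1 - \<kappa>))\<^sup>2) * weighted_energy p f"
    using heat_weighted_le[OF q(1,2) d _ \<kappa>(2,3) p] \<kappa>(1) by auto
  obtain m where m: "decay_mass \<kappa> {0<..} = ennreal m" "0 \<le> m"
    using decay_mass_less_top[OF \<kappa>(1), of "{0<..}"] by (cases "decay_mass \<kappa> {0<..}") auto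
  show ?thesis
  proof (rule that[of "C * m\<^sup>2"])
    show "0 \<le> C * m\<^sup>2" using C by simp
    fix f :: "real ^ 'n \<Rightarrow> real" assume f: "f \<in> borel_measurable borel" "weighted_energy p f < \<infinity>" "(LINT x|lborel. f x) = 0"
    have if1: "integrable lborel f" using integrable_of_weighted_energy(1)[of f p] f p by auto
    have "weighted_square q (inv_nabla f) \<le> ennreal C * (decay_mass \<kappa> {0<..})\<^sup>2 * weighted_energy p f"
      by (rule heat_superposition_weighted_le[OF f(1) _ _ C bound[OF if1 f(3)]]) auto
    thus "weighted_square q (inv_nabla f) \<le> ennreal (C * m\<^sup>2) * weighted_energy p f"
      using C m by (simp add: ennreal_mult ennreal_power)
  qed
qed

text \<open>
  The truncated superpositions tend to the full one in \<open>L\<^sup>2\<close>, the remainder being a superposition of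
  widths above \<open>n\<close> with small total decay. Their symbols increase to \<open>1 / |\<xi>|\<close>, so their transforms
  converge in \<open>L\<^sup>2\<close> by dominated convergence.
\<close>

lemma is_multiplier_inv_nabla:
  fixes f :: "real ^ 'n::finite \<Rightarrow> real"
  assumes d: "2 \<le> CARD('n)" and p: "p > real CARD('n) + 7/2"
    and f [measurable]: "f \<in> borel_measurable borel" and E: "weighted_energy p f < \<infinity>" and f0: "(LINT x|lborel. f x) = 0"
  shows "is_multiplier inv_nabla_symbol f (inv_nabla f)"
proof -
  obtain C where C: "0 \<le> C" and bound: "\<And>(f :: real ^ 'n \<Rightarrow> real) s. integrable lborel f \<Longrightarrow> (LINT x|lborel. f x) = 0 \<Longrightarrow> 0 < s \<Longrightarrow>
    weighted_square 0 (heat s f) \<le> ennreal (C * ((1 + s) powr (- 1 - 1/4))\<^sup>2) * weighted_energy p f"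
    using heat_weighted_le[of 0 "1/4" p, where 'n='n] d p by auto
  have p2: "p > real CARD('n) + 2" using p by simp
  note i = integrable_of_weighted_energy[OF f p2 E]
  let ?v = "inv_nabla f" and ?vn = "\<lambda>n. heat_superposition {0<..real n} f"
  let ?g = "\<lambda>\<xi>. inv_nabla_symbol \<xi> * fourier_integral f \<xi>"
  obtain e where e: "weighted_energy p f = ennreal e" "0 \<le> e" using E by (cases "weighted_energy p f") auto
  have sup: "(\<integral>\<^sup>+x. ennreal ((heat_superposition S f x)\<^sup>2) \<partial>lborel) \<le> ennreal C * (decay_mass (1/4) S)\<^sup>2 * ennreal e"
    if S: "S \<in> sets borel" "S \<subseteq> {0<..}" for S
  proof -
    have "(\<integral>\<^sup>+x. ennreal ((heat_superposition S f x)\<^sup>2) \<partial>lborel) = weighted_square 0 (heat_superposition S f)"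
      by (rule nn_integral_cong_AE) (use AE_norm_powr_0[where 'n='n] in \<open>eventually_elim, simp\<close>)
    also have "\<dots> \<le> ennreal C * (decay_mass (1/4) S)\<^sup>2 * ennreal e"
      unfolding e(1)[symmetric] by (rule heat_superposition_weighted_le[OF f S C bound[OF i(1) f0]])
    finally show ?thesis .
  qed
  have sup2: "integrable lborel (\<lambda>x. (heat_superposition S f x)\<^sup>2)" if [measurable]: "S \<in> sets borel" and S: "S \<subseteq> {0<..}" for S
  proof (rule integrableI_bounded)
    have "ennreal C * (decay_mass (1/4) S)\<^sup>2 * ennreal e < \<infinity>"
      using decay_mass_less_top[of "1/4" S] S by (simp add: ennreal_mult_less_top power2_eq_square)
    from le_less_trans[OF sup this] show "(\<integral>\<^sup>+x. ennreal (norm ((heat_superposition S f x)\<^sup>2)) \<partial>lborel) < \<infinity>"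
      using S by simp
  qed measurable
  have diff: "(LINT x|lborel. (?vn n x - ?v x)\<^sup>2) \<le> C * (4 * (1 + real n) powr (- 1/4))\<^sup>2 * e" for n
  proof -
    have ae: "AE x in lborel. integrable lborel (\<lambda>s. indicator {0<..} s * heat s f x)"
      by (rule AE_integrable_heat_time[OF d p f E f0])
    have "AE x in lborel. (?vn n x - ?v x)\<^sup>2 = (heat_superposition {real n<..} f x)\<^sup>2"
      using ae
    proof eventually_elim
      case (elim x)
      have j: "integrable lborel (\<lambda>s. indicator S s * heat s f x)" if [measurable]: "S \<in> sets borel" and "S \<subseteq> {0<..}" for S
        by (rule Bochner_Integration.integrable_bound[OF elim]) (use that in \<open>auto simp: indicator_def\<close>)
      have "?v x = ?vn n x + heat_superposition {real n<..} f x"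
      proof -
        have "(LINT s|lborel. indicator {0<..} s * heat s f x) = (LINT s|lborel. indicator {0<..real n} s * heat s f x + indicator {real n<..} s * heat s f x)"
          by (intro Bochner_Integration.integral_cong refl) (auto simp: indicator_def)
        also have "\<dots> = (LINT s|lborel. indicator {0<..real n} s * heat s f x) + (LINT s|lborel. indicator {real n<..} s * heat s f x)"
          by (rule Bochner_Integration.integral_add) (auto intro!: j simp del: indicator_simps)
        finally show ?thesis by (simp add: heat_superposition_def distrib_left)
      qed
      thus ?case by (simp add: power2_commute)
    qed
    hence "(LINT x|lborel. (?vn n x - ?v x)\<^sup>2) = (LINT x|lborel. (heat_superposition {real n<..} f x)\<^sup>2)"
      by (intro integral_cong_AE) auto
    also have "ennreal \<dots> = (\<integral>\<^sup>+x. ennreal ((heat_superposition {real n<..} f x)\<^sup>2) \<partial>lborel)"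
      by (rule nn_integral_eq_integral[symmetric]) (auto intro: sup2)
    also have "\<dots> \<le> ennreal C * (decay_mass (1/4) {real n<..})\<^sup>2 * ennreal e"
      by (rule sup) auto
    also have "\<dots> \<le> ennreal C * (ennreal ((1 + real n) powr (- (1/4)) / (1/4)))\<^sup>2 * ennreal e"
      by (intro mult_right_mono mult_left_mono power_mono decay_mass_atLeast) auto
    also have "\<dots> = ennreal (C * (4 * (1 + real n) powr (- 1/4))\<^sup>2 * e)"
      using C e by (simp add: ennreal_power ennreal_mult mult.commute)
    finally show ?thesis using C e by (simp add: mult_nonneg_nonneg)
  qed
  have vlim: "(\<lambda>n. LINT x|lborel. (?vn n x - ?v x)\<^sup>2) \<longlonglongrightarrow> 0"
  proof (rule tendsto_sandwich[OF _ _ tendsto_const])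
    show "\<forall>\<^sub>F n in sequentially. 0 \<le> (LINT x|lborel. (?vn n x - ?v x)\<^sup>2)"
      by (intro always_eventually allI Bochner_Integration.integral_nonneg) simp
    show "\<forall>\<^sub>F n in sequentially. (LINT x|lborel. (?vn n x - ?v x)\<^sup>2) \<le> C * (4 * (1 + real n) powr (- 1/4))\<^sup>2 * e"
      by (intro always_eventually allI diff)
    have "(\<lambda>n. (1 + real n) powr (- 1/4)) \<longlonglongrightarrow> 0"
      by (intro tendsto_neg_powr filterlim_tendsto_add_at_top[OF tendsto_const] filterlim_real_sequentially) auto
    hence "(\<lambda>n. C * (4 * (1 + real n) powr (- 1/4))\<^sup>2 * e) \<longlonglongrightarrow> C * (4 * 0)\<^sup>2 * e"
      by (intro tendsto_intros)
    thus "(\<lambda>n. C * (4 * (1 + real n) powr (- 1/4))\<^sup>2 * e) \<longlonglongrightarrow> 0" by simp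
  qed
  have [measurable]: "(inv_nabla_symbol :: real^'n \<Rightarrow> complex) \<in> borel_measurable borel"
    unfolding inv_nabla_symbol_def by measurable
  have [measurable]: "heat_superposition S f \<in> borel_measurable borel" if "S \<in> sets borel" for S
    using that by measurable
  have gL2: "?g \<in> L2_space lborel" by (rule inv_nabla_fourier_L2[OF i f0])
  let ?\<Delta> = "\<lambda>n \<xi>. ?g \<xi> - fourier_integral (?vn n) \<xi>" and ?m = "\<lambda>n \<xi>. 1 / norm \<xi> - partial_inverse_symbol n (norm \<xi>)"
  have glim: "(\<lambda>n. LINT \<xi>|lborel. (norm (?\<Delta> n \<xi>))\<^sup>2) \<longlonglongrightarrow> 0"
  proof -
    have "(\<lambda>n. LINT \<xi>|lborel. (norm (?\<Delta> n \<xi>))\<^sup>2) \<longlonglongrightarrow> (LINT \<xi>|(lborel :: (real^'n) measure). (0::real))"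
    proof (rule integral_dominated_convergence[where w="\<lambda>\<xi>. (norm (?g \<xi>))\<^sup>2"])
      have n: "norm (?\<Delta> n \<xi>) = \<bar>?m n \<xi>\<bar> * norm (fourier_integral f \<xi>)" for n \<xi>
      proof -
        have "?\<Delta> n \<xi> = complex_of_real (?m n \<xi>) * fourier_integral f \<xi>"
          by (simp add: heat_superposition_partial(2)[OF i(1)] inv_nabla_symbol_def left_diff_distrib)
        thus ?thesis by (simp only: norm_mult norm_of_real)
      qed
      show "AE \<xi> in lborel. (\<lambda>n. (norm (?\<Delta> n \<xi>))\<^sup>2) \<longlonglongrightarrow> 0"
        using AE_lborel_singleton[of "0 :: real^'n"]
      proof eventually_elim
        case (elim \<xi>)
        hence "(\<lambda>n. (\<bar>?m n \<xi>\<bar> * norm (fourier_integral f \<xi>))\<^sup>2) \<longlonglongrightarrow>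
          (\<bar>1 / norm \<xi> - 1 / norm \<xi>\<bar> * norm (fourier_integral f \<xi>))\<^sup>2"
          by (intro tendsto_intros partial_inverse_symbol(3)) auto
        thus ?case unfolding n by simp
      qed
      show "AE \<xi> in lborel. norm ((norm (?\<Delta> n \<xi>))\<^sup>2) \<le> (norm (?g \<xi>))\<^sup>2" for n
        using AE_lborel_singleton[of "0 :: real^'n"]
      proof eventually_elim
        case (elim \<xi>)
        have "\<bar>?m n \<xi>\<bar> \<le> 1 / norm \<xi>"
          using partial_inverse_symbol(1,2)[of "norm \<xi>" n] elim by auto
        hence "norm (?\<Delta> n \<xi>) \<le> norm (?g \<xi>)"
          unfolding n by (simp add: inv_nabla_symbol_def norm_mult norm_inverse divide_inverse mult_right_mono)
        thus ?case by (simp add: power_mono)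
      qed
    qed (use gL2 in \<open>auto simp: L2_space_iff\<close>)
    thus ?thesis by simp
  qed
  have vL2: "?v \<in> L2_space lborel" using sup2[of "{0<..}"] by (simp add: L2_space_iff)
  have fv: "AE \<xi> in lborel. fourier ?v \<xi> = ?g \<xi>"
    by (rule fourier_eq_L2_limit(2)[OF vL2 gL2 heat_superposition_partial(1)[OF i(1)] sup2 vlim glim]) auto
  have "f \<in> L2_space lborel" using i by (simp add: L2_space_iff)
  moreover have "AE \<xi> in lborel. fourier ?v \<xi> = inv_nabla_symbol \<xi> * fourier f \<xi>"
    using fv fourier_eq_fourier_integral[OF i(1,2)] by eventually_elim simp
  ultimately show ?thesis using vL2 by (simp add: is_multiplier_def)
qed

section \<open>Continuity in time\<close>

lemma weighted_energy_diff_le: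
  fixes f g :: "real ^ 'n::finite \<Rightarrow> real"
  assumes [measurable]: "f \<in> borel_measurable borel" "g \<in> borel_measurable borel"
  shows "weighted_energy p (\<lambda>x. f x - g x) \<le> 2 * weighted_energy p f + 2 * weighted_energy p g"
proof -
  \<comment> \<open>Multiplication by the root of the weight reduces the claim to the unweighted norm.\<close>
  define w where "w y = sqrt ((1 + norm y) powr p)" for y :: "real^'n"
  have [measurable]: "w \<in> borel_measurable borel" unfolding w_def by measurable
  have w: "(norm (w y * h))\<^sup>2 = (1 + norm y) powr p * h\<^sup>2" for y h by (simp add: w_def power_mult_distrib)
  show ?thesis
    using nn_integral_norm_power2_add_le[of "\<lambda>y. w y * f y" lborel "\<lambda>y. w y * (- g y)"]
    by (simp only: w weighted_energy_def distrib_left[symmetric] power2_minus) simp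
qed

lemma L2_norm_power_weight:
  assumes [measurable]: "f \<in> borel_measurable borel"
  shows "(L2_norm (power_weight r) f)\<^sup>2 = (\<integral>\<^sup>+x. ennreal (norm x powr (2 * r) * (norm (f x))\<^sup>2) \<partial>lborel)"
  unfolding L2_norm_power2 power_weight_def by (subst nn_integral_density) (auto simp: ennreal_mult)

lemma weighted_energy_le:
  fixes f :: "real ^ 'n::finite \<Rightarrow> real"
  assumes [measurable]: "f \<in> borel_measurable borel" and r: "0 \<le> r"
  shows "weighted_energy (2 * r) f \<le> ennreal (2 powr (2 * r)) * ((L2_norm lborel f)\<^sup>2 + (L2_norm (power_weight r) f)\<^sup>2)"
proof -
  have "weighted_energy (2 * r) f \<le> (\<integral>\<^sup>+x. ennreal (2 powr (2 * r)) * (ennreal ((norm (f x))\<^sup>2) + ennreal (norm x powr (2 * r) * (norm (f x))\<^sup>2)) \<partial>lborel)"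
    unfolding weighted_energy_def
  proof (rule nn_integral_mono)
    fix x :: "real^'n"
    have "(1 + norm x) powr (2 * r) * (f x)\<^sup>2 \<le> (2 powr (2 * r) * (1 powr (2 * r) + norm x powr (2 * r))) * (f x)\<^sup>2"
      using r by (intro mult_right_mono powr_add_le) auto
    thus "ennreal ((1 + norm x) powr (2 * r) * (f x)\<^sup>2) \<le> ennreal (2 powr (2 * r)) * (ennreal ((norm (f x))\<^sup>2) + ennreal (norm x powr (2 * r) * (norm (f x))\<^sup>2))"
      by (simp add: ennreal_mult[symmetric] ennreal_plus[symmetric] algebra_simps ennreal_leI del: ennreal_plus)
  qed
  also have "\<dots> = ennreal (2 powr (2 * r)) * ((L2_norm lborel f)\<^sup>2 + (L2_norm (power_weight r) f)\<^sup>2)"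
    unfolding L2_norm_power_weight[OF assms(1)] L2_norm_power2[of lborel] by (simp add: nn_integral_cmult nn_integral_add)
  finally show ?thesis .
qed

lemma Zdot_spaceD:
  fixes f :: "real ^ 'n::finite \<Rightarrow> real"
  assumes f: "f \<in> Zdot_space s r" and r: "0 \<le> r"
  shows "f \<in> borel_measurable borel" "weighted_energy (2 * r) f < \<infinity>" "(LINT x|lborel. f x) = 0"
proof -
  have L: "f \<in> L2_space lborel" "f \<in> L2_space (power_weight r)" and 0: "fourier_integral f 0 = 0"
    using f by (auto simp: Zdot_space_def Hs_space_def)
  show m: "f \<in> borel_measurable borel" using L by (simp add: L2_space_def)
  have "ennreal (2 powr (2 * r)) * ((L2_norm lborel f)\<^sup>2 + (L2_norm (power_weight r) f)\<^sup>2) < \<infinity>"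
    using L by (auto simp: L2_space_def ennreal_mult_less_top power2_eq_square)
  with weighted_energy_le[OF m r] show "weighted_energy (2 * r) f < \<infinity>" by (rule le_less_trans)
  show "(LINT x|lborel. f x) = 0" using 0 by (simp add: fourier_integral_def)
qed

text \<open>
  The norm of \<open>H\<^sup>s\<close> is a norm of the transform; Plancherel's lower bound turns it into one of \<open>f\<close>.
\<close>

lemma L2_norm_le_Hs_norm:
  fixes f :: "real ^ 'n::finite \<Rightarrow> real"
  assumes f: "integrable lborel f" and f2: "integrable lborel (\<lambda>x. (f x)\<^sup>2)" and s: "0 \<le> s"
  shows "(L2_norm lborel f)\<^sup>2 \<le> (Hs_norm s f)\<^sup>2"
proof -
  have [measurable]: "f \<in> borel_measurable borel" using f by auto
  have "1 \<le> (2 * pi) ^ CARD('n)" using pi_gt3 by (intro one_le_power) simp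
  hence "1 * (LINT x|lborel. (f x)\<^sup>2) \<le> (2 * pi) ^ CARD('n) * (LINT x|lborel. (f x)\<^sup>2)"
    by (intro mult_right_mono Bochner_Integration.integral_nonneg) auto
  also have "\<dots> \<le> (LINT \<xi>|lborel. (norm (fourier_integral f \<xi>))\<^sup>2)" by (rule plancherel_ge[OF f f2])
  finally have "(LINT x|lborel. (f x)\<^sup>2) \<le> (LINT \<xi>|lborel. (norm (fourier_integral f \<xi>))\<^sup>2)" by simp
  hence "(L2_norm lborel f)\<^sup>2 \<le> (\<integral>\<^sup>+\<xi>. ennreal ((norm (fourier_integral f \<xi>))\<^sup>2) \<partial>lborel)"
    using f2 plancherel_le(1)[OF f f2] by (simp add: L2_norm_power2 nn_integral_eq_integral ennreal_leI)
  also have "\<dots> = (\<integral>\<^sup>+\<xi>. ennreal ((norm (fourier f \<xi>))\<^sup>2) \<partial>lborel)"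
    by (rule nn_integral_cong_AE) (use fourier_eq_fourier_integral[OF f f2] in \<open>eventually_elim, simp\<close>)
  also have "\<dots> \<le> (\<integral>\<^sup>+\<xi>. ennreal ((1 + (norm \<xi>)\<^sup>2) powr s) * ennreal ((norm (fourier f \<xi>))\<^sup>2) \<partial>lborel)"
  proof (rule nn_integral_mono)
    fix \<xi> :: "real^'n"
    have "1 \<le> (1 + (norm \<xi>)\<^sup>2) powr s" using s by (intro ge_one_powr_ge_zero) auto
    hence "1 * (norm (fourier f \<xi>))\<^sup>2 \<le> (1 + (norm \<xi>)\<^sup>2) powr s * (norm (fourier f \<xi>))\<^sup>2"
      by (intro mult_right_mono) auto
    thus "ennreal ((norm (fourier f \<xi>))\<^sup>2) \<le> ennreal ((1 + (norm \<xi>)\<^sup>2) powr s) * ennreal ((norm (fourier f \<xi>))\<^sup>2)"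
      by (simp add: ennreal_mult[symmetric] ennreal_leI)
  qed
  also have "\<dots> = (Hs_norm s f)\<^sup>2"
  proof -
    have "f \<in> L2_space lborel" "fourier_integral f \<in> L2_space lborel"
      using f2 plancherel_le(1)[OF f f2] by (auto simp: L2_space_iff)
    hence "fourier f \<in> L2_space lborel"
      by (rule fourier_eq_L2_limit(1)[where v="\<lambda>_. f"]) (use f f2 in auto)
    hence [measurable]: "fourier f \<in> borel_measurable borel" by (simp add: L2_space_def)
    show ?thesis
      unfolding Hs_norm_def L2_norm_power2 bessel_weight_def by (subst nn_integral_density) auto
  qed
  finally show ?thesis .
qed

text \<open>
  The energy of differences is what the bounds on the inverse operator are stated in, and the norm of
  the space is what the hypothesis of continuity controls. The difference has finite energy because
  both terms have.
\<close>

lemma weighted_energy_diff_le_Zdot_norm: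
  fixes f g :: "real ^ 'n::finite \<Rightarrow> real"
  assumes f: "f \<in> Zdot_space s r" and g: "g \<in> Zdot_space s r" and r: "2 * r > real CARD('n) + 2" "r \<le> s"
  shows "weighted_energy (2 * r) (\<lambda>x. f x - g x) < \<infinity>"
    and "weighted_energy (2 * r) (\<lambda>x. f x - g x) \<le> ennreal (2 powr (2 * r) * 2) * (Zdot_norm s r (\<lambda>x. f x - g x))\<^sup>2"
proof -
  have r0: "0 \<le> r" using r by linarith
  note F = Zdot_spaceD[OF f r0] and G = Zdot_spaceD[OF g r0]
  have [measurable]: "f \<in> borel_measurable borel" "g \<in> borel_measurable borel" by fact+
  let ?h = "\<lambda>x. f x - g x"
  have h: "?h \<in> borel_measurable borel" by measurable
  have "2 * weighted_energy (2 * r) f + 2 * weighted_energy (2 * r) g < \<infinity>"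
    using F G by (simp add: ennreal_mult_less_top)
  from le_less_trans[OF weighted_energy_diff_le this] show E: "weighted_energy (2 * r) ?h < \<infinity>" by simp
  note i = integrable_of_weighted_energy[OF h r(1) E]
  have "weighted_energy (2 * r) ?h \<le> ennreal (2 powr (2 * r)) * ((L2_norm lborel ?h)\<^sup>2 + (L2_norm (power_weight r) ?h)\<^sup>2)"
    by (rule weighted_energy_le[OF h r0])
  also have "\<dots> \<le> ennreal (2 powr (2 * r)) * ((Zdot_norm s r ?h)\<^sup>2 + (Zdot_norm s r ?h)\<^sup>2)"
  proof (intro mult_left_mono add_mono)
    have "(L2_norm lborel ?h)\<^sup>2 \<le> (Hs_norm s ?h)\<^sup>2" by (rule L2_norm_le_Hs_norm) (use i r r0 in auto)
    also have "\<dots> \<le> (Zdot_norm s r ?h)\<^sup>2" by (intro power_mono) (auto simp: Zdot_norm_def)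
    finally show "(L2_norm lborel ?h)\<^sup>2 \<le> (Zdot_norm s r ?h)\<^sup>2" .
    show "(L2_norm (power_weight r) ?h)\<^sup>2 \<le> (Zdot_norm s r ?h)\<^sup>2" by (intro power_mono) (auto simp: Zdot_norm_def)
  qed auto
  also have "\<dots> = ennreal (2 powr (2 * r) * 2) * (Zdot_norm s r ?h)\<^sup>2"
    by (simp add: ennreal_mult mult.assoc flip: mult_2)
  finally show "weighted_energy (2 * r) ?h \<le> ennreal (2 powr (2 * r) * 2) * (Zdot_norm s r ?h)\<^sup>2" .
qed

text \<open>
  A bounded linear operator maps continuous curves to continuous curves. Linearity holds almost
  everywhere, which is enough for the norm of the difference.
\<close>

lemma inv_nabla_C_into:
  fixes u :: "real \<Rightarrow> real ^ 'n::finite \<Rightarrow> real"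
  assumes d: "2 \<le> CARD('n)" and r0: "0 \<le> r0" "2 * r0 \<le> 3" "2 * r0 < real CARD('n)"
    and r: "2 * r > real CARD('n) + 7/2" "r \<le> s" and u: "u \<in> C_into T (Zdot_space s r) (Zdot_norm s r)"
  shows "(\<lambda>t. inv_nabla (u t)) \<in> C_into T (L2_space (power_weight r0)) (L2_norm (power_weight r0))"
proof -
  have rpos: "0 \<le> r" and r2: "2 * r > real CARD('n) + 2" using r by linarith+
  have uZ: "u t \<in> Zdot_space s r" if "t \<in> {0..T}" for t using u that by (auto simp: C_into_def)
  have ulim: "((\<lambda>t'. Zdot_norm s r (\<lambda>x. u t' x - u t x)) \<longlongrightarrow> 0) (at t within {0..T})" if "t \<in> {0..T}" for t
    using u that by (auto simp: C_into_def)
  note Z = Zdot_spaceD[OF uZ rpos]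
  obtain K where K: "0 \<le> K" and bound: "\<And>f :: real ^ 'n \<Rightarrow> real. f \<in> borel_measurable borel \<Longrightarrow> weighted_energy (2 * r) f < \<infinity> \<Longrightarrow> (LINT x|lborel. f x) = 0 \<Longrightarrow>
    weighted_square (2 * r0) (inv_nabla f) \<le> ennreal K * weighted_energy (2 * r) f"
    using inv_nabla_weighted_bound[of "2 * r0" "2 * r", where 'n='n] d r0 r by auto
  have L2: "inv_nabla (u t) \<in> L2_space (power_weight r0)" if t: "t \<in> {0..T}" for t
  proof -
    have [measurable]: "u t \<in> borel_measurable borel" by (rule Z(1)[OF t])
    have "(L2_norm (power_weight r0) (inv_nabla (u t)))\<^sup>2 = weighted_square (2 * r0) (inv_nabla (u t))"
      by (subst L2_norm_power_weight) auto
    also have "\<dots> \<le> ennreal K * weighted_energy (2 * r) (u t)" by (rule bound[OF Z[OF t]])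
    also have "\<dots> < \<infinity>" using Z(2)[OF t] by (simp add: ennreal_mult_less_top)
    finally have "L2_norm (power_weight r0) (inv_nabla (u t)) < \<infinity>"
      by (auto simp: less_top[symmetric] power2_eq_square ennreal_top_mult)
    thus ?thesis by (simp add: L2_space_def power_weight_def)
  qed
  have lim: "((\<lambda>t'. L2_norm (power_weight r0) (\<lambda>x. inv_nabla (u t') x - inv_nabla (u t) x)) \<longlongrightarrow> 0) (at t within {0..T})"
    if t: "t \<in> {0..T}" for t
  proof -
    let ?L = "\<lambda>t'. L2_norm (power_weight r0) (\<lambda>x. inv_nabla (u t') x - inv_nabla (u t) x)"
    let ?c = "ennreal (K * (2 powr (2 * r) * 2))"
    let ?N = "\<lambda>t'. Zdot_norm s r (\<lambda>x. u t' x - u t x)"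
    have le: "(?L t')\<^sup>2 \<le> ?c * (?N t')\<^sup>2"
      if t': "t' \<in> {0..T}" for t'
    proof -
      have [measurable]: "u t \<in> borel_measurable borel" "u t' \<in> borel_measurable borel" using Z(1) t t' by auto
      let ?h = "\<lambda>x. u t' x - u t x"
      have h0: "(LINT x|lborel. ?h x) = 0"
        using Z(3)[OF t] Z(3)[OF t'] integrable_of_weighted_energy(1)[OF Z(1)[OF t] r2 Z(2)[OF t]]
          integrable_of_weighted_energy(1)[OF Z(1)[OF t'] r2 Z(2)[OF t']] by simp
      have ae: "AE x in lborel. inv_nabla ?h x = inv_nabla (u t') x - inv_nabla (u t) x"
        by (rule inv_nabla_diff[OF d r(1) Z[OF t'] Z[OF t]])
      have "(?L t')\<^sup>2 =
        (\<integral>\<^sup>+x. ennreal (norm x powr (2 * r0) * (inv_nabla (u t') x - inv_nabla (u t) x)\<^sup>2) \<partial>lborel)"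
        by (subst L2_norm_power_weight) auto
      also have "\<dots> = weighted_square (2 * r0) (inv_nabla ?h)"
        by (rule nn_integral_cong_AE) (use ae in \<open>eventually_elim, simp\<close>)
      also have "\<dots> \<le> ennreal K * weighted_energy (2 * r) ?h"
        by (rule bound) (use h0 weighted_energy_diff_le_Zdot_norm(1)[OF uZ[OF t'] uZ[OF t] r2 r(2)] in auto)
      also have "\<dots> \<le> ennreal K * (ennreal (2 powr (2 * r) * 2) * (?N t')\<^sup>2)"
        by (intro mult_left_mono weighted_energy_diff_le_Zdot_norm(2)[OF uZ[OF t'] uZ[OF t] r2 r(2)]) auto
      also have "\<dots> = ?c * (?N t')\<^sup>2"
        using K by (simp add: ennreal_mult mult.assoc)
      finally show ?thesis .
    qed
    have "((\<lambda>t'. (?N t')\<^sup>2) \<longlongrightarrow> 0) (at t within {0..T})"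
      using ulim[OF t] by (simp add: ennreal_power2_tendsto_0_iff)
    hence "((\<lambda>t'. ?c * (?N t')\<^sup>2) \<longlongrightarrow> ?c * 0) (at t within {0..T})"
      by (intro ennreal_tendsto_cmult) auto
    hence lim2: "((\<lambda>t'. ?c * (?N t')\<^sup>2) \<longlongrightarrow> 0) (at t within {0..T})" by simp
    have "((\<lambda>t'. (?L t')\<^sup>2) \<longlongrightarrow> 0) (at t within {0..T})"
    proof (rule tendsto_sandwich[OF _ _ tendsto_const lim2])
      have "\<forall>\<^sub>F t' in at t within {0..T}. t' \<in> {0..T}" by (simp add: eventually_at_filter)
      thus "\<forall>\<^sub>F t' in at t within {0..T}. (?L t')\<^sup>2 \<le> ?c * (?N t')\<^sup>2"
        by eventually_elim (rule le)
    qed simp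
    thus ?thesis by (simp add: ennreal_power2_tendsto_0_iff)
  qed
  show ?thesis using L2 lim by (simp add: C_into_def)
qed

theorem corollary1p1:
  fixes k :: "'n::finite" and r0 :: real
  assumes "CARD('n) = 2 \<or> CARD('n) = 3"
    and "0 \<le> r0" and "r0 < real CARD('n) / 2"
  shows "\<exists>\<epsilon>>0. \<forall>(T::real) (r::real) (s::real)
      (u0 :: real ^ 'n \<Rightarrow> real) (u :: real \<Rightarrow> real ^ 'n \<Rightarrow> real).
    T > 0 \<longrightarrow> real CARD('n) / 2 + 2 - \<epsilon> \<le> r \<longrightarrow> r \<le> s \<longrightarrow>
    u \<in> C_into T (Zdot_space s r) (Zdot_norm s r) \<longrightarrow>
    duhamel_solution k T u0 u \<longrightarrow>
    (\<exists>v. (\<forall>t\<in>{0..T}. is_multiplier inv_nabla_symbol (u t) (v t)) \<and>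
         v \<in> C_into T (L2_space (power_weight r0)) (L2_norm (power_weight r0)))"
  \<comment> \<open>With \<open>\<epsilon> = 1/8\<close>, \<open>2 r \<ge> d + 15/4\<close>; any \<open>\<epsilon> < 1/4\<close> makes this exceed \<open>d + 7/2\<close>.\<close>
proof (intro exI[of _ "1/8"] conjI allI impI)
  fix T r s :: real and u0 :: "real ^ 'n \<Rightarrow> real" and u :: "real \<Rightarrow> real ^ 'n \<Rightarrow> real"
  assume r: "real CARD('n) / 2 + 2 - 1/8 \<le> r" "r \<le> s"
    and u: "u \<in> C_into T (Zdot_space s r) (Zdot_norm s r)"
  have d: "2 \<le> CARD('n)" "real CARD('n) \<le> 3" using assms(1) by auto
  have p: "2 * r > real CARD('n) + 7/2" using r by simp
  have "is_multiplier inv_nabla_symbol (u t) (inv_nabla (u t))" if "t \<in> {0..T}" for t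
  proof (rule is_multiplier_inv_nabla[OF d(1) p])
    have "u t \<in> Zdot_space s r" using u that by (auto simp: C_into_def)
    thus "u t \<in> borel_measurable borel" "weighted_energy (2 * r) (u t) < \<infinity>" "(LINT x|lborel. u t x) = 0"
      using Zdot_spaceD[of "u t" s r] p by auto
  qed
  moreover have "(\<lambda>t. inv_nabla (u t)) \<in> C_into T (L2_space (power_weight r0)) (L2_norm (power_weight r0))"
    by (rule inv_nabla_C_into[OF d(1) _ _ _ p r(2) u]) (use assms d in auto)
  ultimately show "\<exists>v. (\<forall>t\<in>{0..T}. is_multiplier inv_nabla_symbol (u t) (v t)) \<and>
         v \<in> C_into T (L2_space (power_weight r0)) (L2_norm (power_weight r0))"
    by (intro exI[of _ "\<lambda>t. inv_nabla (u t)"]) auto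
qed simp

end
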